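(* Let $\mathbf X=(X(t))_{t\in\mathbb R}$ be a stochastic process with continuous paths. For $T>0$ let $\mathcal L_{loc,T}$ be the set of all local intrinsic location functionals on $\mathcal C(\mathbb R)$ with related length $T$. Then the following are equivalent: (1) The process $\mathbf X$ is stationary. (2) For any $T>0$ and any $L_T\in\mathcal L_{loc,T}$, the distribution of $L_T(\mathbf X,a)-a$ does not depend on $a\in\mathbb R$. (3) For any $T>0$, any $L_T\in\mathcal L_{loc,T}$ and any $a\in\mathbb R$, $L_T(\mathbf X,a)$ admits a density function in $(a,a+T)$ which satisfies the total variation constraints on $[a,a+T]$.
   Context: $\mathcal C(\mathbb R)$ is the space of continuous real functions on $\mathbb R$ with the cylindrical $\sigma$-field; $\theta_cf(x)=f(x+c)$. $\mathbb R\cup\{\infty\}$ carries the $\sigma$-field generated by the Borel sets of $\mathbb R$ and $\{\infty\}$; $\infty+c=\infty$. Local intrinsic location functional on $H=\mathcal C(\mathbb R)$ with related length $T>0$: a map $L_T:H\times\mathbb R\to\mathbb R\cup\{\infty\}$ such that (1) for every $a\in\mathbb R$, $L_T(\cdot,a):H\to\mathbb R\cup\{\infty\}$ is measurable; (2) $L_T(f,a)\in[a,a+T]\cup\{\infty\}$ for all $f\in H$, $a\in\mathbb R$; (3) $L_T(f,a)=L_T(\theta_cf,a-c)+c$ for all $f\in H$, $a,c\in\mathbb R$; (4) for all $f\in H$, $a,b\in\mathbb R$, $L_T(f,a)\in[b,b+T]$ implies that either $L_T(f,b)=L_T(f,a)$ or $L_T(f,b)\in[b,b+T]\setminus[a,a+T]$.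 Total variation constraints on $[a,b]$: for a density $f$ on $(a,b)$ (taken right continuous with left limits $f(t-)$, and for which $f(a+)=\lim_{t\downarrow a}f(t)$ and $f(b-)=\lim_{t\uparrow b}f(t)$ exist in $[0,\infty]$), and $a\le u<v\le b$, put $TV_{(u,v)}(f)=\sup\sum_{i=1}^{n-1}|f(s_{i+1})-f(s_i)|$ and $TV^{\pm}_{(u,v)}(f)=\sup\sum_{i=1}^{n-1}(f(s_{i+1})-f(s_i))_{\pm}$ (positive/negative parts), suprema over all $u<s_1<\dots<s_n<v$. The constraints are: (i) for all $a<t_1<t_2<b$, $TV_{(t_1,t_2)}(f)\le\min(f(t_1),f(t_1-))+\min(f(t_2),f(t_2-))$; (ii) for all $0<\varepsilon<b-a$, $TV^+_{(a,a+\varepsilon)}(f)\le\min(f(a+\varepsilon),f((a+\varepsilon)-))$ and $TV^-_{(b-\varepsilon,b)}(f)\le\min(f(b-\varepsilon),f((b-\varepsilon)-))$; (iii) $f(a+)<\infty$ if and only if $TV_{(a,a+\varepsilon)}(f)<\infty$ for some (equivalently, any) $0<\varepsilon<b-a$, in which case $TV_{(a,a+\varepsilon)}(f)\le f(a+)+\min(f(a+\varepsilon),f((a+\varepsilon)-))$; and $f(b-)<\infty$ if and only if $TV_{(b-\varepsilon,b)}(f)<\infty$ for some (equivalently, any) $0<\varepsilon<b-a$, in which case $TV_{(b-\varepsilon,b)}(f)\le\min(f(b-\varepsilon),f((b-\varepsilon)-))+f(b-)$. *)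

theory Defs
  imports "HOL-Probability.Probability"
begin

definition sample_path :: "(real \<Rightarrow> 'w \<Rightarrow> real) \<Rightarrow> 'w \<Rightarrow> real \<Rightarrow> real" where
  "sample_path X \<omega> = (\<lambda>t. X t \<omega>)"

definition shift :: "real \<Rightarrow> (real \<Rightarrow> real) \<Rightarrow> real \<Rightarrow> real" where
  "shift c f = (\<lambda>x. f (x + c))"

definition stationary_process :: "'w measure \<Rightarrow> (real \<Rightarrow> 'w \<Rightarrow> real) \<Rightarrow> bool" where
  "stationary_process M X \<longleftrightarrow>
     (\<forall>J c. finite J \<longrightarrow>
        distr M (PiM J (\<lambda>_. borel)) (\<lambda>\<omega>. \<lambda>t\<in>J. X (t + c) \<omega>) =
        distr M (PiM J (\<lambda>_. borel)) (\<lambda>\<omega>. \<lambda>t\<in>J. X t \<omega>))"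

abbreviation C_real :: "(real \<Rightarrow> real) set" where
  "C_real \<equiv> {f. continuous_on UNIV f}"

definition C_cyl :: "(real \<Rightarrow> real) measure" where
  "C_cyl = restrict_space (PiM UNIV (\<lambda>_. borel)) C_real"

text \<open>The real line with one point \<open>\<infinity>\<close> added, realised inside \<^typ>\<open>ereal\<close> without \<open>- \<infinity>\<close>.\<close>

definition real_inf :: "ereal measure" where
  "real_inf = sigma (insert \<infinity> (range ereal)) (insert {\<infinity>} {ereal ` B | B. B \<in> sets borel})"

text \<open>Location functionals are total functions in HOL; only their values on \<^term>\<open>C_real\<close> are
  constrained.\<close>

definition local_intrinsic_location :: "real \<Rightarrow> ((real \<Rightarrow> real) \<Rightarrow> real \<Rightarrow> ereal) set" where
  "local_intrinsic_location T = {L.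
     (\<forall>a. (\<lambda>f. L f a) \<in> C_cyl \<rightarrow>\<^sub>M real_inf) \<and>
     (\<forall>f\<in>C_real. \<forall>a. L f a \<in> {ereal a..ereal (a + T)} \<union> {\<infinity>}) \<and>
     (\<forall>f\<in>C_real. \<forall>a c. L f a = L (shift c f) (a - c) + ereal c) \<and>
     (\<forall>f\<in>C_real. \<forall>a b. L f a \<in> {ereal b..ereal (b + T)} \<longrightarrow>
        L f b = L f a \<or>
        L f b \<in> {ereal b..ereal (b + T)} - {ereal a..ereal (a + T)})}"

definition has_density_on ::
    "'w measure \<Rightarrow> ('w \<Rightarrow> ereal) \<Rightarrow> real \<Rightarrow> real \<Rightarrow> (real \<Rightarrow> real) \<Rightarrow> bool" where
  "has_density_on M Y a b f \<longleftrightarrow>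
     f \<in> borel_measurable (restrict_space borel {a<..<b}) \<and>
     (\<forall>t\<in>{a<..<b}. 0 \<le> f t) \<and>
     (\<forall>B\<in>sets borel. B \<subseteq> {a<..<b} \<longrightarrow>
        emeasure M {\<omega> \<in> space M. Y \<omega> \<in> ereal ` B} = (\<integral>\<^sup>+t\<in>B. ennreal (f t) \<partial>lborel))"

text \<open>The supremum over \<open>u < s\<^sub>1 < \<dots> < s\<^sub>n < v\<close> of the sum of
  \<open>\<phi> (f s\<^sub>i\<^sub>+\<^sub>1 - f s\<^sub>i)\<close>; admitting the empty list adds only the value 0.\<close>

definition variation ::
    "(real \<Rightarrow> real) \<Rightarrow> (real \<Rightarrow> real) \<Rightarrow> real \<Rightarrow> real \<Rightarrow> ennreal" where
  "variation \<phi> f u v =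
     (SUP s\<in>{s. sorted_wrt (<) s \<and> set s \<subseteq> {u<..<v}}.
        \<Sum>i<length s - 1. ennreal (\<phi> (f (s ! Suc i) - f (s ! i))))"

definition TV :: "(real \<Rightarrow> real) \<Rightarrow> real \<Rightarrow> real \<Rightarrow> ennreal" where
  "TV = variation (\<lambda>d. \<bar>d\<bar>)"

definition TV_pos :: "(real \<Rightarrow> real) \<Rightarrow> real \<Rightarrow> real \<Rightarrow> ennreal" where
  "TV_pos = variation (\<lambda>d. max d 0)"

definition TV_neg :: "(real \<Rightarrow> real) \<Rightarrow> real \<Rightarrow> real \<Rightarrow> ennreal" where
  "TV_neg = variation (\<lambda>d. max (- d) 0)"

definition cadlag_on :: "real \<Rightarrow> real \<Rightarrow> (real \<Rightarrow> real) \<Rightarrow> bool" where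
  "cadlag_on a b f \<longleftrightarrow>
     (\<forall>t\<in>{a<..<b}. continuous (at_right t) f \<and> (\<exists>l. (f \<longlongrightarrow> l) (at_left t)))"

definition left_lim :: "(real \<Rightarrow> real) \<Rightarrow> real \<Rightarrow> real" where
  "left_lim f t = Lim (at_left t) f"

text \<open>One-sided limits at the end points of the interval, with values in \<open>[0, \<infinity>]\<close>.\<close>

definition end_right :: "(real \<Rightarrow> real) \<Rightarrow> real \<Rightarrow> ennreal" where
  "end_right f a = Lim (at_right a) (\<lambda>t. ennreal (f t))"

definition end_left :: "(real \<Rightarrow> real) \<Rightarrow> real \<Rightarrow> ennreal" where
  "end_left f b = Lim (at_left b) (\<lambda>t. ennreal (f t))"

definition low :: "(real \<Rightarrow> real) \<Rightarrow> real \<Rightarrow> ennreal" where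
  "low f t = ennreal (min (f t) (left_lim f t))"

text \<open>The regularity under which the constraints make sense (right continuity, left limits, limits
  at the end points) is part of the predicate. In the finiteness criteria the quantifier
  \<open>\<exists>\<epsilon>\<close> may be replaced by \<open>\<forall>\<epsilon>\<close> because the first constraint bounds the variation away
  from the end points.\<close>

definition TV_constraints :: "real \<Rightarrow> real \<Rightarrow> (real \<Rightarrow> real) \<Rightarrow> bool" where
  "TV_constraints a b f \<longleftrightarrow>
     cadlag_on a b f \<and>
     (\<exists>l. ((\<lambda>t. ennreal (f t)) \<longlongrightarrow> l) (at_right a)) \<and>
     (\<exists>l. ((\<lambda>t. ennreal (f t)) \<longlongrightarrow> l) (at_left b)) \<and>
     (\<forall>t1 t2. a < t1 \<and> t1 < t2 \<and> t2 < b \<longrightarrow> TV f t1 t2 \<le> low f t1 + low f t2) \<and>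
     (\<forall>\<epsilon>\<in>{0<..<b - a}.
        TV_pos f a (a + \<epsilon>) \<le> low f (a + \<epsilon>) \<and>
        TV_neg f (b - \<epsilon>) b \<le> low f (b - \<epsilon>)) \<and>
     (end_right f a < \<infinity> \<longleftrightarrow> (\<exists>\<epsilon>\<in>{0<..<b - a}. TV f a (a + \<epsilon>) < \<infinity>)) \<and>
     (end_right f a < \<infinity> \<longrightarrow>
        (\<forall>\<epsilon>\<in>{0<..<b - a}. TV f a (a + \<epsilon>) \<le> end_right f a + low f (a + \<epsilon>))) \<and>
     (end_left f b < \<infinity> \<longleftrightarrow> (\<exists>\<epsilon>\<in>{0<..<b - a}. TV f (b - \<epsilon>) b < \<infinity>)) \<and>
     (end_left f b < \<infinity> \<longrightarrow>
        (\<forall>\<epsilon>\<in>{0<..<b - a}. TV f (b - \<epsilon>) b \<le> low f (b - \<epsilon>) + end_left f b))"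

end

theory Submission
  imports Defs
begin

text \<open>
  Stationary implies the constraints. Let \<open>\<nu>\<close> be the law of the location \<open>L\<close> for the window
  \<open>[a, a + T]\<close>. Shifting the window by \<open>h\<close> keeps \<open>\<nu>\<close> up to translation, and by consistency the location
  can only change by jumping to a point entering on the right, or by having been a point leaving on the
  left. Since the mass to the right (left) of any \<open>t\<close> is conserved, these jumps are compensated by the
  mass that crosses \<open>t\<close>, so the difference quotient \<open>\<nu>(x, x + h] / h\<close> has positive variation below \<open>t\<close> and
  negative variation above \<open>t\<close> at most its value at \<open>t\<close>. These two bounds survive the limit
  \<open>h = 2\<^sup>-\<^sup>n \<rightarrow> 0\<close>, which exists almost everywhere because consecutive quotients differ by \<open>O(h)\<close> in \<open>L\<^sup>1\<close>,
  and they imply all the other constraints.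

  The constraints imply stationarity. Let a set \<open>N\<close> of times depend on the path in a shift equivariant
  way and have gaps larger than \<open>D\<close>. The constraints give \<open>f r \<le> f s + f z\<close> for \<open>s < r < z\<close>; letting
  \<open>T \<rightarrow> \<infinity>\<close>, the density of the first point of \<open>N\<close> after a given time is nonincreasing and that of the last
  point before a given time is nondecreasing, so \<open>N\<close> has constant intensity. Applied to the ends of the
  gaps of length at least \<open>D\<close> of a closed hitting set \<open>{t. h t \<le> 0}\<close>, this shows that the law of the
  waiting time for a hit, on the event that it is positive and finite, does not depend on the starting time;
  the probability of never hitting after \<open>s\<close> is monotone in \<open>s\<close>, hence so is the probability of \<open>h s > 0\<close>.
  Exchanging the roles of \<open>h\<close> and \<open>1/n - h\<close> shows that it is constant.
\<close>

section \<open>Variation of real functions\<close>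

text \<open>The third condition speaks of the open window only, so it is blind to the event that a
  location sits at the left end of its window. That event is what the second condition exploits at
  once: the first point of \<open>{t. h t \<le> 0}\<close> in \<open>[a, a + 1]\<close> is
  \<open>a\<close> iff \<open>h a \<le> 0\<close>. Recovering its probability from densities is what
  forces the detour through waiting times. The hitting set itself cannot be used there, since it may
  be a perfect set; the ends of its long gaps are isolated, and whether such an end falls in a short
  interval can be read from a first point as well as from a last point, in windows that are
  arbitrarily long on the far side.

  In the other direction no density is known beforehand. The variation bounds are therefore proved
  for quotients of a fixed width \<open>h\<close>, where they compare probabilities of events;
  existence of the density, its regularity and its constraints all come from these two bounds.
  Widths are halved because a quotient of width \<open>2 * h\<close> is the mean of two quotients of
  width \<open>h\<close>, so that successive quotients differ by half a translation
  difference.\<close>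

fun incr :: "(real \<Rightarrow> real) \<Rightarrow> real list \<Rightarrow> real" where
  "incr f (x # y # xs) = max (f y - f x) 0 + incr f (y # xs)"
| "incr f _ = 0"

lemma incr_Cons: "incr f (x # xs) = (if xs = [] then 0 else max (f (hd xs) - f x) 0 + incr f xs)"
  by (cases xs) auto

lemma incr_snoc: "incr f (xs @ [x]) = incr f xs + (if xs = [] then 0 else max (f x - f (last xs)) 0)"
  by (induction xs) (auto simp: incr_Cons hd_append)

lemma incr_map: "incr f (map r xs) = incr (\<lambda>x. f (r x)) xs"
  by (induction xs) (auto simp: incr_Cons hd_map)

lemma incr_cong: "(\<And>x. x \<in> set xs \<Longrightarrow> f x = g x) \<Longrightarrow> incr f xs = incr g xs"
  by (induction xs) (auto simp: incr_Cons)

lemma incr_sum: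
  "(\<Sum>i<length xs - 1. max (f (xs ! Suc i) - f (xs ! i)) 0) = incr f xs"
proof (induction f xs rule: incr.induct)
  case (1 f x y xs)
  then show ?case by (simp add: sum.lessThan_Suc_shift del: sum.lessThan_Suc)
qed auto

text \<open>Rises minus falls telescope. This trades falls for rises and end values, so that a bound
  on the rises alone can control the total variation.\<close>

lemma incr_minus: "xs \<noteq> [] \<Longrightarrow> incr f xs - incr (\<lambda>x. - f x) xs = f (last xs) - f (hd xs)"
proof (induction xs)
  case (Cons x xs)
  then show ?case by (cases "xs = []") (auto simp: incr_Cons max_def)
qed auto

text \<open>In the application \<open>A\<close> is a rescaled jump probability, additive over
  adjacent strips: its increments are known exactly, whereas those of \<open>f\<close> are only
  bounded by them.\<close>

lemma incr_le_telescope: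
  assumes "sorted xs" "xs \<noteq> []"
    and "\<And>x y. x \<in> set xs \<Longrightarrow> y \<in> set xs \<Longrightarrow> x \<le> y \<Longrightarrow> max (f y - f x) 0 \<le> A y - A x"
  shows "incr f xs \<le> A (last xs) - A (hd xs)"
  using assms
proof (induction xs)
  case (Cons x xs)
  show ?case
  proof (cases "xs = []")
    case False
    have "incr f xs \<le> A (last xs) - A (hd xs)"
      using Cons.IH Cons.prems False by auto
    moreover have "max (f (hd xs) - f x) 0 \<le> A (hd xs) - A x"
      using Cons.prems False by (intro Cons.prems) auto
    moreover have "incr f (x # xs) = max (f (hd xs) - f x) 0 + incr f xs"
      using False by (simp add: incr_Cons)
    ultimately show ?thesis using False by (simp del: max.bounded_iff)
  qed auto
qed auto

lemma tendsto_incr: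
  assumes "\<And>x. x \<in> set xs \<Longrightarrow> ((\<lambda>k. F k x) \<longlongrightarrow> f x) net"
  shows "((\<lambda>k. incr (F k) xs) \<longlongrightarrow> incr f xs) net"
  using assms
proof (induction f xs rule: incr.induct)
  case (1 f x y xs)
  have "((\<lambda>k. max (F k y - F k x) 0 + incr (F k) (y # xs)) \<longlongrightarrow> max (f y - f x) 0 + incr f (y # xs)) net"
    using 1 by (intro tendsto_intros) auto
  then show ?case by simp
qed auto

text \<open>A supremum in \<open>ennreal\<close> lies below \<open>c\<close> iff every finite sum
  does, and each finite sum is the real number \<open>incr f xs\<close>. From here on all estimates
  are made on lists in the reals.\<close>

lemma TV_pos_le_iff:
  "TV_pos f u v \<le> c \<longleftrightarrow>
   (\<forall>xs. sorted_wrt (<) xs \<and> set xs \<subseteq> {u<..<v} \<longrightarrow> ennreal (incr f xs) \<le> c)"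
proof -
  have "(\<Sum>i<length xs - 1. ennreal (max (f (xs ! Suc i) - f (xs ! i)) 0)) = ennreal (incr f xs)" for xs
    by (subst incr_sum[symmetric], rule sum_ennreal) simp
  then show ?thesis by (auto simp: TV_pos_def variation_def SUP_le_iff)
qed

lemma TV_neg_le_iff:
  "TV_neg f u v \<le> c \<longleftrightarrow>
   (\<forall>xs. sorted_wrt (<) xs \<and> set xs \<subseteq> {u<..<v} \<longrightarrow> ennreal (incr (\<lambda>x. - f x) xs) \<le> c)"
proof -
  have "(\<Sum>i<length xs - 1. ennreal (max (- (f (xs ! Suc i) - f (xs ! i))) 0)) = ennreal (incr (\<lambda>x. - f x) xs)" for xs
  proof -
    have "- (f (xs ! Suc i) - f (xs ! i)) = - f (xs ! Suc i) - - f (xs ! i)" for i by simp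
    then show ?thesis by (subst incr_sum[symmetric]) (simp only: sum_ennreal max.cobounded2)
  qed
  then show ?thesis by (auto simp: TV_neg_def variation_def SUP_le_iff)
qed

lemma TV_le_iff:
  "TV f u v \<le> c \<longleftrightarrow>
   (\<forall>xs. sorted_wrt (<) xs \<and> set xs \<subseteq> {u<..<v} \<longrightarrow>
      ennreal (incr f xs + incr (\<lambda>x. - f x) xs) \<le> c)"
proof -
  have "(\<Sum>i<length xs - 1. ennreal \<bar>f (xs ! Suc i) - f (xs ! i)\<bar>) =
      ennreal (incr f xs + incr (\<lambda>x. - f x) xs)" for xs
    by (subst incr_sum[symmetric], subst incr_sum[symmetric])
       (auto simp: sum_ennreal sum.distrib[symmetric] intro!: arg_cong[where f=ennreal] sum.cong)
  then show ?thesis by (auto simp: TV_def variation_def SUP_le_iff)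
qed

text \<open>Folding \<open>K\<close> adjacent intervals of length \<open>h\<close> onto the first
  one puts the values of \<open>g\<close> on a grid of step \<open>h\<close> into one sum, which can
  then be bounded as a variation.\<close>

lemma nn_integral_periodic_split:
  fixes g :: "real \<Rightarrow> ennreal"
  assumes [measurable]: "g \<in> borel_measurable borel" and "0 \<le> h"
  shows "(\<integral>\<^sup>+s. g s * indicator {x..<x + real K * h} s \<partial>lborel) =
    (\<integral>\<^sup>+s. (\<Sum>k<K. g (s + real k * h)) * indicator {x..<x + h} s \<partial>lborel)"
proof (induction K)
  case (Suc K)
  have split: "(indicator {x..<w} s :: ennreal) = indicator {x..<u} s + indicator {u..<w} s"
    if "x \<le> u" "u \<le> w" for u w s :: real
    using that by (auto simp: indicator_def)
  have le: "x \<le> x + real K * h" "x + real K * h \<le> x + real (Suc K) * h"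
    using \<open>0 \<le> h\<close> by (simp_all add: mult_right_mono)
  have "(\<integral>\<^sup>+s. g s * indicator {x..<x + real (Suc K) * h} s \<partial>lborel) =
    (\<integral>\<^sup>+s. g s * indicator {x..<x + real K * h} s
        + g s * indicator {x + real K * h..<x + real (Suc K) * h} s \<partial>lborel)"
    by (simp only: split[OF le] distrib_left)
  also have "\<dots> = (\<integral>\<^sup>+s. g s * indicator {x..<x + real K * h} s \<partial>lborel) +
    (\<integral>\<^sup>+s. g s * indicator {x + real K * h..<x + real (Suc K) * h} s \<partial>lborel)"
    by (rule nn_integral_add) auto
  also have "(\<integral>\<^sup>+s. g s * indicator {x + real K * h..<x + real (Suc K) * h} s \<partial>lborel) =
    (\<integral>\<^sup>+s. g (s + real K * h) * indicator {x..<x + h} s \<partial>lborel)"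
    by (subst nn_integral_real_affine[of _ 1 "real K * h"])
       (auto intro!: nn_integral_cong simp: indicator_def algebra_simps)
  also have "(\<integral>\<^sup>+s. g s * indicator {x..<x + real K * h} s \<partial>lborel) + \<dots> =
     (\<integral>\<^sup>+s. (\<Sum>k<K. g (s + real k * h)) * indicator {x..<x + h} s
        + g (s + real K * h) * indicator {x..<x + h} s \<partial>lborel)"
    unfolding Suc.IH by (rule nn_integral_add[symmetric]) auto
  finally show ?case by (simp add: distrib_right)
qed simp

section \<open>Difference quotients whose rises and falls are bounded\<close>

definition slope :: "real measure \<Rightarrow> real \<Rightarrow> real \<Rightarrow> real" where
  "slope \<nu> h x = (cdf \<nu> (x + h) - cdf \<nu> x) / h"

text \<open>The one-sided variation constraints at a positive width. The list in \<open>rise\<close>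
  keeps the distance \<open>h\<close> from \<open>t\<close> while the list in \<open>fall\<close>
  may start at \<open>t\<close>, because a quotient at \<open>x\<close> looks to the right, at the
  mass of \<open>(x, x + h]\<close>.\<close>

locale bounded_slope_variation = finite_borel_measure \<nu> for \<nu> :: "real measure" +
  fixes a b :: real
  assumes ab: "a < b"
    and rise: "\<And>h t xs. 0 < h \<Longrightarrow> t + h \<le> b \<Longrightarrow> sorted xs \<Longrightarrow> set xs \<subseteq> {a<..t - h} \<Longrightarrow>
      incr (slope \<nu> h) xs \<le> slope \<nu> h t"
    and fall: "\<And>h t xs. 0 < h \<Longrightarrow> a + h \<le> t \<Longrightarrow> sorted xs \<Longrightarrow> set xs \<subseteq> {t..b - h} \<Longrightarrow>
      incr (\<lambda>x. - slope \<nu> h x) xs \<le> slope \<nu> h t"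
begin

lemma slope_nonneg: "0 < h \<Longrightarrow> 0 \<le> slope \<nu> h x"
  by (auto simp: slope_def intro!: divide_nonneg_pos cdf_nondecreasing)

text \<open>The quotient of width \<open>2 * h\<close> at \<open>x\<close> is the mean of the
  quotients of width \<open>h\<close> at \<open>x\<close> and \<open>x + h\<close>.\<close>

lemma slope_double:
  "slope \<nu> (2 * h) x - slope \<nu> h x = (slope \<nu> h (x + h) - slope \<nu> h x) / 2"
  by (cases "h = 0") (auto simp: slope_def field_simps)

text \<open>The \<open>n\<close> windows are adjacent and disjoint, so their masses add up to at
  most the total mass and one of them gets at most the average.\<close>

lemma slope_pigeonhole:
  assumes "0 < h" "0 < n"
  shows "\<exists>k<n. slope \<nu> h (x + real k * h) \<le> measure \<nu> (space \<nu>) / (real n * h)"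
proof (rule ccontr)
  assume "\<not> ?thesis"
  then have "\<And>k. k < n \<Longrightarrow> measure \<nu> (space \<nu>) / real n < h * slope \<nu> h (x + real k * h)"
    using assms by (auto simp: field_simps not_le)
  then have "(\<Sum>k<n. measure \<nu> (space \<nu>) / real n) < (\<Sum>k<n. h * slope \<nu> h (x + real k * h))"
    using assms by (intro sum_strict_mono) auto
  also have "\<dots> = (\<Sum>k<n. cdf \<nu> (x + real (Suc k) * h) - cdf \<nu> (x + real k * h))"
    using assms by (intro sum.cong) (simp_all add: slope_def distrib_right add_ac)
  also have "\<dots> = cdf \<nu> (x + real n * h) - cdf \<nu> (x + real 0 * h)"
    by (rule sum_lessThan_telescope)
  also have "\<dots> \<le> measure \<nu> (space \<nu>)"
    using cdf_bounded[of "x + real n * h"] cdf_nonneg[of "x + real 0 * h"] by linarith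
  finally show False using assms by simp
qed

text \<open>The pigeonhole gives a point \<open>l\<close> to the left of \<open>x\<close> and a
  point \<open>r\<close> to the right of \<open>y\<close> with small quotients. Then
  \<open>rise\<close> for the two-point list \<open>[l, s]\<close> yields
  \<open>slope s - slope l \<le> slope r\<close>, whence a bound by the sum of two small
  values.\<close>

lemma slope_bounded:
  assumes "a < x" "x \<le> y" "y < b"
  shows "\<exists>C>0. \<exists>\<delta>>0. \<forall>h s. 0 < h \<and> h < \<delta> \<and> x \<le> s \<and> s \<le> y \<longrightarrow> slope \<nu> h s \<le> C"
proof -
  \<comment> \<open>With a quarter of the smaller margin, the grids of length at most
    \<open>d\<close> that start at \<open>x - 2 * d\<close> and \<open>y + d\<close> stay inside
    \<open>(a, b)\<close>, with room for one more window of width \<open>h\<close> on the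
    right.\<close>
  define d where "d = min (x - a) (b - y) / 4"
  have d: "0 < d" "4 * d \<le> x - a" "4 * d \<le> b - y" using assms by (auto simp: d_def)
  define m where "m = measure \<nu> (space \<nu>)"
  have m: "0 \<le> m" by (simp add: m_def)
  have "slope \<nu> h s \<le> 4 * m / d + 1" if h: "0 < h" "h < d / 2" and s: "x \<le> s" "s \<le> y" for h s
  proof -
    \<comment> \<open>This choice keeps \<open>n * h\<close> between \<open>d / 2\<close> and
      \<open>d\<close>: the grid fits into the margin, and the average is at most
      \<open>2 * m / d\<close>.\<close>
    define n where "n = nat \<lfloor>d / h\<rfloor>"
    have rn: "real n = of_int \<lfloor>d / h\<rfloor>" using d h by (simp add: n_def)
    have n1: "real n * h \<le> d" using rn h by (metis of_int_floor_le pos_le_divide_eq)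
    have "d / h < real n + 1" using rn by linarith
    then have "d < real n * h + h" using h by (simp add: field_simps)
    then have n2: "d / 2 \<le> real n * h" using h by linarith
    then have n0: "0 < n" using d by (cases n) auto
    have le: "m / (real n * h) \<le> 2 * m / d"
      using frac_le[of m m "d / 2" "real n * h"] n2 d m by (simp add: mult.commute)
    have kn: "real k * h \<le> d" if "k < n" for k
      using that n1 h by (smt (verit) mult_right_mono of_nat_less_iff)
    obtain k where k: "k < n" "slope \<nu> h (x - 2 * d + real k * h) \<le> 2 * m / d"
      using slope_pigeonhole[OF h(1) n0, of "x - 2 * d"] le unfolding m_def by fastforce
    obtain j where j: "j < n" "slope \<nu> h (y + d + real j * h) \<le> 2 * m / d"
      using slope_pigeonhole[OF h(1) n0, of "y + d"] le unfolding m_def by fastforce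
    let ?l = "x - 2 * d + real k * h" and ?r = "y + d + real j * h"
    have "0 \<le> real k * h" "0 \<le> real j * h" using h by auto
    then have "a < ?l" "?l \<le> s" "s \<le> ?r - h" "?r + h \<le> b"
      using kn[OF k(1)] kn[OF j(1)] d h s by linarith+
    then have "incr (slope \<nu> h) [?l, s] \<le> slope \<nu> h ?r"
      using h by (intro rise) auto
    then show ?thesis using k j by simp
  qed
  \<comment> \<open>The summand 1 keeps the constant positive when the measure is zero.\<close>
  moreover have "0 < 4 * m / d + 1" using m d by (smt (verit) divide_nonneg_pos)
  ultimately show ?thesis using d by (intro exI[of _ "4 * m / d + 1"] conjI exI[of _ "d / 2"]) auto
qed

text \<open>Rises on \<open>[x, y]\<close> are paid for by the quotient at a point \<open>r\<close>
  beyond \<open>y\<close>, falls by the quotient at a point \<open>l\<close> before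
  \<open>x\<close>, and both quotients are bounded uniformly in \<open>h\<close>.\<close>

lemma slope_variation:
  assumes "a < x" "x \<le> y" "y < b"
  shows "\<exists>C>0. \<exists>\<delta>>0. \<forall>h xs. 0 < h \<and> h < \<delta> \<and> sorted xs \<and> set xs \<subseteq> {x..y} \<longrightarrow>
    incr (slope \<nu> h) xs + incr (\<lambda>x. - slope \<nu> h x) xs \<le> C"
proof -
  define l where "l = (a + x) / 2"
  define r where "r = (y + b) / 2"
  have lr: "a < l" "l < x" "y < r" "r < b" "l \<le> r" using assms by (auto simp: l_def r_def)
  obtain C \<delta> where C: "0 < C" "0 < \<delta>"
    "\<And>h s. 0 < h \<Longrightarrow> h < \<delta> \<Longrightarrow> l \<le> s \<Longrightarrow> s \<le> r \<Longrightarrow> slope \<nu> h s \<le> C"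
    using slope_bounded[of l r] lr by blast
  define \<epsilon> where "\<epsilon> = Min {\<delta>, l - a, r - y, b - r, b - y}"
  have \<epsilon>: "0 < \<epsilon>" "\<epsilon> \<le> \<delta>" "\<epsilon> \<le> l - a" "\<epsilon> \<le> r - y" "\<epsilon> \<le> b - r" "\<epsilon> \<le> b - y"
    using C lr assms by (auto simp: \<epsilon>_def)
  have "incr (slope \<nu> h) xs + incr (\<lambda>x. - slope \<nu> h x) xs \<le> 2 * C"
    if "0 < h" "h < \<epsilon>" "sorted xs" "set xs \<subseteq> {x..y}" for h xs
  proof -
    have "incr (slope \<nu> h) xs \<le> slope \<nu> h r"
      using that \<epsilon> lr by (intro rise) force+
    moreover have "incr (\<lambda>x. - slope \<nu> h x) xs \<le> slope \<nu> h l"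
      using that \<epsilon> lr by (intro fall) force+
    ultimately show ?thesis using C(3)[of h l] C(3)[of h r] that \<epsilon> lr by linarith
  qed
  then show ?thesis using C \<epsilon> by (intro exI[of _ "2 * C"] conjI exI[of _ \<epsilon>]) auto
qed

lemma measurable_slope [measurable]: "slope \<nu> h \<in> borel_measurable borel"
proof -
  have [measurable]: "cdf \<nu> \<in> borel_measurable borel"
    by (rule borel_measurable_mono) (simp add: mono_def cdf_nondecreasing)
  show ?thesis unfolding slope_def by measurable
qed

text \<open>A function of bounded variation moves by \<open>O(h)\<close> in the \<open>L^1\<close>
  norm under translation by \<open>h\<close>: after folding, the integrand is the variation along a
  grid of step \<open>h\<close>, bounded by a constant on an interval of length
  \<open>h\<close>.\<close>

lemma slope_translate:
  assumes "a < x" "x \<le> y" "y < b"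
  shows "\<exists>C>0. \<exists>\<delta>>0. \<forall>h. 0 < h \<and> h < \<delta> \<longrightarrow>
    (\<integral>\<^sup>+s. ennreal \<bar>slope \<nu> h (s + h) - slope \<nu> h s\<bar> * indicator {x..y} s \<partial>lborel) \<le> ennreal (C * h)"
proof -
  define r where "r = (y + b) / 2"
  have r: "y < r" "r < b" using assms by (auto simp: r_def)
  obtain C \<delta> where C: "0 < C" "0 < \<delta>"
    "\<And>h xs. 0 < h \<Longrightarrow> h < \<delta> \<Longrightarrow> sorted xs \<Longrightarrow> set xs \<subseteq> {x..r} \<Longrightarrow>
      incr (slope \<nu> h) xs + incr (\<lambda>x. - slope \<nu> h x) xs \<le> C"
    using slope_variation[of x r] assms r by fastforce
  \<comment> \<open>The grid covers \<open>[x, y]\<close> and may overshoot \<open>y\<close> by less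
    than \<open>3 * h\<close>: up to \<open>2 * h\<close> from rounding \<open>K\<close>, and
    \<open>h\<close> from its starting point \<open>s\<close>. A third of \<open>r - y\<close> keeps
    it below \<open>r\<close>.\<close>
  define \<epsilon> where "\<epsilon> = min \<delta> ((r - y) / 3)"
  have "\<epsilon> \<le> (r - y) / 3" unfolding \<epsilon>_def by (rule min.cobounded2)
  then have \<epsilon>: "3 * \<epsilon> \<le> r - y" by (simp add: field_simps)
  have \<epsilon>': "0 < \<epsilon>" "\<epsilon> \<le> \<delta>" using C r by (auto simp: \<epsilon>_def)
  have "(\<integral>\<^sup>+s. ennreal \<bar>slope \<nu> h (s + h) - slope \<nu> h s\<bar> * indicator {x..y} s \<partial>lborel) \<le> ennreal (C * h)"
    if h: "0 < h" "h < \<epsilon>" for h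
  proof -
    let ?g = "\<lambda>s. ennreal \<bar>slope \<nu> h (s + h) - slope \<nu> h s\<bar>"
    define K where "K = Suc (nat \<lceil>(y - x) / h\<rceil>)"
    have "0 \<le> (y - x) / h" using h assms by simp
    then have "(y - x) / h < real K" "real K < (y - x) / h + 2"
      unfolding K_def by linarith+
    then have K: "y < x + real K * h" "x + real K * h < y + 2 * h"
      using h by (auto simp: field_simps)
    have "(\<integral>\<^sup>+s. ?g s * indicator {x..y} s \<partial>lborel) \<le>
        (\<integral>\<^sup>+s. ?g s * indicator {x..<x + real K * h} s \<partial>lborel)"
      using K by (intro nn_integral_mono) (auto simp: indicator_def)
    also have "\<dots> = (\<integral>\<^sup>+s. (\<Sum>k<K. ?g (s + real k * h)) * indicator {x..<x + h} s \<partial>lborel)"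
      using h by (intro nn_integral_periodic_split) auto
    also have "\<dots> \<le> (\<integral>\<^sup>+s. ennreal C * indicator {x..<x + h} s \<partial>lborel)"
    proof (rule nn_integral_mono)
      fix s
      show "(\<Sum>k<K. ?g (s + real k * h)) * indicator {x..<x + h} s \<le> ennreal C * indicator {x..<x + h} s"
      proof (cases "s \<in> {x..<x + h}")
        case s: True
        let ?p = "\<lambda>k. s + real k * h"
        let ?xs = "map ?p [0..<Suc K]"
        have "?p k \<le> r" if "k \<le> K" for k
        proof -
          have "real k * h \<le> real K * h" using that h by (intro mult_right_mono) auto
          moreover have "s < x + h" using s by simp
          ultimately show ?thesis using K(2) \<epsilon> h(2) by linarith
        qed
        then have "set ?xs \<subseteq> {x..r}" using s h by (auto simp del: upt_Suc intro!: add_increasing2)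
        moreover have "sorted ?xs"
          using h by (auto simp: sorted_iff_nth_mono nth_append simp del: upt_Suc intro!: mult_right_mono)
        ultimately have "incr (slope \<nu> h) ?xs + incr (\<lambda>x. - slope \<nu> h x) ?xs \<le> C"
          using C h \<epsilon>' by auto
        moreover have "incr (slope \<nu> h) ?xs + incr (\<lambda>x. - slope \<nu> h x) ?xs =
          (\<Sum>k<K. \<bar>slope \<nu> h (?p k + h) - slope \<nu> h (?p k)\<bar>)"
          unfolding incr_sum[symmetric] sum.distrib[symmetric]
          by (intro sum.cong) (auto simp: algebra_simps nth_map simp del: upt_Suc)
        ultimately show ?thesis using s by (simp add: ennreal_leI)
      qed auto
    qed
    also have "\<dots> = ennreal (C * h)"
      using h C by (simp add: nn_integral_cmult_indicator ennreal_mult)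
    finally show ?thesis .
  qed
  then show ?thesis using C \<epsilon>' by (intro exI[of _ C] conjI exI[of _ \<epsilon>]) auto
qed

text \<open>The \<open>L^1\<close> norms of the successive differences are dominated by a geometric
  series, so the sum of the differences has a finite integral and converges absolutely at almost
  every point.\<close>

lemma AE_convergent_slope_cbox:
  assumes "a < x" "x \<le> y" "y < b"
  shows "AE s in lborel. s \<in> {x..y} \<longrightarrow> convergent (\<lambda>n. slope \<nu> (1 / 2 ^ n) s)"
proof -
  obtain C \<delta> where C: "0 < C" "0 < \<delta>" "\<And>h. 0 < h \<Longrightarrow> h < \<delta> \<Longrightarrow>
    (\<integral>\<^sup>+s. ennreal \<bar>slope \<nu> h (s + h) - slope \<nu> h s\<bar> * indicator {x..y} s \<partial>lborel) \<le> ennreal (C * h)"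
    using slope_translate[OF assms] by blast
  obtain m where m: "(1 / 2) ^ m < \<delta>" using real_arch_pow_inv[of \<delta> "1/2"] C by auto
  define h :: "nat \<Rightarrow> real" where "h n = 1 / 2 ^ (n + m)" for n
  have h: "0 < h n" "h n < \<delta>" "h n = 2 * h (Suc n)" for n
  proof -
    have "h n \<le> (1/2) ^ m" by (simp add: h_def power_one_over power_add frac_le)
    then show "h n < \<delta>" using m by simp
  qed (auto simp: h_def)
  let ?d = "\<lambda>n s. \<bar>slope \<nu> (h (Suc n)) s - slope \<nu> (h n) s\<bar>"
  have d: "?d n s \<le> \<bar>slope \<nu> (h (Suc n)) (s + h (Suc n)) - slope \<nu> (h (Suc n)) s\<bar>" for n s
    using slope_double[of "h (Suc n)" s] h(3)[of n] by simp
  have "(\<integral>\<^sup>+s. (\<Sum>n. ennreal (?d n s) * indicator {x..y} s) \<partial>lborel) =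
     (\<Sum>n. \<integral>\<^sup>+s. ennreal (?d n s) * indicator {x..y} s \<partial>lborel)"
    by (rule nn_integral_suminf) auto
  also have "\<dots> \<le> (\<Sum>n. ennreal (C * h (Suc n)))"
  proof (intro suminf_le)
    fix n
    have "(\<integral>\<^sup>+s. ennreal (?d n s) * indicator {x..y} s \<partial>lborel) \<le>
      (\<integral>\<^sup>+s. ennreal \<bar>slope \<nu> (h (Suc n)) (s + h (Suc n)) - slope \<nu> (h (Suc n)) s\<bar> * indicator {x..y} s \<partial>lborel)"
      by (intro nn_integral_mono mult_right_mono ennreal_leI d) auto
    also have "\<dots> \<le> ennreal (C * h (Suc n))" using h C by blast
    finally show "(\<integral>\<^sup>+s. ennreal (?d n s) * indicator {x..y} s \<partial>lborel) \<le> ennreal (C * h (Suc n))" .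
  qed auto
  also have "\<dots> < \<infinity>"
  proof -
    have "summable (\<lambda>n. (C / (2 ^ m * 2)) * (1 / 2) ^ n)"
      by (intro summable_mult summable_geometric) auto
    also have "(\<lambda>n. (C / (2 ^ m * 2)) * (1 / 2) ^ n) = (\<lambda>n. C * h (Suc n))"
      by (auto simp: h_def power_add power_one_over field_simps)
    finally have "summable (\<lambda>n. C * h (Suc n))" .
    then have "(\<Sum>n. ennreal (C * h (Suc n))) = ennreal (\<Sum>n. C * h (Suc n))"
      using C(1) h(1) by (intro suminf_ennreal2 mult_nonneg_nonneg less_imp_le)
    then show ?thesis by simp
  qed
  finally have fin: "(\<integral>\<^sup>+s. (\<Sum>n. ennreal (?d n s) * indicator {x..y} s) \<partial>lborel) \<noteq> \<infinity>" by simp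
  have "AE s in lborel. (\<Sum>n. ennreal (?d n s) * indicator {x..y} s) \<noteq> \<infinity>"
    by (rule nn_integral_PInf_AE[OF _ fin]) auto
  then show ?thesis
  proof (rule AE_mp, intro AE_I2 impI)
    fix s assume s: "(\<Sum>n. ennreal (?d n s) * indicator {x..y} s) \<noteq> \<infinity>" "s \<in> {x..y}"
    then have "summable (\<lambda>n. ?d n s)"
      by (intro summable_suminf_not_top) auto
    then have "summable (\<lambda>n. slope \<nu> (h (Suc n)) s - slope \<nu> (h n) s)"
      by (rule summable_rabs_cancel)
    then have conv: "convergent (\<lambda>n. (\<Sum>k<n. slope \<nu> (h (Suc k)) s - slope \<nu> (h k) s) + slope \<nu> (h 0) s)"
      by (intro convergent_add convergent_const) (simp add: summable_iff_convergent)
    have eq: "(\<Sum>k<n. slope \<nu> (h (Suc k)) s - slope \<nu> (h k) s) + slope \<nu> (h 0) s = slope \<nu> (1 / 2 ^ (n + m)) s" for n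
      by (subst sum_lessThan_telescope) (simp add: h_def)
    from conv[unfolded eq] show "convergent (\<lambda>n. slope \<nu> (1 / 2 ^ n) s)"
      by (rule convergent_ignore_initial_segment[THEN iffD1])
  qed
qed

end

section \<open>Right continuous versions of functions known on a dense set\<close>

lemma incr_append: "xs \<noteq> [] \<Longrightarrow> ys \<noteq> [] \<Longrightarrow>
  incr f (xs @ ys) = incr f xs + max (f (hd ys) - f (last xs)) 0 + incr f ys"
  by (induction xs) (auto simp: incr_Cons)

lemma incr_rev: "incr f (rev xs) = incr (\<lambda>x. - f x) xs"
  by (induction xs) (auto simp: incr_Cons incr_snoc last_rev)

text \<open>The Jordan decomposition on an arbitrary set: \<open>U t\<close> is the supremum of the
  rises up to \<open>t\<close>. The single inequality on \<open>max (g t - g s) 0\<close> says that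
  both \<open>U\<close> and \<open>U - g\<close> are nondecreasing.\<close>

lemma monotone_rise_function:
  fixes g :: "real \<Rightarrow> real"
  assumes bound: "\<And>t. t \<in> S \<Longrightarrow>
    \<exists>K. \<forall>xs. sorted_wrt (<) xs \<longrightarrow> set xs \<subseteq> S \<inter> {..t} \<longrightarrow> incr g xs \<le> K"
  obtains U where "\<And>s. s \<in> S \<Longrightarrow> 0 \<le> U s"
    and "\<And>s t. s \<in> S \<Longrightarrow> t \<in> S \<Longrightarrow> s \<le> t \<Longrightarrow> max (g t - g s) 0 \<le> U t - U s"
proof
  define W where "W t = incr g ` {xs. sorted_wrt (<) xs \<and> set xs \<subseteq> S \<inter> {..t}}" for t
  define U where "U t = Sup (W t)" for t
  have bdd: "bdd_above (W t)" if "t \<in> S" for t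
    using bound[OF that] by (auto simp: W_def bdd_above_def)
  have U: "incr g xs \<le> U t" if "t \<in> S" "sorted_wrt (<) xs" "set xs \<subseteq> S \<inter> {..t}" for t xs
    unfolding U_def using that by (intro cSup_upper bdd) (auto simp: W_def)
  show "0 \<le> U s" if "s \<in> S" for s using U[of s "[]"] that by simp
  show "max (g t - g s) 0 \<le> U t - U s" if st: "s \<in> S" "t \<in> S" "s \<le> t" for s t
  proof (cases "s = t")
    case False
    have "U s \<le> U t - max (g t - g s) 0"
      unfolding U_def[of s]
    proof (rule cSup_least)
      show "W s \<noteq> {}" by (auto simp: W_def intro!: exI[of _ "[]"])
      fix x assume "x \<in> W s"
      then obtain xs where xs: "sorted_wrt (<) xs" "set xs \<subseteq> S \<inter> {..s}" "x = incr g xs"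
        by (auto simp: W_def)
      \<comment> \<open>The list is prolonged by \<open>s\<close> and \<open>t\<close>. If it
        already ends in \<open>s\<close>, only \<open>t\<close> is appended, since repeating
        \<open>s\<close> would violate the strict order.\<close>
      consider "xs = []" | ys where "xs = ys @ [s]" | "xs \<noteq> []" "last xs < s"
        using xs by (cases xs rule: rev_cases) force+
      then have "x + max (g t - g s) 0 \<le> U t"
      proof cases
        case 1
        then show ?thesis using U[of t "[s, t]"] st False xs by auto
      next
        case 2
        have "sorted_wrt (<) (xs @ [t])" "set (xs @ [t]) \<subseteq> S \<inter> {..t}"
          using xs st False by (force simp: sorted_wrt_append)+
        moreover have "xs \<noteq> []" "last xs = s" using 2 by auto
        ultimately show ?thesis
          using U[of t "xs @ [t]"] incr_snoc[of g xs t] \<open>t \<in> S\<close> xs(3) by simp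
      next
        case 3
        have "\<forall>x\<in>set xs. x \<le> last xs"
          using xs 3 by (induction xs rule: rev_induct) (auto simp: sorted_wrt_append less_imp_le)
        then have "sorted_wrt (<) (xs @ [s, t])" "set (xs @ [s, t]) \<subseteq> S \<inter> {..t}"
          using xs st False 3 by (force simp: sorted_wrt_append)+
        then show ?thesis using U[of t "xs @ [s, t]"] st xs 3 by (simp add: incr_append)
      qed
      then show "x \<le> U t - max (g t - g s) 0" by simp
    qed
    then show ?thesis by linarith
  qed simp
qed

text \<open>The extension is a supremum over the points of \<open>S\<close> to the left; density up
  to both end points of the interval makes that set nonempty and bounded.\<close>

lemma mono_extension:
  fixes U :: "real \<Rightarrow> real"
  assumes mono: "\<And>s t. s \<in> S \<Longrightarrow> t \<in> S \<Longrightarrow> s \<le> t \<Longrightarrow> U s \<le> U t"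
    and dense: "\<And>u v. a \<le> u \<Longrightarrow> u < v \<Longrightarrow> v \<le> b \<Longrightarrow> \<exists>s\<in>S. u < s \<and> s < v"
    and S: "S \<subseteq> {a<..<b}"
  obtains V where "\<And>s. s \<in> S \<Longrightarrow> V s = U s"
    and "\<And>s t. a < s \<Longrightarrow> s \<le> t \<Longrightarrow> t < b \<Longrightarrow> V s \<le> (V t :: real)"
proof
  define V where "V t = Sup (U ` (S \<inter> {..t}))" for t
  have bdd: "bdd_above (U ` (S \<inter> {..t}))" if t: "a < t" "t < b" for t
  proof -
    obtain s where "s \<in> S" "t < s" using dense[of t b] t by auto
    then show ?thesis by (auto simp: bdd_above_def intro!: exI[of _ "U s"] mono)
  qed
  show "V s = U s" if "s \<in> S" for s
    unfolding V_def using that by (intro cSup_eq_maximum) (auto intro: mono)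
  show "V s \<le> V t" if st: "a < s" "s \<le> t" "t < b" for s t
  proof -
    obtain r where "r \<in> S" "r < s" using dense[of a s] st by auto
    then show ?thesis
      unfolding V_def using st by (intro cSup_subset_mono bdd) auto
  qed
qed

text \<open>\<open>V\<close> is the right limit of \<open>U\<close>. It has the same one-sided
  limits as \<open>U\<close>, and it can differ from \<open>U\<close> only at the countably many
  discontinuities of a monotone function.\<close>

lemma mono_right_regularize:
  fixes U :: "real \<Rightarrow> real"
  assumes mono: "\<And>s t. a < s \<Longrightarrow> s \<le> t \<Longrightarrow> t < b \<Longrightarrow> U s \<le> U t"
  obtains V where "mono_on {a<..<b} V"
    and "\<And>t. a < t \<Longrightarrow> t < b \<Longrightarrow> (U \<longlongrightarrow> V t) (at_right t)"
    and "\<And>t. a < t \<Longrightarrow> t < b \<Longrightarrow> (V \<longlongrightarrow> V t) (at_right t)"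
    and "\<And>t. a < t \<Longrightarrow> t < b \<Longrightarrow> \<exists>l. (U \<longlongrightarrow> l) (at_left t) \<and> (V \<longlongrightarrow> l) (at_left t)"
    and "countable {t \<in> {a<..<b}. V t \<noteq> U t}"
proof
  define V where "V t = Inf (U ` {t<..<b})" for t
  have le_V: "y \<le> V s" if "\<And>r. s < r \<Longrightarrow> r < b \<Longrightarrow> y \<le> U r" "s < b" for y s
    unfolding V_def using that by (intro cInf_greatest) auto
  have UV: "U t \<le> V t" if "a < t" "t < b" for t
    using that by (intro le_V mono) auto
  have VU: "V s \<le> U r" if "a < s" "s < r" "r < b" for s r
    unfolding V_def using that
    by (intro cInf_lower) (auto simp: bdd_below_def intro!: exI[of _ "U s"] mono)
  have V_less: "\<exists>r>s. r < b \<and> U r < y" if "V s < y" "s < b" for s y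
    using le_V[of s y] that by force
  have V_mono: "V s \<le> V t" if "a < s" "s \<le> t" "t < b" for s t
    using that by (intro le_V VU) auto
  then show "mono_on {a<..<b} V" by (auto simp: mono_on_def)
  fix t assume t: "a < t" "t < b"
  show lim: "(U \<longlongrightarrow> V t) (at_right t)"
  proof (rule order_tendstoI)
    fix y assume "y < V t"
    then show "\<forall>\<^sub>F s in at_right t. y < U s"
      using t VU[of t] by (force simp: eventually_at_right[OF t(2)] intro!: exI[of _ b])
  next
    fix y assume "V t < y"
    then obtain r where "t < r" "r < b" "U r < y" using V_less t by blast
    then have "U s < y" if "t < s" "s < r" for s using mono[of s r] t that by simp
    then show "\<forall>\<^sub>F s in at_right t. U s < y"
      using \<open>t < r\<close> by (auto simp: eventually_at_right[OF t(2)] intro!: exI[of _ r])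
  qed
  show "(V \<longlongrightarrow> V t) (at_right t)"
  proof (rule order_tendstoI)
    fix y assume "y < V t"
    then have "y < V s" if "t < s" "s < b" for s using V_mono[of t s] t that by simp
    then show "\<forall>\<^sub>F s in at_right t. y < V s"
      using t by (auto simp: eventually_at_right[OF t(2)] intro!: exI[of _ b])
  next
    fix y assume "V t < y"
    then obtain r where "t < r" "r < b" "U r < y" using V_less t by blast
    then have "V s < y" if "t < s" "s < r" for s using VU[of s r] t that by simp
    then show "\<forall>\<^sub>F s in at_right t. V s < y"
      using \<open>t < r\<close> by (auto simp: eventually_at_right[OF t(2)] intro!: exI[of _ r])
  qed
  define l where "l = Sup (U ` {a<..<t})"
  have Ul: "U s \<le> l" if "a < s" "s < t" for s
    unfolding l_def using that t
    by (intro cSup_upper) (auto simp: bdd_above_def intro!: exI[of _ "U t"] mono)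
  have l_gt: "\<exists>r. a < r \<and> r < t \<and> y < U r" if "y < l" for y
  proof -
    have "U ` {a<..<t} \<noteq> {}" using t by auto
    from less_cSupD[OF this, of y] show ?thesis using that by (auto simp: l_def)
  qed
  have Vl: "V s \<le> l" if s: "a < s" "s < t" for s
  proof -
    obtain r where "s < r" "r < t" using dense s(2) by blast
    then show ?thesis using VU[of s r] Ul[of r] s t by linarith
  qed
  show "\<exists>l. (U \<longlongrightarrow> l) (at_left t) \<and> (V \<longlongrightarrow> l) (at_left t)"
  proof (intro exI conjI; rule order_tendstoI)
    fix y assume "y < l"
    then obtain r where r: "a < r" "r < t" "y < U r" using l_gt by blast
    have "y < U s" "y < V s" if "r < s" "s < t" for s
      using mono[of r s] UV[of s] r that t by linarith+
    then show "\<forall>\<^sub>F s in at_left t. y < U s" "\<forall>\<^sub>F s in at_left t. y < V s"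
      using r by (auto simp: eventually_at_left[OF t(1)] intro!: exI[of _ r])
  next
    fix y assume "l < y"
    then have "U s < y" "V s < y" if "a < s" "s < t" for s
      using Ul[of s] Vl[of s] that by linarith+
    then show "\<forall>\<^sub>F s in at_left t. U s < y" "\<forall>\<^sub>F s in at_left t. V s < y"
      using t by (auto simp: eventually_at_left[OF t(1)] intro!: exI[of _ a])
  qed
next
  define V where "V t = Inf (U ` {t<..<b})" for t
  have "countable {t \<in> {a<..<b}. \<not> isCont U t}"
    using mono by (intro mono_on_ctble_discont_open) (auto simp: mono_on_def)
  moreover have "Inf (U ` {t<..<b}) = U t" if t: "a < t" "t < b" "isCont U t" for t
  proof (rule antisym)
    show "U t \<le> Inf (U ` {t<..<b})" using t by (intro cInf_greatest) (auto intro: mono)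
    have le: "Inf (U ` {t<..<b}) \<le> U s" if "t < s" "s < b" for s
      using that t by (intro cInf_lower) (auto simp: bdd_below_def intro!: exI[of _ "U t"] mono)
    have "(U \<longlongrightarrow> U t) (at_right t)"
      using t by (auto simp: isCont_def filterlim_at_split)
    then show "Inf (U ` {t<..<b}) \<le> U t"
    proof (rule tendsto_lowerbound)
      show "\<forall>\<^sub>F s in at_right t. Inf (U ` {t<..<b}) \<le> U s"
        using le t by (auto simp: eventually_at_right[OF t(2)])
    qed simp
  qed
  ultimately show "countable {t \<in> {a<..<b}. Inf (U ` {t<..<b}) \<noteq> U t}"
    by (rule_tac countable_subset) auto
qed

text \<open>Both monotone parts of \<open>g\<close> are extended from \<open>S\<close> and then made
  right continuous. The intermediate function \<open>G\<close> is kept because it still agrees with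
  \<open>g\<close> on all of \<open>S\<close>, and its one-sided limits at every point are the
  values and left limits of \<open>f\<close>; inequalities on \<open>S\<close> reach
  \<open>f\<close> through it.\<close>

lemma regularize_dense:
  fixes g :: "real \<Rightarrow> real"
  assumes ab: "a < b" and S: "S \<subseteq> {a<..<b}"
    and dense: "\<And>u v. a \<le> u \<Longrightarrow> u < v \<Longrightarrow> v \<le> b \<Longrightarrow> \<exists>s\<in>S. u < s \<and> s < v"
    and rise: "\<And>t xs. t \<in> S \<Longrightarrow> sorted_wrt (<) xs \<Longrightarrow> set xs \<subseteq> S \<inter> {..<t} \<Longrightarrow> incr g xs \<le> g t"
  obtains f G where "f \<in> borel_measurable (restrict_space borel {a<..<b})"
    and "\<And>s. s \<in> S \<Longrightarrow> G s = g s" and "countable {s \<in> S. f s \<noteq> g s}"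
    and "cadlag_on a b f"
    and "\<And>t. a < t \<Longrightarrow> t < b \<Longrightarrow> (G \<longlongrightarrow> f t) (at_right t)"
    and "\<And>t. a < t \<Longrightarrow> t < b \<Longrightarrow> (G \<longlongrightarrow> left_lim f t) (at_left t)"
proof -
  have "\<exists>K. \<forall>xs. sorted_wrt (<) xs \<longrightarrow> set xs \<subseteq> S \<inter> {..t} \<longrightarrow> incr g xs \<le> K" if t: "t \<in> S" for t
  proof -
    have "a < t" "t < b" using t S by auto
    \<comment> \<open>The hypothesis bounds only lists strictly below its point, so a point of
      \<open>S\<close> beyond \<open>t\<close> is needed for lists that contain
      \<open>t\<close>.\<close>
    then obtain s where "s \<in> S" "t < s" using dense[of t b] by auto
    then show ?thesis by (intro exI[of _ "g s"]) (auto intro!: rise)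
  qed
  from monotone_rise_function[of S g, OF this] obtain U where
    U: "\<And>s t. s \<in> S \<Longrightarrow> t \<in> S \<Longrightarrow> s \<le> t \<Longrightarrow> max (g t - g s) 0 \<le> U t - U s" by metis
  obtain U1 where U1: "\<And>s. s \<in> S \<Longrightarrow> U1 s = U s"
    "\<And>s t. a < s \<Longrightarrow> s \<le> t \<Longrightarrow> t < b \<Longrightarrow> U1 s \<le> U1 t"
  proof (rule mono_extension[of S U a b])
    show "U s \<le> U t" if "s \<in> S" "t \<in> S" "s \<le> t" for s t
      using U[OF that] by linarith
  qed (use dense S in blast)+
  obtain D1 where D1: "\<And>s. s \<in> S \<Longrightarrow> D1 s = U s - g s"
    "\<And>s t. a < s \<Longrightarrow> s \<le> t \<Longrightarrow> t < b \<Longrightarrow> D1 s \<le> D1 t"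
  proof (rule mono_extension[of S "\<lambda>s. U s - g s" a b])
    show "U s - g s \<le> U t - g t" if "s \<in> S" "t \<in> S" "s \<le> t" for s t
      using U[OF that] by linarith
  qed (use dense S in blast)+
  obtain U2 where U2: "mono_on {a<..<b} U2"
    "\<And>t. a < t \<Longrightarrow> t < b \<Longrightarrow> (U1 \<longlongrightarrow> U2 t) (at_right t)"
    "\<And>t. a < t \<Longrightarrow> t < b \<Longrightarrow> (U2 \<longlongrightarrow> U2 t) (at_right t)"
    "\<And>t. a < t \<Longrightarrow> t < b \<Longrightarrow> \<exists>l. (U1 \<longlongrightarrow> l) (at_left t) \<and> (U2 \<longlongrightarrow> l) (at_left t)"
    "countable {t \<in> {a<..<b}. U2 t \<noteq> U1 t}"
    using mono_right_regularize[of a b U1] U1(2) by blast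
  obtain D2 where D2: "mono_on {a<..<b} D2"
    "\<And>t. a < t \<Longrightarrow> t < b \<Longrightarrow> (D1 \<longlongrightarrow> D2 t) (at_right t)"
    "\<And>t. a < t \<Longrightarrow> t < b \<Longrightarrow> (D2 \<longlongrightarrow> D2 t) (at_right t)"
    "\<And>t. a < t \<Longrightarrow> t < b \<Longrightarrow> \<exists>l. (D1 \<longlongrightarrow> l) (at_left t) \<and> (D2 \<longlongrightarrow> l) (at_left t)"
    "countable {t \<in> {a<..<b}. D2 t \<noteq> D1 t}"
    using mono_right_regularize[of a b D1] D1(2) by blast
  define f where "f t = U2 t - D2 t" for t
  define G where "G t = U1 t - D1 t" for t
  have left: "\<exists>l. (f \<longlongrightarrow> l) (at_left t) \<and> (G \<longlongrightarrow> l) (at_left t)" if t: "a < t" "t < b" for t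
  proof -
    obtain l m where "(U1 \<longlongrightarrow> l) (at_left t)" "(U2 \<longlongrightarrow> l) (at_left t)"
      "(D1 \<longlongrightarrow> m) (at_left t)" "(D2 \<longlongrightarrow> m) (at_left t)"
      using U2(4)[OF t] D2(4)[OF t] by blast
    then show ?thesis unfolding f_def G_def by (intro exI[of _ "l - m"]) (auto intro!: tendsto_intros)
  qed
  show thesis
  proof
    show "f \<in> borel_measurable (restrict_space borel {a<..<b})"
      unfolding f_def using U2(1) D2(1)
      by (intro borel_measurable_diff borel_measurable_mono_on_fnc)
    show "G s = g s" if "s \<in> S" for s using U1(1) D1(1) that by (simp add: G_def)
    show "countable {s \<in> S. f s \<noteq> g s}"
      by (rule countable_subset[OF _ countable_Un[OF U2(5) D2(5)]])
         (use S U1(1) D1(1) in \<open>auto simp: f_def\<close>)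
    have "(f \<longlongrightarrow> f t) (at_right t)" if "a < t" "t < b" for t
      unfolding f_def by (intro tendsto_diff U2(3) D2(3) that)
    moreover have "\<exists>l. (f \<longlongrightarrow> l) (at_left t)" if "a < t" "t < b" for t
      using left[OF that] by blast
    ultimately show "cadlag_on a b f"
      by (auto simp: cadlag_on_def continuous_within)
    show "(G \<longlongrightarrow> f t) (at_right t)" if "a < t" "t < b" for t
      unfolding f_def G_def using that U2(2) D2(2) by (auto intro!: tendsto_intros)
    show "(G \<longlongrightarrow> left_lim f t) (at_left t)" if t: "a < t" "t < b" for t
    proof -
      obtain l where l: "(f \<longlongrightarrow> l) (at_left t)" "(G \<longlongrightarrow> l) (at_left t)" using left[OF t] by blast
      then have "left_lim f t = l" unfolding left_lim_def by (intro tendsto_Lim) auto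
      then show ?thesis using l by simp
    qed
  qed
qed

text \<open>Each list entry is approached from the right by points of \<open>S\<close>. A finite
  list keeps its strict order under small perturbations; approaching from the right allows
  \<open>u \<le> x\<close> on the left but requires \<open>x < w\<close> on the right.\<close>

lemma incr_le_of_right_limits:
  fixes f G :: "real \<Rightarrow> real"
  assumes dense: "\<And>u v. a \<le> u \<Longrightarrow> u < v \<Longrightarrow> v \<le> b \<Longrightarrow> \<exists>s\<in>S. u < s \<and> s < v"
    and xs: "sorted_wrt (<) xs" "set xs \<subseteq> {a<..<b}"
    and lim: "\<And>x. x \<in> set xs \<Longrightarrow> (G \<longlongrightarrow> f x) (at_right x)"
    and uw: "\<And>x. x \<in> set xs \<Longrightarrow> u \<le> x \<and> x < w"
    and le: "\<And>ys. sorted_wrt (<) ys \<Longrightarrow> set ys \<subseteq> S \<inter> {u<..<w} \<Longrightarrow> incr G ys \<le> c"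
  shows "incr f xs \<le> c"
proof -
  have "\<exists>s\<in>S. x < s \<and> s < min b (x + 1 / real (Suc k))" if "x \<in> {a<..<b}" for x k
    using that by (intro dense) auto
  then have "\<forall>k. \<forall>x\<in>{a<..<b}. \<exists>s. s \<in> S \<and> x < s \<and> s < x + 1 / real (Suc k)" by fastforce
  then obtain r where r: "\<And>k x. x \<in> {a<..<b} \<Longrightarrow> r k x \<in> S \<and> x < r k x \<and> r k x < x + 1 / real (Suc k)"
    by metis
  have to: "(\<lambda>k. r k x) \<longlonglongrightarrow> x" if "x \<in> {a<..<b}" for x
  proof (rule real_tendsto_sandwich)
    show "\<forall>\<^sub>F k in sequentially. x \<le> r k x" "\<forall>\<^sub>F k in sequentially. r k x \<le> x + 1 / real (Suc k)"
      using r[OF that] by (auto intro!: always_eventually less_imp_le)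
    show "(\<lambda>k. x + 1 / real (Suc k)) \<longlonglongrightarrow> x"
      using tendsto_add[OF tendsto_const LIMSEQ_Suc[OF lim_1_over_n], of x] by simp
  qed simp
  have rl: "filterlim (\<lambda>k. r k x) (at_right x) sequentially" if "x \<in> {a<..<b}" for x
    unfolding filterlim_at
    using to[OF that] r[OF that] by (metis (mono_tags, lifting) always_eventually greaterThan_iff less_irrefl)
  have "(\<lambda>k. incr (\<lambda>x. G (r k x)) xs) \<longlonglongrightarrow> incr f xs"
    using xs by (intro tendsto_incr filterlim_compose[OF lim rl]) auto
  moreover have "\<forall>\<^sub>F k in sequentially. incr (\<lambda>x. G (r k x)) xs \<le> c"
  proof -
    have "\<forall>\<^sub>F k in sequentially. r k x < w" if "x \<in> set xs" for x
      using order_tendstoD(2)[OF to, of x w] uw that xs by blast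
    then have 1: "\<forall>\<^sub>F k in sequentially. \<forall>x\<in>set xs. r k x < w"
      by (simp add: eventually_ball_finite_distrib)
    have "\<forall>\<^sub>F k in sequentially. x < y \<longrightarrow> r k x < r k y" if "x \<in> set xs" "y \<in> set xs" for x y
    proof (cases "x < y")
      case True
      then have "\<forall>\<^sub>F k in sequentially. r k x < y"
        using order_tendstoD(2)[OF to, of x y] that xs by blast
      then show ?thesis
        by (rule eventually_mono) (use r that xs in \<open>force intro: less_trans\<close>)
    qed simp
    then have 2: "\<forall>\<^sub>F k in sequentially. \<forall>x\<in>set xs. \<forall>y\<in>set xs. x < y \<longrightarrow> r k x < r k y"
      by (simp add: eventually_ball_finite_distrib)
    show ?thesis
      using 1 2
    proof eventually_elim
      case (elim k)
      have "sorted_wrt (<) (map (r k) xs)"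
        unfolding sorted_wrt_map by (rule sorted_wrt_mono_rel[OF _ xs(1)]) (use elim in auto)
      moreover have "r k x \<in> S \<inter> {u<..<w}" if "x \<in> set xs" for x
        using r[of x k] uw[OF that] that xs(2) elim(1) by force
      then have "set (map (r k) xs) \<subseteq> S \<inter> {u<..<w}" by auto
      ultimately show ?case using le[of "map (r k) xs"] by (simp add: incr_map)
    qed
  qed
  ultimately show ?thesis by (rule tendsto_upperbound) simp
qed

text \<open>When the limit is known to exist, a bound along a dense set suffices. The bounds on
  \<open>G\<close> are available only on \<open>S\<close>, hence frequently but not
  eventually.\<close>

lemma le_limit_frequently:
  fixes G :: "real \<Rightarrow> real"
  assumes "(G \<longlongrightarrow> l) F" "\<exists>\<^sub>F s in F. c \<le> G s"
  shows "c \<le> l"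
proof (rule ccontr)
  assume "\<not> c \<le> l"
  then have "\<forall>\<^sub>F s in F. G s < c" using assms(1) by (intro order_tendstoD) auto
  then show False using assms(2) by (auto simp: frequently_def not_le)
qed

lemma frequently_at_right_dense:
  assumes dense: "\<And>u v. a \<le> u \<Longrightarrow> u < v \<Longrightarrow> v \<le> (b::real) \<Longrightarrow> \<exists>s\<in>S. u < s \<and> s < v"
    and "a \<le> t" "t < w" "w \<le> b"
  shows "\<exists>\<^sub>F s in at_right t. s \<in> S \<and> s < w"
proof (rule ccontr)
  assume "\<not> ?thesis"
  then obtain v where v: "t < v" "\<And>s. t < s \<Longrightarrow> s < v \<Longrightarrow> \<not> (s \<in> S \<and> s < w)"
    by (auto simp: frequently_def eventually_at_right[OF assms(3)])
  then show False using dense[of t "min v w"] assms by force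
qed

lemma frequently_at_left_dense:
  assumes dense: "\<And>u v. a \<le> u \<Longrightarrow> u < v \<Longrightarrow> v \<le> (b::real) \<Longrightarrow> \<exists>s\<in>S. u < s \<and> s < v"
    and "a \<le> w" "w < t" "t \<le> b"
  shows "\<exists>\<^sub>F s in at_left t. s \<in> S \<and> w < s"
proof (rule ccontr)
  assume "\<not> ?thesis"
  then obtain v where v: "v < t" "\<And>s. v < s \<Longrightarrow> s < t \<Longrightarrow> \<not> (s \<in> S \<and> w < s)"
    by (auto simp: frequently_def eventually_at_left[OF assms(3)])
  then show False using dense[of "max v w" t] assms by force
qed

lemma mono_at_right_cases:
  fixes U :: "real \<Rightarrow> real"
  assumes "a < c" and mono: "\<And>s t. a < s \<Longrightarrow> s \<le> t \<Longrightarrow> t < c \<Longrightarrow> U s \<le> U t"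
  obtains u where "(U \<longlongrightarrow> u) (at_right a)" | "filterlim U at_bot (at_right a)"
proof (cases "bdd_below (U ` {a<..<c})")
  case True
  have "(U \<longlongrightarrow> Inf (U ` {a<..<c})) (at_right a)"
  proof (rule order_tendstoI)
    fix y assume "y < Inf (U ` {a<..<c})"
    then have "y < U s" if "a < s" "s < c" for s
      using cInf_lower[OF _ True, of "U s"] that by fastforce
    then show "\<forall>\<^sub>F s in at_right a. y < U s"
      using \<open>a < c\<close> by (auto simp: eventually_at_right[OF \<open>a < c\<close>])
  next
    fix y assume "Inf (U ` {a<..<c}) < y"
    moreover have "U ` {a<..<c} \<noteq> {}" using \<open>a < c\<close> by auto
    ultimately obtain r where r: "a < r" "r < c" "U r < y"
      using cInf_lessD[of "U ` {a<..<c}" y] by auto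
    have "U s < y" if "a < s" "s < r" for s using mono[of s r] r that by simp
    then show "\<forall>\<^sub>F s in at_right a. U s < y"
      using r by (auto simp: eventually_at_right[OF \<open>a < c\<close>])
  qed
  then show ?thesis by (rule that(1))
next
  case False
  have "filterlim U at_bot (at_right a)"
    unfolding filterlim_at_bot
  proof
    fix Z
    have "\<not> (\<forall>s\<in>{a<..<c}. Z \<le> U s)" using False by (auto simp: bdd_below_def)
    then obtain r where r: "a < r" "r < c" "U r \<le> Z" by force
    have "U s \<le> Z" if "a < s" "s < r" for s using mono[of s r] r that by simp
    then show "\<forall>\<^sub>F s in at_right a. U s \<le> Z"
      using r by (auto simp: eventually_at_right[OF \<open>a < c\<close>])
  qed
  then show ?thesis by (rule that(2))
qed

text \<open>In the decomposition \<open>f = U - (U - f)\<close> the first part is nonnegative and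
  monotone, hence has a finite limit at \<open>a\<close>. The second either has a finite limit or
  tends to minus infinity, in which case \<open>f\<close> tends to infinity.\<close>

lemma ennreal_limit_at_right:
  fixes f :: "real \<Rightarrow> real"
  assumes "a < c"
    and bound: "\<And>xs. sorted_wrt (<) xs \<Longrightarrow> set xs \<subseteq> {a<..<c} \<Longrightarrow> incr f xs \<le> K"
  shows "\<exists>l. ((\<lambda>t. ennreal (f t)) \<longlongrightarrow> l) (at_right a)"
proof -
  obtain U where U: "\<And>s. s \<in> {a<..<c} \<Longrightarrow> 0 \<le> U s"
    "\<And>s t. s \<in> {a<..<c} \<Longrightarrow> t \<in> {a<..<c} \<Longrightarrow> s \<le> t \<Longrightarrow> max (f t - f s) 0 \<le> U t - U s"
    using monotone_rise_function[of "{a<..<c}" f] bound by (metis inf.boundedE)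
  have mono: "U s \<le> U t" "U s - f s \<le> U t - f t" if "a < s" "s \<le> t" "t < c" for s t
    using U(2)[of s t] that by auto
  have "\<not> filterlim U at_bot (at_right a)"
  proof
    assume "filterlim U at_bot (at_right a)"
    then have "\<forall>\<^sub>F s in at_right a. U s \<le> -1" by (simp add: filterlim_at_bot)
    moreover have "\<forall>\<^sub>F s in at_right a. 0 \<le> U s"
      using U(1) \<open>a < c\<close> by (auto simp: eventually_at_right[OF \<open>a < c\<close>])
    ultimately have "\<forall>\<^sub>F s in at_right a. False" by eventually_elim simp
    then show False by simp
  qed
  with mono_at_right_cases[of a c U] mono(1) \<open>a < c\<close>
  obtain u where u: "(U \<longlongrightarrow> u) (at_right a)" by metis
  show ?thesis
  proof (rule mono_at_right_cases[of a c "\<lambda>s. U s - f s"])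
    show "a < c" by fact
    show "U s - f s \<le> U t - f t" if "a < s" "s \<le> t" "t < c" for s t using mono(2)[OF that] .
  next
    fix v assume "((\<lambda>s. U s - f s) \<longlongrightarrow> v) (at_right a)"
    from tendsto_diff[OF u this] have "(f \<longlongrightarrow> u - v) (at_right a)" by simp
    then show ?thesis by (intro exI) (rule tendsto_ennrealI)
  next
    assume D: "filterlim (\<lambda>s. U s - f s) at_bot (at_right a)"
    have "((\<lambda>t. ennreal (f t)) \<longlongrightarrow> top) (at_right a)"
      unfolding tendsto_top_iff_ennreal
    proof safe
      fix l :: real assume "0 \<le> l"
      have "\<forall>\<^sub>F s in at_right a. U s - f s \<le> - l - 1" using D by (simp add: filterlim_at_bot)
      moreover have "\<forall>\<^sub>F s in at_right a. 0 \<le> U s"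
        using U(1) \<open>a < c\<close> by (auto simp: eventually_at_right[OF \<open>a < c\<close>])
      ultimately show "\<forall>\<^sub>F s in at_right a. ennreal l < ennreal (f s)"
        by eventually_elim (use \<open>0 \<le> l\<close> in \<open>simp add: ennreal_less_iff\<close>)
    qed
    then show ?thesis by blast
  qed
qed

text \<open>The reflection at 0 reverses the lists, so the rises of the reflected function are the
  falls of \<open>f\<close>.\<close>

lemma ennreal_limit_at_left:
  fixes f :: "real \<Rightarrow> real"
  assumes "c < b"
    and bound: "\<And>xs. sorted_wrt (<) xs \<Longrightarrow> set xs \<subseteq> {c<..<b} \<Longrightarrow> incr (\<lambda>x. - f x) xs \<le> K"
  shows "\<exists>l. ((\<lambda>t. ennreal (f t)) \<longlongrightarrow> l) (at_left b)"
proof -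
  have "\<exists>l. ((\<lambda>t. ennreal (f (- t))) \<longlongrightarrow> l) (at_right (- b))"
  proof (rule ennreal_limit_at_right[of "- b" "- c"])
    fix xs assume xs: "sorted_wrt (<) xs" "set xs \<subseteq> {- b<..<- c}"
    have "incr (\<lambda>x. f (- x)) xs = incr (\<lambda>x. - f x) (rev (map uminus xs))"
      by (simp add: incr_rev incr_map)
    also have "\<dots> \<le> K"
    proof (rule bound)
      have "sorted_wrt (\<lambda>x y. x > y) (map uminus xs)"
        unfolding sorted_wrt_map using xs(1) by simp
      then show "sorted_wrt (<) (rev (map uminus xs))" by (simp add: sorted_wrt_rev)
    qed (use xs(2) in force)
    finally show "incr (\<lambda>x. f (- x)) xs \<le> K" .
  qed (use assms in simp)
  then show ?thesis by (simp add: filterlim_at_left_to_right)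
qed

section \<open>All constraints from the two one-sided variation bounds\<close>

lemma strict_sorted_hd_last:
  fixes xs :: "'a::linorder list"
  assumes "sorted_wrt (<) xs" "x \<in> set xs"
  shows "hd xs \<le> x \<and> x \<le> last xs"
proof
  show "hd xs \<le> x" using assms by (cases xs) auto
  show "x \<le> last xs" using assms by (cases xs rule: rev_cases) (auto simp: sorted_wrt_append)
qed

text \<open>Between \<open>t1\<close> and \<open>t2\<close>, rises are bounded through
  \<open>t2\<close> and falls through \<open>t1\<close>. Near an end point only one kind is bounded,
  and the other equals it up to the difference of the values at the ends of the list; extending the
  list towards the ends of the interval turns these values into one-sided limits.\<close>

lemma TV_constraintsI:
  assumes ab: "a < b" and cadlag: "cadlag_on a b f"
    and nonneg: "\<And>t. a < t \<Longrightarrow> t < b \<Longrightarrow> 0 \<le> f t"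
    and pos: "\<And>t. a < t \<Longrightarrow> t < b \<Longrightarrow> TV_pos f a t \<le> low f t"
    and neg: "\<And>t. a < t \<Longrightarrow> t < b \<Longrightarrow> TV_neg f t b \<le> low f t"
  shows "TV_constraints a b f"
proof -
  define lw where "lw t = min (f t) (left_lim f t)" for t
  have low: "low f t = ennreal (lw t)" for t by (simp add: low_def lw_def)
  have right: "(f \<longlongrightarrow> f t) (at_right t)" if "a < t" "t < b" for t
    using cadlag that by (auto simp: cadlag_on_def continuous_within)
  have left: "(f \<longlongrightarrow> left_lim f t) (at_left t)" if t: "a < t" "t < b" for t
  proof -
    have "\<exists>l. (f \<longlongrightarrow> l) (at_left t)" using cadlag t by (simp add: cadlag_on_def)
    then obtain l where "(f \<longlongrightarrow> l) (at_left t)" by blast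
    moreover from this have "left_lim f t = l" unfolding left_lim_def by (intro tendsto_Lim) auto
    ultimately show ?thesis by simp
  qed
  have lw_nonneg: "0 \<le> lw t" if t: "a < t" "t < b" for t
  proof -
    have "\<forall>\<^sub>F s in at_left t. 0 \<le> f s"
      using t nonneg by (auto simp: eventually_at_left[OF t(1)] intro!: exI[of _ a])
    from tendsto_lowerbound[OF left[OF t] this] show ?thesis
      using nonneg t by (simp add: lw_def)
  qed
  have P: "incr f xs \<le> lw t"
    if "a < t" "t < b" "sorted_wrt (<) xs" "set xs \<subseteq> {a<..<t}" for t xs
    using pos[of t] that lw_nonneg[of t] by (simp add: TV_pos_le_iff low ennreal_le_iff)
  have N: "incr (\<lambda>x. - f x) xs \<le> lw t"
    if "a < t" "t < b" "sorted_wrt (<) xs" "set xs \<subseteq> {t<..<b}" for t xs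
    using neg[of t] that lw_nonneg[of t] by (simp add: TV_neg_le_iff low ennreal_le_iff)
  define m where "m = (a + b) / 2"
  have m: "a < m" "m < b" using ab by (auto simp: m_def)
  obtain la where la: "((\<lambda>t. ennreal (f t)) \<longlongrightarrow> la) (at_right a)"
    using ennreal_limit_at_right[OF m(1), of f "lw m"] P m by blast
  obtain lb where lb: "((\<lambda>t. ennreal (f t)) \<longlongrightarrow> lb) (at_left b)"
    using ennreal_limit_at_left[OF m(2), of f "lw m"] N m by blast
  have era: "end_right f a = la" and elb: "end_left f b = lb"
    unfolding end_right_def end_left_def using la lb by (auto intro!: tendsto_Lim)
  have ev_a: "\<forall>\<^sub>F s in at_right a. 0 \<le> f s"
    using ab nonneg by (auto simp: eventually_at_right[OF ab] intro!: exI[of _ b])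
  have ev_b: "\<forall>\<^sub>F s in at_left b. 0 \<le> f s"
    using ab nonneg by (auto simp: eventually_at_left[OF ab] intro!: exI[of _ a])
  have ends: "sorted_wrt (<) (s # xs @ [r])" if "xs \<noteq> []" "sorted_wrt (<) xs" "s < hd xs" "last xs < r"
    for s r :: real and xs
  proof -
    have "s < x \<and> x < r" if "x \<in> set xs" for x
      using strict_sorted_hd_last[OF \<open>sorted_wrt (<) xs\<close> that] \<open>s < hd xs\<close> \<open>last xs < r\<close> by linarith
    moreover from this have "s < r" using \<open>xs \<noteq> []\<close> hd_in_set by fastforce
    ultimately show ?thesis using \<open>sorted_wrt (<) xs\<close> by (auto simp: sorted_wrt_append)
  qed
  have i: "TV f t1 t2 \<le> low f t1 + low f t2" if t: "a < t1" "t1 < t2" "t2 < b" for t1 t2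
  proof -
    have "incr f xs + incr (\<lambda>x. - f x) xs \<le> lw t1 + lw t2"
      if xs: "sorted_wrt (<) xs" "set xs \<subseteq> {t1<..<t2}" for xs
    proof -
      have "incr f xs \<le> lw t2" "incr (\<lambda>x. - f x) xs \<le> lw t1"
        using t xs by (intro P N; force)+
      then show ?thesis by simp
    qed
    then show ?thesis
      using t lw_nonneg by (auto simp: TV_le_iff low ennreal_plus[symmetric] simp del: ennreal_plus intro!: ennreal_leI)
  qed
  have iii_a: "TV f a t \<le> la + low f t" if t: "a < t" "t < b" and fin: "la < \<infinity>" for t
  proof -
    obtain l where l: "la = ennreal l" "0 \<le> l" using fin by (cases la) auto
    have fl: "(f \<longlongrightarrow> l) (at_right a)"
      using la ev_a l by (simp add: tendsto_ennreal_iff)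
    have "incr f xs + incr (\<lambda>x. - f x) xs \<le> l + lw t"
      if xs: "sorted_wrt (<) xs" "set xs \<subseteq> {a<..<t}" for xs
    proof (cases "xs = []")
      case False
      have mem: "hd xs \<in> {a<..<t}" "last xs \<in> {a<..<t}"
        using xs(2) False hd_in_set last_in_set by blast+
      let ?v = "incr f xs + incr (\<lambda>x. - f x) xs"
      \<comment> \<open>The total variation is twice the rises minus the growth from
        \<open>hd xs\<close> to \<open>last xs\<close>. Attaching \<open>s\<close> and
        \<open>r\<close> to the list before using the bound on rises replaces that growth by
        \<open>f r - f s\<close>.\<close>
      have 1: "?v \<le> 2 * lw t + f s - f r" if s: "a < s" "s < hd xs" and r: "last xs < r" "r < t" for s r
      proof -
        have "incr f (s # xs @ [r]) \<le> lw t"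
          using ends[OF False xs(1) s(2) r(1)] s r t xs mem by (intro P) auto
        then have "incr f xs + max (f (hd xs) - f s) 0 + max (f r - f (last xs)) 0 \<le> lw t"
          using False by (simp add: incr_Cons incr_snoc)
        then show ?thesis using incr_minus[OF False, of f] by linarith
      qed
      have 2: "?v \<le> 2 * lw t + f s - left_lim f t" if s: "a < s" "s < hd xs" for s
      proof (rule tendsto_lowerbound)
        show "((\<lambda>r. 2 * lw t + f s - f r) \<longlongrightarrow> 2 * lw t + f s - left_lim f t) (at_left t)"
          by (intro tendsto_intros left t)
        have "last xs < t" using mem by simp
        then show "\<forall>\<^sub>F r in at_left t. ?v \<le> 2 * lw t + f s - f r"
          using 1[OF s] by (auto simp: eventually_at_left[OF \<open>last xs < t\<close>] intro!: exI[of _ "last xs"])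
      qed simp
      have "?v \<le> 2 * lw t + l - left_lim f t"
      proof (rule tendsto_lowerbound)
        show "((\<lambda>s. 2 * lw t + f s - left_lim f t) \<longlongrightarrow> 2 * lw t + l - left_lim f t) (at_right a)"
          by (intro tendsto_intros fl)
        have "a < hd xs" using mem by simp
        then show "\<forall>\<^sub>F s in at_right a. ?v \<le> 2 * lw t + f s - left_lim f t"
          using 2 by (auto simp: eventually_at_right[OF \<open>a < hd xs\<close>] intro!: exI[of _ "hd xs"])
      qed simp
      \<comment> \<open>Since \<open>lw t\<close> is at most the left limit at \<open>t\<close>, one
        of the two copies of \<open>lw t\<close> is cancelled.\<close>
      then show ?thesis by (simp add: lw_def)
    qed (use l lw_nonneg t in simp)
    then show ?thesis
      using l lw_nonneg[OF t] by (auto simp: TV_le_iff low ennreal_plus[symmetric] simp del: ennreal_plus intro!: ennreal_leI)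
  qed
  have iii_b: "TV f t b \<le> low f t + lb" if t: "a < t" "t < b" and fin: "lb < \<infinity>" for t
  proof -
    obtain l where l: "lb = ennreal l" "0 \<le> l" using fin by (cases lb) auto
    have fl: "(f \<longlongrightarrow> l) (at_left b)"
      using lb ev_b l by (simp add: tendsto_ennreal_iff)
    have "incr f xs + incr (\<lambda>x. - f x) xs \<le> lw t + l"
      if xs: "sorted_wrt (<) xs" "set xs \<subseteq> {t<..<b}" for xs
    proof (cases "xs = []")
      case False
      have mem: "hd xs \<in> {t<..<b}" "last xs \<in> {t<..<b}"
        using xs(2) False hd_in_set last_in_set by blast+
      let ?v = "incr f xs + incr (\<lambda>x. - f x) xs"
      have 1: "?v \<le> 2 * lw t + f r - f s" if s: "t < s" "s < hd xs" and r: "last xs < r" "r < b" for s r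
      proof -
        have "incr (\<lambda>x. - f x) (s # xs @ [r]) \<le> lw t"
          using ends[OF False xs(1) s(2) r(1)] s r t xs mem by (intro N) auto
        then have "incr (\<lambda>x. - f x) xs + max (f s - f (hd xs)) 0 + max (f (last xs) - f r) 0 \<le> lw t"
          using False by (simp add: incr_Cons incr_snoc)
        then show ?thesis using incr_minus[OF False, of f] by linarith
      qed
      have 2: "?v \<le> 2 * lw t + f r - f t" if r: "last xs < r" "r < b" for r
      proof (rule tendsto_lowerbound)
        show "((\<lambda>s. 2 * lw t + f r - f s) \<longlongrightarrow> 2 * lw t + f r - f t) (at_right t)"
          by (intro tendsto_intros right t)
        have "t < hd xs" using mem by simp
        then show "\<forall>\<^sub>F s in at_right t. ?v \<le> 2 * lw t + f r - f s"
          using 1 r by (auto simp: eventually_at_right[OF \<open>t < hd xs\<close>] intro!: exI[of _ "hd xs"])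
      qed simp
      have "?v \<le> 2 * lw t + l - f t"
      proof (rule tendsto_lowerbound)
        show "((\<lambda>r. 2 * lw t + f r - f t) \<longlongrightarrow> 2 * lw t + l - f t) (at_left b)"
          by (intro tendsto_intros fl)
        have "last xs < b" using mem by simp
        then show "\<forall>\<^sub>F r in at_left b. ?v \<le> 2 * lw t + f r - f t"
          using 2 by (auto simp: eventually_at_left[OF \<open>last xs < b\<close>] intro!: exI[of _ "last xs"])
      qed simp
      then show ?thesis by (simp add: lw_def)
    qed (use l lw_nonneg t in simp)
    then show ?thesis
      using l lw_nonneg[OF t] by (auto simp: TV_le_iff low ennreal_plus[symmetric] simp del: ennreal_plus intro!: ennreal_leI)
  qed
  have bounded: "f s \<le> f r + K" "f r \<le> f s + K"
    if "TV f u v \<le> ennreal K" "0 \<le> K" "u < s" "s < r" "r < v" for u v s r K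
  proof -
    have "ennreal (incr f [s, r] + incr (\<lambda>x. - f x) [s, r]) \<le> ennreal K"
      using that(1)[unfolded TV_le_iff, rule_format, of "[s, r]"] that(3-5) by auto
    then have "incr f [s, r] + incr (\<lambda>x. - f x) [s, r] \<le> K" using that(2) by (simp only: ennreal_le_iff)
    then show "f s \<le> f r + K" "f r \<le> f s + K" by simp_all
  qed
  \<comment> \<open>Finite variation keeps \<open>f\<close> near \<open>a\<close> within
    \<open>K\<close> of one fixed value, so the limit cannot be infinite.\<close>
  have conv_a: "la < \<infinity>" if t: "a < t" "t < b" "TV f a t < \<infinity>" for t
  proof -
    obtain K where K: "TV f a t = ennreal K" "0 \<le> K" using t(3) by (cases "TV f a t") auto
    define r where "r = (a + t) / 2"
    have r: "a < r" "r < t" using t by (auto simp: r_def)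
    have "la \<le> ennreal (f r + K)"
    proof (rule tendsto_upperbound[OF la])
      have "f s \<le> f r + K" if "a < s" "s < r" for s
        using bounded(1)[of a t K s r] K r that t by simp
      then show "\<forall>\<^sub>F s in at_right a. ennreal (f s) \<le> ennreal (f r + K)"
        using r by (auto simp: eventually_at_right[OF r(1)] intro!: exI[of _ r] ennreal_leI)
    qed simp
    then show ?thesis by (simp add: le_less_trans)
  qed
  have conv_b: "lb < \<infinity>" if t: "a < t" "t < b" "TV f t b < \<infinity>" for t
  proof -
    obtain K where K: "TV f t b = ennreal K" "0 \<le> K" using t(3) by (cases "TV f t b") auto
    define s where "s = (t + b) / 2"
    have s: "t < s" "s < b" using t by (auto simp: s_def)
    have "lb \<le> ennreal (f s + K)"
    proof (rule tendsto_upperbound[OF lb])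
      have "f r \<le> f s + K" if "s < r" "r < b" for r
        using bounded(2)[of t b K s r] K s that t by simp
      then show "\<forall>\<^sub>F r in at_left b. ennreal (f r) \<le> ennreal (f s + K)"
        using s by (auto simp: eventually_at_left[OF s(2)] intro!: exI[of _ s] ennreal_leI)
    qed simp
    then show ?thesis by (simp add: le_less_trans)
  qed
  have fin_a: "TV f a t < \<infinity>" if "a < t" "t < b" "la < \<infinity>" for t
    by (rule le_less_trans[OF iii_a[OF that]]) (use that in \<open>simp add: low\<close>)
  have fin_b: "TV f t b < \<infinity>" if "a < t" "t < b" "lb < \<infinity>" for t
    by (rule le_less_trans[OF iii_b[OF that]]) (use that in \<open>simp add: low\<close>)
  show ?thesis
    unfolding TV_constraints_def era elb
  proof (intro conjI ballI allI impI iffI)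
    show "cadlag_on a b f" by fact
    show "\<exists>l. ((\<lambda>t. ennreal (f t)) \<longlongrightarrow> l) (at_right a)" using la by blast
    show "\<exists>l. ((\<lambda>t. ennreal (f t)) \<longlongrightarrow> l) (at_left b)" using lb by blast
    show "TV f t1 t2 \<le> low f t1 + low f t2" if "a < t1 \<and> t1 < t2 \<and> t2 < b" for t1 t2
      using i that by blast
    show "TV_pos f a (a + \<epsilon>) \<le> low f (a + \<epsilon>)" "TV_neg f (b - \<epsilon>) b \<le> low f (b - \<epsilon>)"
      if "\<epsilon> \<in> {0<..<b - a}" for \<epsilon> using that by (auto intro!: pos neg)
    show "\<exists>\<epsilon>\<in>{0<..<b - a}. TV f a (a + \<epsilon>) < \<infinity>" if "la < \<infinity>"
      using fin_a[of m] that m by (intro bexI[of _ "m - a"]) auto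
    show "la < \<infinity>" if "\<exists>\<epsilon>\<in>{0<..<b - a}. TV f a (a + \<epsilon>) < \<infinity>"
      using that conv_a by force
    show "TV f a (a + \<epsilon>) \<le> la + low f (a + \<epsilon>)" if "la < \<infinity>" "\<epsilon> \<in> {0<..<b - a}" for \<epsilon>
      using that by (intro iii_a) auto
    show "\<exists>\<epsilon>\<in>{0<..<b - a}. TV f (b - \<epsilon>) b < \<infinity>" if "lb < \<infinity>"
      using fin_b[of m] that m by (intro bexI[of _ "b - m"]) auto
    show "lb < \<infinity>" if "\<exists>\<epsilon>\<in>{0<..<b - a}. TV f (b - \<epsilon>) b < \<infinity>"
      using that conv_b by force
    show "TV f (b - \<epsilon>) b \<le> low f (b - \<epsilon>) + lb" if "lb < \<infinity>" "\<epsilon> \<in> {0<..<b - a}" for \<epsilon>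
      using that by (intro iii_b) auto
  qed
qed

text \<open>The bound by \<open>g s\<close> with \<open>s\<close> in \<open>S\<close> is used for
  \<open>s\<close> tending to \<open>t\<close> from the right, which gives \<open>f t\<close>, and
  from the left, which gives the left limit. Both are required because \<open>low\<close> is their
  minimum.\<close>

lemma TV_constraints_of_dense:
  fixes g :: "real \<Rightarrow> real"
  assumes ab: "a < b" and S: "S \<subseteq> {a<..<b}"
    and dense: "\<And>u v. a \<le> u \<Longrightarrow> u < v \<Longrightarrow> v \<le> b \<Longrightarrow> \<exists>s\<in>S. u < s \<and> s < v"
    and nonneg: "\<And>s. s \<in> S \<Longrightarrow> 0 \<le> g s"
    and rise: "\<And>t xs. t \<in> S \<Longrightarrow> sorted_wrt (<) xs \<Longrightarrow> set xs \<subseteq> S \<inter> {..<t} \<Longrightarrow> incr g xs \<le> g t"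
    and fall: "\<And>t xs. t \<in> S \<Longrightarrow> sorted_wrt (<) xs \<Longrightarrow> set xs \<subseteq> S \<inter> {t<..} \<Longrightarrow>
      incr (\<lambda>x. - g x) xs \<le> g t"
  obtains f where "f \<in> borel_measurable (restrict_space borel {a<..<b})"
    and "countable {s \<in> S. f s \<noteq> g s}" and "\<And>t. a < t \<Longrightarrow> t < b \<Longrightarrow> 0 \<le> f t"
    and "TV_constraints a b f"
proof -
  obtain f G where f: "f \<in> borel_measurable (restrict_space borel {a<..<b})"
    and G: "\<And>s. s \<in> S \<Longrightarrow> G s = g s" and count: "countable {s \<in> S. f s \<noteq> g s}"
    and cadlag: "cadlag_on a b f"
    and right: "\<And>t. a < t \<Longrightarrow> t < b \<Longrightarrow> (G \<longlongrightarrow> f t) (at_right t)"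
    and left: "\<And>t. a < t \<Longrightarrow> t < b \<Longrightarrow> (G \<longlongrightarrow> left_lim f t) (at_left t)"
    using regularize_dense[OF ab S dense rise] by blast
  have freq_r: "\<exists>\<^sub>F s in at_right t. s \<in> S \<and> t < s \<and> s < w" if "a \<le> t" "t < w" "w \<le> b" for t w
    using frequently_eventually_frequently[OF frequently_at_right_dense[of a b S, OF dense that]
      eventually_at_right_less[of t]] by (rule frequently_elim1) blast+
  have freq_l: "\<exists>\<^sub>F s in at_left t. s \<in> S \<and> w < s \<and> s < t" if "a \<le> w" "w < t" "t \<le> b" for t w
    using frequently_eventually_frequently[OF frequently_at_left_dense[of a b S, OF dense that]
      eventually_at_left_real[OF that(2)]] by (rule frequently_elim1) auto
  have f_nonneg: "0 \<le> f t" if "a < t" "t < b" for t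
    using freq_r[of t b] that nonneg G
    by (intro le_limit_frequently[OF right[OF that]]) (auto elim!: frequently_elim1)
  have P: "incr f xs \<le> f t" "incr f xs \<le> left_lim f t"
    if t: "a < t" "t < b" and xs: "sorted_wrt (<) xs" "set xs \<subseteq> {a<..<t}" for t xs
  proof -
    have le: "incr f xs \<le> G s" if s: "s \<in> S" "\<And>x. x \<in> set xs \<Longrightarrow> x < s" for s
    proof (rule incr_le_of_right_limits[of a b S xs G f a s])
      show "(G \<longlongrightarrow> f x) (at_right x)" if "x \<in> set xs" for x using right that xs t by force
      fix ys assume ys: "sorted_wrt (<) ys" "set ys \<subseteq> S \<inter> {a<..<s}"
      have "incr G ys = incr g ys" using ys G by (intro incr_cong) auto
      also have "\<dots> \<le> g s" using ys s by (intro rise) auto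
      finally show "incr G ys \<le> G s" using G s by simp
    qed (use dense xs t s in force)+
    show "incr f xs \<le> f t"
      using freq_r[of t b] t xs
      by (intro le_limit_frequently[OF right[OF t]]) (force elim!: frequently_elim1 intro!: le)
    \<comment> \<open>Points between \<open>w\<close> and \<open>t\<close> lie beyond the whole list
      and still below \<open>t\<close>, also when the list is empty.\<close>
    define w where "w = Max (insert a (set xs))"
    have w: "a \<le> w" "w < t" "\<And>x. x \<in> set xs \<Longrightarrow> x \<le> w" using t xs by (auto simp: w_def)
    show "incr f xs \<le> left_lim f t"
      using freq_l[of w t] t w
      by (intro le_limit_frequently[OF left[OF t]]) (force elim!: frequently_elim1 intro!: le)
  qed
  have N: "incr (\<lambda>x. - f x) xs \<le> f t" "incr (\<lambda>x. - f x) xs \<le> left_lim f t"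
    if t: "a < t" "t < b" and xs: "sorted_wrt (<) xs" "set xs \<subseteq> {t<..<b}" for t xs
  proof -
    have le: "incr (\<lambda>x. - f x) xs \<le> G s" if s: "s \<in> S" "\<And>x. x \<in> set xs \<Longrightarrow> s < x" for s
    proof (rule incr_le_of_right_limits[of a b S xs "\<lambda>x. - G x" "\<lambda>x. - f x" s b])
      show "((\<lambda>x. - G x) \<longlongrightarrow> - f x) (at_right x)" if "x \<in> set xs" for x
        using right that xs t by (intro tendsto_minus) force
      fix ys assume ys: "sorted_wrt (<) ys" "set ys \<subseteq> S \<inter> {s<..<b}"
      have "incr (\<lambda>x. - G x) ys = incr (\<lambda>x. - g x) ys" using ys G by (intro incr_cong) auto
      also have "\<dots> \<le> g s" using ys s by (intro fall) auto
      finally show "incr (\<lambda>x. - G x) ys \<le> G s" using G s by simp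
    qed (use dense xs t s in force)+
    show "incr (\<lambda>x. - f x) xs \<le> left_lim f t"
      using freq_l[of a t] t xs
      by (intro le_limit_frequently[OF left[OF t]]) (force elim!: frequently_elim1 intro!: le)
    define w where "w = Min (insert b (set xs))"
    have w: "w \<le> b" "t < w" "\<And>x. x \<in> set xs \<Longrightarrow> w \<le> x" using t xs by (auto simp: w_def)
    show "incr (\<lambda>x. - f x) xs \<le> f t"
      using freq_r[of t w] t w
      by (intro le_limit_frequently[OF right[OF t]]) (force elim!: frequently_elim1 intro!: le)
  qed
  have "TV_constraints a b f"
    by (rule TV_constraintsI[OF ab cadlag f_nonneg])
       (auto simp: TV_pos_le_iff TV_neg_le_iff low_def intro!: ennreal_leI P N)
  with f count f_nonneg show thesis by (rule that)
qed

section \<open>The density as an almost everywhere limit of difference quotients\<close>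

context bounded_slope_variation
begin

lemma AE_convergent_slope:
  "AE s in lborel. s \<in> {a<..<b} \<longrightarrow> convergent (\<lambda>n. slope \<nu> (1 / 2 ^ n) s)"
proof -
  define X where "X = {(p, q). p \<in> \<rat> \<and> q \<in> \<rat> \<and> a < p \<and> p \<le> q \<and> q < b}"
  have "countable X"
    by (rule countable_subset[of _ "\<rat> \<times> \<rat>"]) (auto simp: X_def intro: countable_rat)
  then have "AE s in lborel. \<forall>(p, q)\<in>X. s \<in> {p..q} \<longrightarrow> convergent (\<lambda>n. slope \<nu> (1 / 2 ^ n) s)"
    using AE_convergent_slope_cbox
    by (subst AE_ball_countable) (auto simp: X_def simp del: atLeastAtMost_iff)
  then show ?thesis
  proof (rule AE_mp, intro AE_I2 impI)
    fix s assume *: "\<forall>(p, q)\<in>X. s \<in> {p..q} \<longrightarrow> convergent (\<lambda>n. slope \<nu> (1 / 2 ^ n) s)"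
      and s: "s \<in> {a<..<b}"
    obtain p q where "p \<in> \<rat>" "a < p" "p < s" "q \<in> \<rat>" "s < q" "q < b"
      using Rats_dense_in_real[of a s] Rats_dense_in_real[of s b] s by auto
    then show "convergent (\<lambda>n. slope \<nu> (1 / 2 ^ n) s)"
      using *[THEN bspec, of "(p, q)"] by (auto simp: X_def)
  qed
qed

text \<open>By Fubini the integral is \<open>1 / h\<close> times the \<open>\<nu>\<close>-integral
  over \<open>u\<close> of the length of \<open>(x, y] \<inter> [u - h, u)\<close>. This length
  never exceeds \<open>h\<close>, vanishes for \<open>u\<close> outside \<open>(x, y + h]\<close>,
  and equals \<open>h\<close> for \<open>u\<close> in \<open>(x + h, y]\<close>.\<close>

lemma nn_integral_slope_sandwich:
  assumes h: "0 < h" and xy: "x < y"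
  shows "(\<integral>\<^sup>+t. ennreal (slope \<nu> h t) * indicator {x<..y} t \<partial>lborel) \<le> emeasure \<nu> {x<..y + h}"
    and "emeasure \<nu> {x + h<..y} \<le> (\<integral>\<^sup>+t. ennreal (slope \<nu> h t) * indicator {x<..y} t \<partial>lborel)"
proof -
  have [simp, measurable_cong]: "sets \<nu> = sets borel" by (rule M_is_borel)
  interpret pair_sigma_finite lborel \<nu> ..
  let ?I = "\<lambda>t u. indicator {x<..y} t * indicator {t<..t + h} u :: ennreal"
  have meas: "(\<lambda>(t, u). ?I t u) \<in> borel_measurable (lborel \<Otimes>\<^sub>M \<nu>)"
    unfolding indicator_def greaterThanAtMost_iff by measurable
  have sl: "ennreal (slope \<nu> h t) = ennreal (1 / h) * emeasure \<nu> {t<..t + h}" for t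
    using h cdf_diff_eq[of t "t + h"]
    by (simp add: slope_def emeasure_eq_measure ennreal_mult[symmetric])
  have "(\<integral>\<^sup>+t. ennreal (slope \<nu> h t) * indicator {x<..y} t \<partial>lborel) =
      (\<integral>\<^sup>+t. ennreal (1 / h) * (\<integral>\<^sup>+u. ?I t u \<partial>\<nu>) \<partial>lborel)"
    by (intro nn_integral_cong) (simp add: sl nn_integral_cmult_indicator mult_ac)
  also have "\<dots> = ennreal (1 / h) * (\<integral>\<^sup>+t. (\<integral>\<^sup>+u. ?I t u \<partial>\<nu>) \<partial>lborel)"
    using meas by (intro nn_integral_cmult) (auto intro!: borel_measurable_nn_integral)
  also have "(\<integral>\<^sup>+t. (\<integral>\<^sup>+u. ?I t u \<partial>\<nu>) \<partial>lborel) = (\<integral>\<^sup>+u. (\<integral>\<^sup>+t. ?I t u \<partial>lborel) \<partial>\<nu>)"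
    using Fubini'[OF meas] by simp
  finally have eq: "(\<integral>\<^sup>+t. ennreal (slope \<nu> h t) * indicator {x<..y} t \<partial>lborel) =
      ennreal (1 / h) * (\<integral>\<^sup>+u. (\<integral>\<^sup>+t. ?I t u \<partial>lborel) \<partial>\<nu>)" .
  have hh: "ennreal (1 / h) * (ennreal h * e) = e" for e
    using h by (simp add: mult.assoc[symmetric] ennreal_mult[symmetric])
  have "(\<integral>\<^sup>+u. (\<integral>\<^sup>+t. ?I t u \<partial>lborel) \<partial>\<nu>) \<le> (\<integral>\<^sup>+u. ennreal h * indicator {x<..y + h} u \<partial>\<nu>)"
  proof (intro nn_integral_mono)
    fix u
    have "(\<integral>\<^sup>+t. ?I t u \<partial>lborel) \<le> (\<integral>\<^sup>+t. indicator {x<..y + h} u * indicator {u - h..<u} t \<partial>lborel)"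
      by (intro nn_integral_mono) (auto simp: indicator_def)
    also have "\<dots> = ennreal h * indicator {x<..y + h} u"
      using h by (subst nn_integral_cmult_indicator) (auto simp: mult.commute)
    finally show "(\<integral>\<^sup>+t. ?I t u \<partial>lborel) \<le> ennreal h * indicator {x<..y + h} u" .
  qed
  then have "(\<integral>\<^sup>+u. (\<integral>\<^sup>+t. ?I t u \<partial>lborel) \<partial>\<nu>) \<le> ennreal h * emeasure \<nu> {x<..y + h}"
    by (simp add: nn_integral_cmult_indicator)
  then show "(\<integral>\<^sup>+t. ennreal (slope \<nu> h t) * indicator {x<..y} t \<partial>lborel) \<le> emeasure \<nu> {x<..y + h}"
    unfolding eq by (subst (2) hh[symmetric]) (intro mult_left_mono, auto)
  have "(\<integral>\<^sup>+u. ennreal h * indicator {x + h<..y} u \<partial>\<nu>) \<le> (\<integral>\<^sup>+u. (\<integral>\<^sup>+t. ?I t u \<partial>lborel) \<partial>\<nu>)"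
  proof (intro nn_integral_mono)
    fix u
    have "ennreal h * indicator {x + h<..y} u = (\<integral>\<^sup>+t. indicator {x + h<..y} u * indicator {u - h..<u} t \<partial>lborel)"
      using h by (subst nn_integral_cmult_indicator) (auto simp: mult.commute)
    also have "\<dots> \<le> (\<integral>\<^sup>+t. ?I t u \<partial>lborel)"
      by (intro nn_integral_mono) (auto simp: indicator_def)
    finally show "ennreal h * indicator {x + h<..y} u \<le> (\<integral>\<^sup>+t. ?I t u \<partial>lborel)" .
  qed
  then have "ennreal h * emeasure \<nu> {x + h<..y} \<le> (\<integral>\<^sup>+u. (\<integral>\<^sup>+t. ?I t u \<partial>lborel) \<partial>\<nu>)"
    by (simp add: nn_integral_cmult_indicator)
  then show "emeasure \<nu> {x + h<..y} \<le> (\<integral>\<^sup>+t. ennreal (slope \<nu> h t) * indicator {x<..y} t \<partial>lborel)"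
    unfolding eq by (subst hh[symmetric]) (intro mult_left_mono, auto)
qed

text \<open>Quotients are uniformly bounded away from the end points, so integral and limit commute
  by dominated convergence. Right continuity of the distribution function closes the sandwich and
  shows that no singular part is lost.\<close>

lemma nn_integral_slope_limit:
  assumes x: "a < x" and xy: "x < y" and y: "y < b"
  shows "(\<integral>\<^sup>+t. ennreal (lim (\<lambda>n. slope \<nu> (1 / 2 ^ n) t)) * indicator {x<..y} t \<partial>lborel) =
    emeasure \<nu> {x<..y}"
proof -
  let ?g = "\<lambda>t. lim (\<lambda>n. slope \<nu> (1 / 2 ^ n) t)"
  obtain C \<delta> where C: "0 < C" "0 < \<delta>"
    "\<And>h s. 0 < h \<Longrightarrow> h < \<delta> \<Longrightarrow> x \<le> s \<Longrightarrow> s \<le> y \<Longrightarrow> slope \<nu> h s \<le> C"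
    using slope_bounded[of x y] assms by fastforce
  have h0: "(\<lambda>n. 1 / 2 ^ n :: real) \<longlonglongrightarrow> 0"
    using LIMSEQ_realpow_zero[of "1/2 :: real"] by (simp add: power_one_over)
  obtain m where m: "\<And>n. n \<ge> m \<Longrightarrow> 1 / 2 ^ n < \<delta>"
    using order_tendstoD(2)[OF h0 C(2)] by (auto simp: eventually_sequentially)
  define h :: "nat \<Rightarrow> real" where "h n = 1 / 2 ^ (n + m)" for n
  have h: "0 < h n" "h n < \<delta>" for n using m by (auto simp: h_def)
  have h_neq: "h n \<noteq> 0" for n using h(1)[of n] by simp
  have h0': "h \<longlonglongrightarrow> 0" unfolding h_def using LIMSEQ_ignore_initial_segment[OF h0, of m] by simp
  have "(\<lambda>n. \<integral>\<^sup>+t. ennreal (slope \<nu> (h n) t) * indicator {x<..y} t \<partial>lborel) \<longlonglongrightarrow>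
      (\<integral>\<^sup>+t. ennreal (?g t) * indicator {x<..y} t \<partial>lborel)"
  proof (rule nn_integral_dominated_convergence)
    show "AE t in lborel. ennreal (slope \<nu> (h n) t) * indicator {x<..y} t \<le> ennreal C * indicator {x<..y} t" for n
      using C(3) h by (auto simp: indicator_def intro!: AE_I2 ennreal_leI)
    show "(\<integral>\<^sup>+t. ennreal C * indicator {x<..y} t \<partial>lborel) < \<infinity>"
      using xy C by (simp add: nn_integral_cmult_indicator ennreal_mult[symmetric])
    show "AE t in lborel. (\<lambda>n. ennreal (slope \<nu> (h n) t) * indicator {x<..y} t) \<longlonglongrightarrow>
        ennreal (?g t) * indicator {x<..y} t"
      using AE_convergent_slope
    proof (rule AE_mp, intro AE_I2 impI)
      fix t assume *: "t \<in> {a<..<b} \<longrightarrow> convergent (\<lambda>n. slope \<nu> (1 / 2 ^ n) t)"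
      show "(\<lambda>n. ennreal (slope \<nu> (h n) t) * indicator {x<..y} t) \<longlonglongrightarrow>
        ennreal (?g t) * indicator {x<..y} t"
      proof (cases "t \<in> {x<..y}")
        case True
        then have "(\<lambda>n. slope \<nu> (1 / 2 ^ n) t) \<longlonglongrightarrow> ?g t"
          using * x y by (auto simp: convergent_LIMSEQ_iff)
        from LIMSEQ_ignore_initial_segment[OF this, of m] show ?thesis
          using True by (simp add: h_def tendsto_ennrealI)
      qed simp
    qed
  qed measurable
  moreover have "(\<lambda>n. \<integral>\<^sup>+t. ennreal (slope \<nu> (h n) t) * indicator {x<..y} t \<partial>lborel) \<longlonglongrightarrow>
      emeasure \<nu> {x<..y}"
  proof (rule tendsto_sandwich)
    show "\<forall>\<^sub>F n in sequentially. emeasure \<nu> {x + h n<..y} \<le>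
        (\<integral>\<^sup>+t. ennreal (slope \<nu> (h n) t) * indicator {x<..y} t \<partial>lborel)"
      using nn_integral_slope_sandwich(2)[OF h(1) xy] by (intro always_eventually) blast
    show "\<forall>\<^sub>F n in sequentially.
        (\<integral>\<^sup>+t. ennreal (slope \<nu> (h n) t) * indicator {x<..y} t \<partial>lborel) \<le> emeasure \<nu> {x<..y + h n}"
      using nn_integral_slope_sandwich(1)[OF h(1) xy] by (intro always_eventually) blast
    have right: "(\<lambda>n. cdf \<nu> (z + h n)) \<longlonglongrightarrow> cdf \<nu> z" for z
    proof (rule filterlim_compose[of "cdf \<nu>" _ "at_right z"])
      show "(cdf \<nu> \<longlongrightarrow> cdf \<nu> z) (at_right z)"
        using cdf_is_right_cont[of z] by (simp add: continuous_within)
      have "(\<lambda>n. z + h n) \<longlonglongrightarrow> z" using tendsto_add[OF tendsto_const h0', of z] by simp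
      then show "filterlim (\<lambda>n. z + h n) (at_right z) sequentially"
        unfolding filterlim_at using h_neq h(1) by (auto intro!: always_eventually)
    qed
    have eq: "emeasure \<nu> {x<..y} = ennreal (cdf \<nu> y - cdf \<nu> x)"
      using cdf_diff_eq[OF xy] by (simp add: emeasure_eq_measure)
    have "(\<lambda>n. ennreal (cdf \<nu> (y + h n) - cdf \<nu> x)) \<longlonglongrightarrow> emeasure \<nu> {x<..y}"
      unfolding eq by (intro tendsto_ennrealI tendsto_diff right tendsto_const)
    moreover have "emeasure \<nu> {x<..y + h n} = ennreal (cdf \<nu> (y + h n) - cdf \<nu> x)" for n
      using cdf_diff_eq[of x "y + h n"] xy h(1)[of n] by (simp add: emeasure_eq_measure)
    ultimately show "(\<lambda>n. emeasure \<nu> {x<..y + h n}) \<longlonglongrightarrow> emeasure \<nu> {x<..y}" by simp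
    have "(\<lambda>n. ennreal (cdf \<nu> y - cdf \<nu> (x + h n))) \<longlonglongrightarrow> emeasure \<nu> {x<..y}"
      unfolding eq by (intro tendsto_ennrealI tendsto_diff right tendsto_const)
    moreover have "\<forall>\<^sub>F n in sequentially. ennreal (cdf \<nu> y - cdf \<nu> (x + h n)) = emeasure \<nu> {x + h n<..y}"
    proof -
      have "\<forall>\<^sub>F n in sequentially. h n < y - x" using order_tendstoD(2)[OF h0', of "y - x"] xy by simp
      then show ?thesis
        by eventually_elim (use cdf_diff_eq in \<open>simp add: emeasure_eq_measure\<close>)
    qed
    ultimately show "(\<lambda>n. emeasure \<nu> {x + h n<..y}) \<longlonglongrightarrow> emeasure \<nu> {x<..y}"
      by (rule Lim_transform_eventually)
  qed
  ultimately show ?thesis by (rule LIMSEQ_unique)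
qed

text \<open>The limit \<open>g\<close> exists on a set \<open>S\<close> with null complement in
  \<open>(a, b)\<close>, hence dense, and inherits \<open>rise\<close> and \<open>fall\<close> there
  because a list is finite. The regular version \<open>f\<close> differs from \<open>g\<close> on a
  null set only, so it is a density as well.\<close>

lemma TV_density_exists:
  "\<exists>f. f \<in> borel_measurable (restrict_space borel {a<..<b}) \<and> (\<forall>t\<in>{a<..<b}. 0 \<le> f t) \<and>
     (\<forall>B\<in>sets borel. B \<subseteq> {a<..<b} \<longrightarrow> emeasure \<nu> B = (\<integral>\<^sup>+t\<in>B. ennreal (f t) \<partial>lborel)) \<and>
     TV_constraints a b f"
proof -
  let ?F = "\<lambda>n t. slope \<nu> (1 / 2 ^ n) t"
  define g where "g t = lim (\<lambda>n. ?F n t)" for t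
  define S where "S = {s \<in> {a<..<b}. convergent (\<lambda>n. ?F n s)}"
  have lim: "(\<lambda>n. ?F n s) \<longlonglongrightarrow> g s" if "s \<in> S" for s
    using that by (simp add: S_def g_def convergent_LIMSEQ_iff)
  have h0: "(\<lambda>n. 1 / 2 ^ n :: real) \<longlonglongrightarrow> 0"
    using LIMSEQ_realpow_zero[of "1/2 :: real"] by (simp add: power_one_over)
  have h_less: "\<forall>\<^sub>F n in sequentially. 1 / 2 ^ n < \<delta>" if "0 < \<delta>" for \<delta> :: real
    using order_tendstoD(2)[OF h0 that] .
  have AE_S: "AE s in lborel. s \<in> {a<..<b} \<longrightarrow> s \<in> S"
    using AE_convergent_slope by (auto simp: S_def)
  obtain f where f: "f \<in> borel_measurable (restrict_space borel {a<..<b})"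
    "countable {s \<in> S. f s \<noteq> g s}" "\<And>t. a < t \<Longrightarrow> t < b \<Longrightarrow> 0 \<le> f t" "TV_constraints a b f"
  proof (rule TV_constraints_of_dense[OF ab, of S g])
    show "S \<subseteq> {a<..<b}" by (auto simp: S_def)
    show "\<exists>s\<in>S. u < s \<and> s < v" if uv: "a \<le> u" "u < v" "v \<le> b" for u v
    proof (rule ccontr)
      assume none: "\<not> ?thesis"
      have "AE s in lborel. s \<notin> {u<..<v}" using AE_S by eventually_elim (use none uv in auto)
      then have "{u<..<v} \<in> null_sets lborel" using AE_iff_null_sets[of "{u<..<v}" lborel] by simp
      then show False using uv by (simp add: null_sets_def)
    qed
    show "0 \<le> g s" if "s \<in> S" for s
      by (rule LIMSEQ_le_const[OF lim[OF that]]) (auto intro!: slope_nonneg)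
    show "incr g xs \<le> g t" if t: "t \<in> S" and xs: "sorted_wrt (<) xs" "set xs \<subseteq> S \<inter> {..<t}" for t xs
    proof (rule tendsto_le[OF _ lim[OF t]])
      show "(\<lambda>n. incr (?F n) xs) \<longlonglongrightarrow> incr g xs" using xs by (intro tendsto_incr lim) auto
      have "\<forall>\<^sub>F n in sequentially. \<forall>x\<in>set xs. 1 / 2 ^ n < t - x"
        using xs by (auto simp: eventually_ball_finite_distrib intro!: h_less)
      moreover have "\<forall>\<^sub>F n in sequentially. 1 / 2 ^ n < b - t"
        using t by (intro h_less) (auto simp: S_def)
      ultimately show "\<forall>\<^sub>F n in sequentially. incr (?F n) xs \<le> ?F n t"
      proof eventually_elim
        case (elim n)
        have "a < x" if "x \<in> set xs" for x using xs that by (auto simp: S_def)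
        then show ?case
          using elim xs strict_sorted_imp_sorted by (intro rise) (force dest: less_imp_le)+
      qed
    qed simp
    show "incr (\<lambda>x. - g x) xs \<le> g t"
      if t: "t \<in> S" and xs: "sorted_wrt (<) xs" "set xs \<subseteq> S \<inter> {t<..}" for t xs
    proof (rule tendsto_le[OF _ lim[OF t]])
      show "(\<lambda>n. incr (\<lambda>x. - ?F n x) xs) \<longlonglongrightarrow> incr (\<lambda>x. - g x) xs"
        using xs by (intro tendsto_incr tendsto_minus lim) auto
      have "\<forall>\<^sub>F n in sequentially. \<forall>x\<in>set xs. 1 / 2 ^ n < b - x"
        using xs by (auto simp: eventually_ball_finite_distrib S_def intro!: h_less)
      moreover have "\<forall>\<^sub>F n in sequentially. 1 / 2 ^ n < t - a"
        using t by (intro h_less) (auto simp: S_def)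
      ultimately show "\<forall>\<^sub>F n in sequentially. incr (\<lambda>x. - ?F n x) xs \<le> ?F n t"
      proof eventually_elim
        case (elim n)
        have "t < x" if "x \<in> set xs" for x using xs that by auto
        then show ?case
          using elim xs strict_sorted_imp_sorted by (intro fall) (force dest: less_imp_le)+
      qed
    qed simp
  qed blast
  let ?f = "\<lambda>t. ennreal (f t) * indicator {a<..<b} t"
  have meas: "?f \<in> borel_measurable borel"
    using f(1) by (subst borel_measurable_restrict_space_iff_ennreal[symmetric])
      (auto intro: measurable_compose[OF _ measurable_ennreal])
  have AE_fg: "AE t in lborel. t \<in> {a<..<b} \<longrightarrow> f t = g t"
  proof -
    have "{s \<in> S. f s \<noteq> g s} \<in> null_sets lborel"
      using f(2) by (rule countable_imp_null_set_lborel)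
    from AE_not_in[OF this] AE_S show ?thesis by eventually_elim auto
  qed
  have interval: "(\<integral>\<^sup>+t. ennreal (f t) * indicator {x<..y} t \<partial>lborel) = emeasure \<nu> {x<..y}"
    if xy: "a < x" "x < y" "y < b" for x y
  proof -
    have "AE t in lborel. ennreal (f t) * indicator {x<..y} t = ennreal (g t) * indicator {x<..y} t"
      using AE_fg by eventually_elim (use xy in \<open>auto simp: indicator_def\<close>)
    then have "(\<integral>\<^sup>+t. ennreal (f t) * indicator {x<..y} t \<partial>lborel) =
        (\<integral>\<^sup>+t. ennreal (g t) * indicator {x<..y} t \<partial>lborel)"
      by (rule nn_integral_cong_AE)
    then show ?thesis using nn_integral_slope_limit[OF xy] by (simp add: g_def)
  qed
  define N1 where "N1 = density lborel ?f"
  define N2 where "N2 = density \<nu> (indicator {a<..<b})"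
  have [simp, measurable_cong]: "sets \<nu> = sets borel" by (rule M_is_borel)
  have sets: "sets N1 = sets borel" "sets N2 = sets borel" by (simp_all add: N1_def N2_def)
  have N1: "emeasure N1 B = (\<integral>\<^sup>+t. ?f t * indicator B t \<partial>lborel)" if "B \<in> sets borel" for B
    using that meas by (simp add: N1_def emeasure_density)
  have N2: "emeasure N2 B = emeasure \<nu> (B \<inter> {a<..<b})" if "B \<in> sets borel" for B
  proof -
    have "emeasure N2 B = (\<integral>\<^sup>+t. indicator {a<..<b} t * indicator B t \<partial>\<nu>)"
      unfolding N2_def using that by (intro emeasure_density) auto
    also have "\<dots> = (\<integral>\<^sup>+t. indicator (B \<inter> {a<..<b}) t \<partial>\<nu>)"
      by (intro nn_integral_cong) (auto simp: indicator_def)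
    also have "\<dots> = emeasure \<nu> (B \<inter> {a<..<b})" using that by (intro nn_integral_indicator) auto
    finally show ?thesis .
  qed
  have N12: "emeasure N1 {x<..} = emeasure N2 {x<..}" for x
  proof (cases "max x a < b")
    case True
    define p where "p = max x a"
    \<comment> \<open>Starting at a third of the length makes every \<open>A n\<close> a proper
      interval that stays away from both ends.\<close>
    define e where "e n = (b - p) / real (n + 3)" for n
    define A where "A n = {p + e n<..b - e n}" for n
    have pb: "a \<le> p" "p < b" "x \<le> p" using True by (auto simp: p_def)
    have lt: "p + e n < b - e n" for n
    proof -
      have "e n \<le> (b - p) / 3" unfolding e_def using pb by (intro frac_le) auto
      then have "3 * e n \<le> b - p" by (simp add: field_simps)
      then show ?thesis using pb by linarith
    qed
    have pos: "0 < e n" for n using pb by (simp add: e_def)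
    have inc: "incseq A"
    proof (rule incseq_SucI)
      fix n
      have "e (Suc n) \<le> e n" unfolding e_def using pb by (intro frac_le) auto
      then show "A n \<le> A (Suc n)" by (auto simp: A_def)
    qed
    have "e \<longlonglongrightarrow> 0"
      unfolding e_def using LIMSEQ_ignore_initial_segment[OF lim_const_over_n[of "b - p"], of 3] by simp
    then have small: "\<exists>n. e n < \<epsilon>" if "0 < \<epsilon>" for \<epsilon>
      using order_tendstoD(2)[OF _ that] by (fastforce simp: eventually_sequentially)
    have U: "(\<Union>n. A n) = {p<..<b}"
    proof (intro equalityI subsetI)
      fix t assume "t \<in> {p<..<b}"
      then obtain n where "e n < min (t - p) (b - t)" using small[of "min (t - p) (b - t)"] by auto
      then show "t \<in> (\<Union>n. A n)" by (auto simp: A_def intro!: exI[of _ n])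
    next
      fix t assume "t \<in> (\<Union>n. A n)"
      then obtain n where "p + e n < t" "t \<le> b - e n" by (auto simp: A_def)
      then show "t \<in> {p<..<b}" using pos[of n] by simp
    qed
    have A_eq: "emeasure N1 (A n) = emeasure N2 (A n)" for n
    proof -
      have sub: "A n \<subseteq> {a<..<b}" using pos[of n] pb by (auto simp: A_def)
      have "emeasure N1 (A n) = (\<integral>\<^sup>+t. ennreal (f t) * indicator (A n) t \<partial>lborel)"
        using sub by (subst N1) (auto simp: A_def indicator_def intro!: nn_integral_cong)
      also have "\<dots> = emeasure \<nu> (A n)"
        unfolding A_def using pos[of n] lt[of n] pb by (intro interval) auto
      also have "\<dots> = emeasure N2 (A n)" using sub by (subst N2) (auto simp: A_def Int_absorb2)
      finally show ?thesis .
    qed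
    have "range A \<subseteq> sets borel" by (auto simp: A_def)
    then have "emeasure N1 {p<..<b} = emeasure N2 {p<..<b}"
      using SUP_emeasure_incseq[of A N1] SUP_emeasure_incseq[of A N2] inc sets A_eq U by simp
    moreover have "emeasure N1 {x<..} = emeasure N1 {p<..<b}"
      by (subst (1 2) N1) (auto intro!: nn_integral_cong simp: p_def indicator_def)
    moreover have "{x<..} \<inter> {a<..<b} = {p<..<b} \<inter> {a<..<b}" by (auto simp: p_def)
    then have "emeasure N2 {x<..} = emeasure N2 {p<..<b}" by (simp add: N2)
    ultimately show ?thesis by simp
  next
    case False
    then have "{x<..} \<inter> {a<..<b} = {}" using ab by auto
    moreover have "?f t * indicator {x<..} t = 0" for t using False ab by (auto simp: indicator_def)
    ultimately show ?thesis by (simp add: N1 N2 del: mult_eq_0_iff)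
  qed
  have "N2 = N1"
    using sets N12 by (intro measure_eqI_lessThan) (auto simp: N2 emeasure_eq_measure)
  then have "emeasure \<nu> B = (\<integral>\<^sup>+t\<in>B. ennreal (f t) \<partial>lborel)"
    if B: "B \<in> sets borel" "B \<subseteq> {a<..<b}" for B
  proof -
    have "emeasure \<nu> B = emeasure N2 B" using B by (simp add: N2 Int_absorb2)
    also have "\<dots> = (\<integral>\<^sup>+t. ?f t * indicator B t \<partial>lborel)" using B \<open>N2 = N1\<close> by (simp add: N1)
    also have "\<dots> = (\<integral>\<^sup>+t\<in>B. ennreal (f t) \<partial>lborel)"
      using B by (intro nn_integral_cong) (auto simp: indicator_def)
    finally show ?thesis .
  qed
  with f show ?thesis by (intro exI[of _ f]) auto
qed

end

section \<open>Locations of a stationary process\<close>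

lemma space_C_cyl: "space C_cyl = C_real"
  by (simp add: C_cyl_def space_restrict_space space_PiM)

lemma measurable_sample_path:
  assumes "\<And>t. X t \<in> borel_measurable M"
    and "\<And>\<omega>. \<omega> \<in> space M \<Longrightarrow> continuous_on UNIV (sample_path X \<omega>)"
  shows "sample_path X \<in> M \<rightarrow>\<^sub>M C_cyl"
  unfolding C_cyl_def
  using assms by (intro measurable_restrict_space2 measurable_PiM_single') (auto simp: sample_path_def[abs_def])

lemma measurable_eval [measurable]: "(\<lambda>f. f t) \<in> borel_measurable C_cyl"
  unfolding C_cyl_def by (intro measurable_restrict_space1 measurable_component_singleton) simp

lemma C_real_shift: "f \<in> C_real \<Longrightarrow> shift c f \<in> C_real"
  by (auto simp: shift_def intro!: continuous_on_compose2[of UNIV f] continuous_intros)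

lemma space_real_inf: "space real_inf = insert \<infinity> (range ereal)"
  by (simp add: real_inf_def space_measure_of_conv)

lemma sets_real_inf:
  "sets real_inf = sigma_sets (insert \<infinity> (range ereal)) (insert {\<infinity>} {ereal ` B | B. B \<in> sets borel})"
  unfolding real_inf_def by (rule sets_measure_of) auto

lemma infty_in_real_inf: "{\<infinity>} \<in> sets real_inf"
  and image_in_real_inf: "B \<in> sets borel \<Longrightarrow> ereal ` B \<in> sets real_inf"
  unfolding sets_real_inf by (auto intro!: sigma_sets.Basic)

lemma local_locationD:
  assumes "L \<in> local_intrinsic_location T"
  shows local_location_measurable: "(\<lambda>f. L f a) \<in> C_cyl \<rightarrow>\<^sub>M real_inf"
    and local_location_shift: "f \<in> C_real \<Longrightarrow> L f a = L (shift c f) (a - c) + ereal c"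
    and local_location_consistent: "f \<in> C_real \<Longrightarrow> L f a \<in> {ereal b..ereal (b + T)} \<Longrightarrow>
        L f b = L f a \<or> L f b \<in> {ereal b..ereal (b + T)} - {ereal a..ereal (a + T)}"
  using assms unfolding local_intrinsic_location_def by blast+

locale continuous_process = prob_space M for M :: "'w measure" +
  fixes X :: "real \<Rightarrow> 'w \<Rightarrow> real"
  assumes rv: "\<And>t. X t \<in> borel_measurable M"
    and cont: "\<And>\<omega>. \<omega> \<in> space M \<Longrightarrow> continuous_on UNIV (sample_path X \<omega>)"
begin

lemma path_measurable: "sample_path X \<in> M \<rightarrow>\<^sub>M C_cyl"
  by (rule measurable_sample_path[OF rv cont])

lemma path_C_real: "\<omega> \<in> space M \<Longrightarrow> sample_path X \<omega> \<in> C_real"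
  using cont by simp

lemma continuous_process_shift: "continuous_process M (\<lambda>t. X (t + c))"
proof unfold_locales
  fix \<omega> assume "\<omega> \<in> space M"
  then show "continuous_on UNIV (sample_path (\<lambda>t. X (t + c)) \<omega>)"
    using C_real_shift[OF path_C_real, of \<omega> c] by (simp add: shift_def sample_path_def[abs_def])
qed (rule rv)

lemma stationary_path_law:
  assumes "stationary_process M X"
  shows "distr M C_cyl (sample_path (\<lambda>t. X (t + c))) = distr M C_cyl (sample_path X)"
proof -
  let ?P = "PiM UNIV (\<lambda>_. borel) :: (real \<Rightarrow> real) measure"
  have meas: "sample_path Y \<in> M \<rightarrow>\<^sub>M ?P" if "\<And>t. Y t \<in> borel_measurable M" for Y :: "real \<Rightarrow> 'w \<Rightarrow> real"
    using that by (intro measurable_PiM_single') (auto simp: sample_path_def[abs_def])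
  have fdd: "emeasure (distr M ?P (sample_path Y)) (prod_emb UNIV (\<lambda>_. borel) J (Pi\<^sub>E J A)) =
      emeasure (distr M (PiM J (\<lambda>_. borel)) (\<lambda>\<omega>. \<lambda>t\<in>J. Y t \<omega>)) (Pi\<^sub>E J A)"
    if Y: "\<And>t. Y t \<in> borel_measurable M" and J: "finite J" "\<And>j. j \<in> J \<Longrightarrow> A j \<in> sets borel"
    for Y :: "real \<Rightarrow> 'w \<Rightarrow> real" and J A
  proof -
    have "(\<lambda>\<omega>. \<lambda>t\<in>J. Y t \<omega>) \<in> M \<rightarrow>\<^sub>M PiM J (\<lambda>_. borel)"
      using Y by (intro measurable_restrict) auto
    moreover have "prod_emb UNIV (\<lambda>_. borel) J (Pi\<^sub>E J A) \<in> sets ?P" "Pi\<^sub>E J A \<in> sets (PiM J (\<lambda>_. borel))"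
      using J by (auto intro!: sets_PiM_I sets_PiM_I_finite)
    moreover have "sample_path Y -` prod_emb UNIV (\<lambda>_. borel) J (Pi\<^sub>E J A) \<inter> space M =
        (\<lambda>\<omega>. \<lambda>t\<in>J. Y t \<omega>) -` Pi\<^sub>E J A \<inter> space M"
      by (auto simp: prod_emb_def sample_path_def PiE_iff)
    ultimately show ?thesis
      using meas[OF Y] by (simp add: emeasure_distr)
  qed
  have "distr M ?P (sample_path (\<lambda>t. X (t + c))) = distr M ?P (sample_path X)"
  proof (rule measure_eqI_PiM_infinite)
    fix A J assume J: "finite J" "J \<subseteq> (UNIV :: real set)" "\<And>i. i \<in> J \<Longrightarrow> A i \<in> sets (borel :: real measure)"
    show "emeasure (distr M ?P (sample_path (\<lambda>t. X (t + c)))) (prod_emb UNIV (\<lambda>_. borel) J (Pi\<^sub>E J A)) =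
      emeasure (distr M ?P (sample_path X)) (prod_emb UNIV (\<lambda>_. borel) J (Pi\<^sub>E J A))"
      using assms J rv by (subst (1 2) fdd) (auto simp: stationary_process_def)
  next
    show "finite_measure (distr M ?P (sample_path (\<lambda>t. X (t + c))))"
      by (intro finite_measure_distr meas rv)
  qed simp_all
  note eq = this
  interpret Y: continuous_process M "\<lambda>t. X (t + c)" by (rule continuous_process_shift)
  show ?thesis
  proof (rule measure_eqI)
    fix A assume "A \<in> sets (distr M C_cyl (sample_path (\<lambda>t. X (t + c))))"
    then have A: "A \<in> sets C_cyl" by simp
    then obtain B where B: "B \<in> sets ?P" "A = C_real \<inter> B"
      unfolding C_cyl_def sets_restrict_space by auto
    \<comment> \<open>Paths lie in \<open>C_real\<close>, so hitting \<open>B\<close> and hitting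
      its trace \<open>A\<close> are the same event; no measurability of \<open>C_real\<close> in
      the product is involved.\<close>
    have "emeasure (distr M C_cyl (sample_path Z)) A = emeasure (distr M ?P (sample_path Z)) B"
      if "continuous_process M Z" for Z
    proof -
      interpret Z: continuous_process M Z by fact
      show ?thesis
        using Z.path_C_real A B
        by (subst (1 2) emeasure_distr)
           (auto intro!: arg_cong[where f="emeasure M"] Z.path_measurable meas Z.rv)
    qed
    then show "emeasure (distr M C_cyl (sample_path (\<lambda>t. X (t + c)))) A = emeasure (distr M C_cyl (sample_path X)) A"
      using eq Y.continuous_process_axioms continuous_process_axioms by simp
  qed simp
qed

lemma location_measurable:
  assumes "L \<in> local_intrinsic_location T"
  shows "(\<lambda>\<omega>. L (sample_path X \<omega>) a) \<in> M \<rightarrow>\<^sub>M real_inf"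
  by (rule measurable_compose[OF path_measurable local_location_measurable[OF assms]])

text \<open>Equivariance under a shift by \<open>a\<close> makes the centred location one fixed
  measurable functional of the shifted path, so its law depends on the law of the shifted process
  alone.\<close>

lemma location_minus_eq:
  assumes "L \<in> local_intrinsic_location T" "\<omega> \<in> space M"
  shows "L (sample_path X \<omega>) a - ereal a = L (sample_path (\<lambda>t. X (t + a)) \<omega>) 0"
proof -
  have "L (sample_path X \<omega>) a = L (shift a (sample_path X \<omega>)) (a - a) + ereal a"
    by (rule local_location_shift[OF assms(1) path_C_real[OF assms(2)]])
  moreover have "shift a (sample_path X \<omega>) = sample_path (\<lambda>t. X (t + a)) \<omega>"
    by (simp add: shift_def sample_path_def)
  ultimately show ?thesis
    by (cases "L (sample_path (\<lambda>t. X (t + a)) \<omega>) 0") simp_all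
qed

lemma location_minus_measurable:
  assumes "L \<in> local_intrinsic_location T"
  shows "(\<lambda>\<omega>. L (sample_path X \<omega>) a - ereal a) \<in> M \<rightarrow>\<^sub>M real_inf"
proof -
  interpret Y: continuous_process M "\<lambda>t. X (t + a)" by (rule continuous_process_shift)
  show ?thesis
    using Y.location_measurable[OF assms, of 0] location_minus_eq[OF assms]
    by (subst measurable_cong[where g="\<lambda>\<omega>. L (sample_path (\<lambda>t. X (t + a)) \<omega>) 0"]) auto
qed

lemma stationary_location_law:
  assumes "stationary_process M X" "L \<in> local_intrinsic_location T"
  shows "distr M real_inf (\<lambda>\<omega>. L (sample_path X \<omega>) a - ereal a) =
    distr M real_inf (\<lambda>\<omega>. L (sample_path X \<omega>) 0)"
proof -
  interpret Y: continuous_process M "\<lambda>t. X (t + a)" by (rule continuous_process_shift)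
  note L = local_location_measurable[OF assms(2)]
  have "distr M real_inf (\<lambda>\<omega>. L (sample_path X \<omega>) a - ereal a) =
      distr M real_inf ((\<lambda>f. L f 0) \<circ> sample_path (\<lambda>t. X (t + a)))"
    by (intro distr_cong) (auto simp: location_minus_eq[OF assms(2)])
  also have "\<dots> = distr (distr M C_cyl (sample_path X)) real_inf (\<lambda>f. L f 0)"
    by (simp add: distr_distr[OF L Y.path_measurable, symmetric] stationary_path_law[OF assms(1)])
  also have "\<dots> = distr M real_inf (\<lambda>\<omega>. L (sample_path X \<omega>) 0)"
    by (subst distr_distr[OF L path_measurable]) (simp add: comp_def)
  finally show ?thesis .
qed

definition loc :: "((real \<Rightarrow> real) \<Rightarrow> real \<Rightarrow> ereal) \<Rightarrow> real \<Rightarrow> real set \<Rightarrow> 'w set" where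
  "loc L a B = {\<omega> \<in> space M. L (sample_path X \<omega>) a \<in> ereal ` B}"

lemma loc_event:
  assumes "L \<in> local_intrinsic_location T" "B \<in> sets borel"
  shows "loc L a B \<in> events"
  using measurable_sets[OF location_measurable[OF assms(1)] image_in_real_inf[OF assms(2)], of a]
  by (simp add: loc_def vimage_def Int_def conj_commute)

lemma stationary_prob_loc:
  assumes st: "stationary_process M X" and L: "L \<in> local_intrinsic_location T" and B: "B \<in> sets borel"
  shows "prob (loc L (a + h) ((\<lambda>x. x + h) ` B)) = prob (loc L a B)"
proof -
  have *: "prob (loc L c ((\<lambda>x. x + c) ` B)) = prob (loc L 0 B)" if B: "B \<in> sets borel" for c B
  proof -
    have "loc L c ((\<lambda>x. x + c) ` B) = (\<lambda>\<omega>. L (sample_path X \<omega>) c - ereal c) -` (ereal ` B) \<inter> space M"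
    proof (intro set_eqI iffI)
      fix \<omega> assume "\<omega> \<in> (\<lambda>\<omega>. L (sample_path X \<omega>) c - ereal c) -` (ereal ` B) \<inter> space M"
      then obtain x where "x \<in> B" "L (sample_path X \<omega>) c - ereal c = ereal x" "\<omega> \<in> space M" by auto
      then show "\<omega> \<in> loc L c ((\<lambda>x. x + c) ` B)"
        by (cases "L (sample_path X \<omega>) c") (auto simp: loc_def image_iff intro!: bexI[of _ x])
    qed (auto simp: loc_def)
    then have "prob (loc L c ((\<lambda>x. x + c) ` B)) =
        measure (distr M real_inf (\<lambda>\<omega>. L (sample_path X \<omega>) c - ereal c)) (ereal ` B)"
      by (simp add: measure_distr location_minus_measurable[OF L] image_in_real_inf[OF B])
    also have "\<dots> = measure (distr M real_inf (\<lambda>\<omega>. L (sample_path X \<omega>) 0)) (ereal ` B)"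
      by (simp only: stationary_location_law[OF st L])
    also have "\<dots> = prob (loc L 0 B)"
      by (simp add: measure_distr location_measurable[OF L] image_in_real_inf[OF B] loc_def
          vimage_def Int_def conj_commute)
    finally show ?thesis .
  qed
  have B': "(\<lambda>x. x - a) ` B \<in> sets borel"
  proof -
    have "(\<lambda>x. x - a) ` B = (\<lambda>x. x + a) -` B \<inter> space borel" by force
    also have "\<dots> \<in> sets borel" by (rule measurable_sets[OF _ B]) simp
    finally show ?thesis .
  qed
  have "(\<lambda>x. x + (a + h)) ` ((\<lambda>x. x - a) ` B) = (\<lambda>x. x + h) ` B" "(\<lambda>x. x + a) ` ((\<lambda>x. x - a) ` B) = B"
    by (auto simp: image_image)
  then show ?thesis using *[OF B', of a] *[OF B', of "a + h"] by simp
qed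

end

section \<open>Mass balance when the window moves\<close>

locale stationary_location = continuous_process M X for M X +
  fixes L :: "(real \<Rightarrow> real) \<Rightarrow> real \<Rightarrow> ereal" and T a :: real
  assumes stationary: "stationary_process M X" and L: "L \<in> local_intrinsic_location T" and T: "0 < T"
begin

lemma loc_in_events [measurable, simp]: "B \<in> sets borel \<Longrightarrow> loc L c B \<in> events"
  by (rule loc_event[OF L])

text \<open>A subprobability measure: the event of an infinite location is removed before
  \<open>real_of_ereal\<close> is applied, which would otherwise send it to an atom at 0.\<close>

definition law :: "real measure" where
  "law = distr (density M (indicator {\<omega> \<in> space M. L (sample_path X \<omega>) a \<noteq> \<infinity>})) borel
    (\<lambda>\<omega>. real_of_ereal (L (sample_path X \<omega>) a))"

lemma emeasure_law:
  assumes B: "B \<in> sets borel"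
  shows "emeasure law B = emeasure M (loc L a B)"
proof -
  let ?Y = "\<lambda>\<omega>. L (sample_path X \<omega>) a"
  have range: "?Y \<omega> = \<infinity> \<or> (\<exists>x. ?Y \<omega> = ereal x)" if "\<omega> \<in> space M" for \<omega>
  proof -
    have "?Y \<omega> \<in> insert \<infinity> (range ereal)"
      using measurable_space[OF location_measurable[OF L, of a] that] unfolding space_real_inf .
    then show ?thesis by blast
  qed
  have fin: "{\<omega> \<in> space M. ?Y \<omega> \<noteq> \<infinity>} = loc L a UNIV"
    by (fastforce simp: loc_def dest: range)
  have inf: "{\<omega> \<in> space M. ?Y \<omega> = \<infinity>} \<in> events"
    using measurable_sets[OF location_measurable[OF L] infty_in_real_inf, of a]
    by (simp add: vimage_def Int_def conj_commute)
  have meas: "(\<lambda>\<omega>. real_of_ereal (?Y \<omega>)) \<in> borel_measurable M"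
  proof (rule measurableI)
    fix A :: "real set" assume A: "A \<in> sets borel"
    have "(\<lambda>\<omega>. real_of_ereal (?Y \<omega>)) -` A \<inter> space M =
        loc L a A \<union> (if 0 \<in> A then {\<omega> \<in> space M. ?Y \<omega> = \<infinity>} else {})"
      using range by (fastforce simp: loc_def split: if_splits)
    then show "(\<lambda>\<omega>. real_of_ereal (?Y \<omega>)) -` A \<inter> space M \<in> events"
      using A inf by simp
  qed simp
  have "emeasure law B = (\<integral>\<^sup>+\<omega>. indicator (loc L a UNIV) \<omega> *
      indicator ((\<lambda>\<omega>. real_of_ereal (?Y \<omega>)) -` B \<inter> space M) \<omega> \<partial>M)"
    unfolding law_def fin using B meas
    by (subst emeasure_distr) (auto intro!: emeasure_density measurable_sets[OF meas])
  also have "\<dots> = (\<integral>\<^sup>+\<omega>. indicator (loc L a B) \<omega> \<partial>M)"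
    using range by (intro nn_integral_cong) (fastforce simp: loc_def indicator_def)
  also have "\<dots> = emeasure M (loc L a B)" using B by (intro nn_integral_indicator) simp
  finally show ?thesis .
qed

lemma finite_borel_law: "finite_borel_measure law"
proof (intro finite_borel_measure.intro finite_measureI finite_borel_measure_axioms.intro)
  show "emeasure law (space law) \<noteq> \<infinity>"
    using emeasure_law[of UNIV] by (simp add: law_def)
qed (simp add: law_def)

interpretation law: finite_borel_measure law by (rule finite_borel_law)

lemma measure_law: "B \<in> sets borel \<Longrightarrow> measure law B = prob (loc L a B)"
  by (simp add: measure_def emeasure_law)

lemma prob_shift: "prob (loc L (a + h) {x + h<..y + h}) = prob (loc L a {x<..y})"
proof -
  have "(\<lambda>x. x + h) ` {x<..y} = {x + h<..y + h}"
    using image_add_greaterThanAtMost[of h x y] by (simp add: add.commute)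
  then show ?thesis using stationary_prob_loc[OF stationary L, of "{x<..y}" a h] by simp
qed

lemma prob_shift_Icc: "prob (loc L (a + h) {x + h..y + h}) = prob (loc L a {x..y})"
proof -
  have "(\<lambda>x. x + h) ` {x..y} = {x + h..y + h}"
    using image_add_atLeastAtMost[of h x y] by (simp add: add.commute)
  then show ?thesis using stationary_prob_loc[OF stationary L, of "{x..y}" a h] by simp
qed

lemma slope_law: "0 < h \<Longrightarrow> slope law h t = prob (loc L a {t<..t + h}) / h"
  using law.cdf_diff_eq[of t "t + h"] by (simp add: slope_def measure_law)

text \<open>Exchanging terms, the mass of \<open>(t, t + h]\<close> minus that of
  \<open>(s, s + h]\<close> is the mass of \<open>(s + h, t + h]\<close> minus that of
  \<open>(s, t]\<close>. Stationarity moves the latter by \<open>h\<close>, so that an increment of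
  the quotient compares two windows on one and the same set.\<close>

lemma slope_law_diff:
  assumes "0 < h" "s \<le> t"
  shows "slope law h t - slope law h s =
    (prob (loc L a {s + h<..t + h}) - prob (loc L (a + h) {s + h<..t + h})) / h"
proof (cases "s = t")
  case False
  then have "cdf law t - cdf law s = prob (loc L a {s<..t})"
    "cdf law (t + h) - cdf law (s + h) = prob (loc L a {s + h<..t + h})"
    using assms law.cdf_diff_eq[of s t] law.cdf_diff_eq[of "s + h" "t + h"] by (simp_all add: measure_law)
  then show ?thesis
    unfolding slope_def prob_shift using assms by (simp add: diff_divide_distrib[symmetric])
qed (simp add: loc_def)

lemma loc_disjoint: "B \<inter> C = {} \<Longrightarrow> loc L c B \<inter> loc L c C = {}"
  by (auto simp: loc_def)

lemma loc_mono: "B \<subseteq> C \<Longrightarrow> loc L c B \<subseteq> loc L c C"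
  by (auto simp: loc_def)

lemma loc_singleton_iff: "\<omega> \<in> loc L c {x} \<Longrightarrow> \<omega> \<in> loc L c B \<longleftrightarrow> x \<in> B"
  by (auto simp: loc_def)

lemma loc_Un: "loc L c (B \<union> C) = loc L c B \<union> loc L c C"
  by (auto simp: loc_def)

text \<open>If the old location is still available in the moved window, consistency allows the new
  one to differ only by being a point outside the old window, that is, in the strip that has just
  entered.\<close>

lemma location_forward:
  assumes "\<omega> \<in> loc L a {x}" "0 < h" "a + h \<le> x" "x \<le> a + T + h"
  shows "\<omega> \<in> loc L (a + h) {x} \<or> \<omega> \<in> loc L (a + h) {a + T<..a + T + h}"
proof -
  let ?f = "sample_path X \<omega>"
  have \<omega>: "\<omega> \<in> space M" "L ?f a = ereal x" using assms(1) by (auto simp: loc_def)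
  then have "L ?f a \<in> {ereal (a + h)..ereal (a + h + T)}" using assms by (simp add: add_ac)
  then have "L ?f (a + h) = L ?f a \<or>
      L ?f (a + h) \<in> {ereal (a + h)..ereal (a + h + T)} - {ereal a..ereal (a + T)}"
    by (rule local_location_consistent[OF L path_C_real[OF \<omega>(1)]])
  then show ?thesis
  proof
    assume "L ?f (a + h) \<in> {ereal (a + h)..ereal (a + h + T)} - {ereal a..ereal (a + T)}"
    then obtain y where "L ?f (a + h) = ereal y" "a + h \<le> y" "y \<le> a + h + T" "\<not> (a \<le> y \<and> y \<le> a + T)"
      by (cases "L ?f (a + h)") auto
    then have "y \<in> {a + T<..a + T + h}" using \<open>0 < h\<close> by auto
    then show ?thesis using \<omega>(1) \<open>L ?f (a + h) = ereal y\<close> by (simp add: loc_def)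
  qed (use \<omega> in \<open>simp add: loc_def\<close>)
qed

lemma location_backward:
  assumes "\<omega> \<in> loc L (a + h) {x}" "0 < h" "a \<le> x" "x \<le> a + T"
  shows "\<omega> \<in> loc L a {x} \<or> \<omega> \<in> loc L a {a..<a + h}"
proof -
  let ?f = "sample_path X \<omega>"
  have \<omega>: "\<omega> \<in> space M" "L ?f (a + h) = ereal x" using assms(1) by (auto simp: loc_def)
  then have "L ?f (a + h) \<in> {ereal a..ereal (a + T)}" using assms by simp
  then have "L ?f a = L ?f (a + h) \<or>
      L ?f a \<in> {ereal a..ereal (a + T)} - {ereal (a + h)..ereal (a + h + T)}"
    by (rule local_location_consistent[OF L path_C_real[OF \<omega>(1)]])
  then show ?thesis
  proof
    assume "L ?f a \<in> {ereal a..ereal (a + T)} - {ereal (a + h)..ereal (a + h + T)}"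
    then obtain y where "L ?f a = ereal y" "a \<le> y" "y \<le> a + T" "\<not> (a + h \<le> y \<and> y \<le> a + h + T)"
      by (cases "L ?f a") auto
    then have "y \<in> {a..<a + h}" using \<open>0 < h\<close> by auto
    then show ?thesis using \<omega>(1) \<open>L ?f a = ereal y\<close> by (simp add: loc_def)
  qed (use \<omega> in \<open>simp add: loc_def\<close>)
qed

lemma loc_singletonE:
  assumes "\<omega> \<in> loc L c B" obtains x where "x \<in> B" "\<omega> \<in> loc L c {x}"
  using assms by (auto simp: loc_def)

text \<open>By stationarity \<open>?S\<close> and \<open>?S'\<close> have equal probability, so
  entering \<open>?S'\<close> from outside \<open>?S\<close> is as likely as leaving
  \<open>?S\<close> without reaching \<open>?S'\<close>. The jumps in \<open>?Q\<close> are of the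
  first kind. The second kind cannot jump to the new strip, which lies in \<open>?S'\<close>; its
  location stays put, and must be in \<open>(t, t + h]\<close>.\<close>

lemma flux_right:
  assumes h: "0 < h" "a + h \<le> t" "t + h \<le> a + T"
  shows "prob (loc L a {a + h<..t} \<inter> loc L (a + h) {a + T<..a + T + h}) \<le> prob (loc L a {t<..t + h})"
proof -
  let ?S = "loc L a {t<..a + T}" and ?S' = "loc L (a + h) {t + h<..a + T + h}"
  let ?Q = "loc L a {a + h<..t} \<inter> loc L (a + h) {a + T<..a + T + h}"
  have "loc L a {a + h<..t} \<inter> ?S = {}" by (rule loc_disjoint) auto
  then have "?Q \<inter> (?S \<inter> ?S') = {}" by blast
  then have "prob ?Q + prob (?S \<inter> ?S') = prob (?Q \<union> (?S \<inter> ?S'))"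
    by (intro finite_measure_Union[symmetric]) auto
  also have "\<dots> \<le> prob ?S'"
  proof (rule finite_measure_mono)
    have "loc L (a + h) {a + T<..a + T + h} \<subseteq> ?S'" using h by (intro loc_mono) auto
    then show "?Q \<union> (?S \<inter> ?S') \<subseteq> ?S'" by blast
  qed simp
  also have "\<dots> = prob ?S" by (rule prob_shift)
  also have "\<dots> = prob (?S \<inter> ?S') + prob (?S - ?S')"
    by (subst finite_measure_Diff') auto
  also have "prob (?S - ?S') \<le> prob (loc L a {t<..t + h})"
  proof (intro finite_measure_mono subsetI)
    fix \<omega> assume \<omega>: "\<omega> \<in> ?S - ?S'"
    then obtain x where x: "x \<in> {t<..a + T}" "\<omega> \<in> loc L a {x}" by (auto elim: loc_singletonE)
    have "\<omega> \<notin> loc L (a + h) {a + T<..a + T + h}"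
    proof -
      have "loc L (a + h) {a + T<..a + T + h} \<subseteq> ?S'" using h by (intro loc_mono) auto
      then show ?thesis using \<omega> by blast
    qed
    then have "\<omega> \<in> loc L (a + h) {x}" using location_forward[OF x(2) h(1)] x(1) h by auto
    then have "x \<notin> {t + h<..a + T + h}" using \<omega> loc_singleton_iff by blast
    then show "\<omega> \<in> loc L a {t<..t + h}" using x h loc_singleton_iff[OF x(2)] by auto
  qed simp
  finally show ?thesis by simp
qed

text \<open>The same balance read backwards, for the mass to the left of \<open>t\<close>. The sets
  are closed at the left end because a location may sit on the boundary of its window.\<close>

lemma flux_left:
  assumes h: "0 < h" "a + h \<le> t" "t + h \<le> a + T"
  shows "prob (loc L a {a..<a + h} \<inter> loc L (a + h) {t + h<..a + T}) \<le> prob (loc L a {t<..t + h})"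
proof -
  let ?S = "loc L a {a..t}" and ?S' = "loc L (a + h) {a + h..t + h}"
  let ?Q = "loc L a {a..<a + h} \<inter> loc L (a + h) {t + h<..a + T}"
  have "loc L (a + h) {t + h<..a + T} \<inter> ?S' = {}" by (rule loc_disjoint) auto
  then have "?Q \<inter> (?S' \<inter> ?S) = {}" by blast
  then have "prob ?Q + prob (?S' \<inter> ?S) = prob (?Q \<union> (?S' \<inter> ?S))"
    by (intro finite_measure_Union[symmetric]) auto
  also have "\<dots> \<le> prob ?S"
  proof (rule finite_measure_mono)
    have "loc L a {a..<a + h} \<subseteq> ?S" using h by (intro loc_mono) auto
    then show "?Q \<union> (?S' \<inter> ?S) \<subseteq> ?S" by blast
  qed simp
  also have "\<dots> = prob ?S'" by (rule prob_shift_Icc[symmetric])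
  also have "\<dots> = prob (?S' \<inter> ?S) + prob (?S' - ?S)"
    by (subst finite_measure_Diff') auto
  also have "prob (?S' - ?S) \<le> prob (loc L a {t<..t + h})"
  proof (intro finite_measure_mono subsetI)
    fix \<omega> assume \<omega>: "\<omega> \<in> ?S' - ?S"
    then obtain x where x: "x \<in> {a + h..t + h}" "\<omega> \<in> loc L (a + h) {x}" by (auto elim: loc_singletonE)
    have "\<omega> \<notin> loc L a {a..<a + h}"
    proof -
      have "loc L a {a..<a + h} \<subseteq> ?S" using h by (intro loc_mono) auto
      then show ?thesis using \<omega> by blast
    qed
    then have *: "\<omega> \<in> loc L a {x}" using location_backward[OF x(2) h(1)] x(1) h by auto
    then have "x \<notin> {a..t}" using \<omega> loc_singleton_iff by blast
    then show "\<omega> \<in> loc L a {t<..t + h}" using x h loc_singleton_iff[OF *] by auto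
  qed simp
  finally show ?thesis by simp
qed

lemma prob_diff_le:
  assumes "A \<in> events" "B \<in> events" "C \<in> events" "A - B \<subseteq> C"
  shows "prob A - prob B \<le> prob C"
proof -
  have "prob A \<le> prob (B \<union> C)" using assms by (intro finite_measure_mono) auto
  also have "\<dots> \<le> prob B + prob C" using assms by (intro measure_Un_le) auto
  finally show ?thesis by simp
qed

lemma prob_strip_diff:
  assumes "s \<le> t" "r \<le> s" and E: "E \<in> events"
  shows "prob (loc L c {r<..t} \<inter> E) - prob (loc L c {r<..s} \<inter> E) = prob (loc L c {s<..t} \<inter> E)"
proof -
  have "loc L c {r<..t} \<inter> E = (loc L c {r<..s} \<inter> E) \<union> (loc L c {s<..t} \<inter> E)"
    using assms loc_Un[of c "{r<..s}" "{s<..t}"] by (auto simp: ivl_disj_un)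
  moreover have "(loc L c {r<..s} \<inter> E) \<inter> (loc L c {s<..t} \<inter> E) = {}"
    using loc_disjoint[of "{r<..s}" "{s<..t}" c] by auto
  ultimately show ?thesis using E by (simp add: finite_measure_Union)
qed

sublocale law: bounded_slope_variation law a "a + T"
proof
  show "a < a + T" using T by simp
  fix h t :: real and xs :: "real list"
  assume h: "0 < h" and xs: "sorted xs"
  have nonneg: "0 \<le> slope law h t" using h by (simp add: slope_law)
  {
    assume th: "t + h \<le> a + T" and sub: "set xs \<subseteq> {a<..t - h}"
    show "incr (slope law h) xs \<le> slope law h t"
    proof (cases "xs = []")
      case False
      define E where "E = loc L (a + h) {a + T<..a + T + h}"
      \<comment> \<open>The location can disappear from a strip only by jumping to the entering
        strip, the event \<open>E\<close>. Cumulating these jumps from the left end makes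
        \<open>A\<close> additive, so the sum over the list telescopes to one flux.\<close>
      define A where "A s = prob (loc L a {a + h<..s + h} \<inter> E) / h" for s
      have E: "E \<in> events" by (simp add: E_def)
      have last: "last xs \<in> {a<..t - h}" using sub last_in_set[OF False] by blast
      have "incr (slope law h) xs \<le> A (last xs) - A (hd xs)"
      proof (rule incr_le_telescope[OF xs False])
        fix s r assume sr: "s \<in> set xs" "r \<in> set xs" "s \<le> r"
        let ?B = "{s + h<..r + h}"
        have s: "a < s" "r \<le> t - h" using sub sr by auto
        have A: "A r - A s = prob (loc L a ?B \<inter> E) / h"
          unfolding A_def using sr s E
          by (subst prob_strip_diff[symmetric, of "s + h" _ "a + h"]) (auto simp: diff_divide_distrib)
        have "loc L a ?B - loc L (a + h) ?B \<subseteq> loc L a ?B \<inter> E"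
        proof
          fix \<omega> assume \<omega>: "\<omega> \<in> loc L a ?B - loc L (a + h) ?B"
          then obtain x where x: "x \<in> ?B" "\<omega> \<in> loc L a {x}" by (auto elim: loc_singletonE)
          then have "\<omega> \<notin> loc L (a + h) {x}" using \<omega> loc_singleton_iff by blast
          then show "\<omega> \<in> loc L a ?B \<inter> E"
            using location_forward[OF x(2) h] x \<omega> s th h by (auto simp: E_def)
        qed
        then have "prob (loc L a ?B) - prob (loc L (a + h) ?B) \<le> prob (loc L a ?B \<inter> E)"
          using E by (intro prob_diff_le) auto
        then show "max (slope law h r - slope law h s) 0 \<le> A r - A s"
          unfolding A slope_law_diff[OF h sr(3)] using h by (simp add: divide_right_mono)
      qed
      also have "\<dots> \<le> prob (loc L a {a + h<..t} \<inter> E) / h"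
      proof -
        have "prob (loc L a {a + h<..last xs + h} \<inter> E) \<le> prob (loc L a {a + h<..t} \<inter> E)"
          using E last by (intro finite_measure_mono Int_mono loc_mono) auto
        then have "A (last xs) \<le> prob (loc L a {a + h<..t} \<inter> E) / h"
          unfolding A_def using h by (intro divide_right_mono) auto
        moreover have "0 \<le> A (hd xs)" using h by (simp add: A_def)
        ultimately show ?thesis by linarith
      qed
      also have "\<dots> \<le> slope law h t"
        unfolding slope_law[OF h] E_def using h th last by (intro divide_right_mono flux_right) auto
      finally show ?thesis .
    qed (simp add: nonneg)
  }
  {
    assume th: "a + h \<le> t" and sub: "set xs \<subseteq> {t..a + T - h}"
    show "incr (\<lambda>x. - slope law h x) xs \<le> slope law h t"
    proof (cases "xs = []")
      case False
      define E where "E = loc L a {a..<a + h}"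
      \<comment> \<open>For falls the roles are exchanged: mass that is new in a strip after the
        move comes from the leaving strip, and it is cumulated from \<open>t + h\<close>
        upwards.\<close>
      define A where "A s = prob (loc L (a + h) {t + h<..s + h} \<inter> E) / h" for s
      have E: "E \<in> events" by (simp add: E_def)
      have last: "last xs \<in> {t..a + T - h}" using sub last_in_set[OF False] by blast
      have "incr (\<lambda>x. - slope law h x) xs \<le> A (last xs) - A (hd xs)"
      proof (rule incr_le_telescope[OF xs False])
        fix s r assume sr: "s \<in> set xs" "r \<in> set xs" "s \<le> r"
        let ?B = "{s + h<..r + h}"
        have s: "t \<le> s" "r \<le> a + T - h" using sub sr by auto
        have A: "A r - A s = prob (loc L (a + h) ?B \<inter> E) / h"
          unfolding A_def using sr s E
          by (subst prob_strip_diff[symmetric, of "s + h" _ "t + h"]) (auto simp: diff_divide_distrib)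
        have "loc L (a + h) ?B - loc L a ?B \<subseteq> loc L (a + h) ?B \<inter> E"
        proof
          fix \<omega> assume \<omega>: "\<omega> \<in> loc L (a + h) ?B - loc L a ?B"
          then obtain x where x: "x \<in> ?B" "\<omega> \<in> loc L (a + h) {x}" by (auto elim: loc_singletonE)
          then have "\<omega> \<notin> loc L a {x}" using \<omega> loc_singleton_iff by blast
          then show "\<omega> \<in> loc L (a + h) ?B \<inter> E"
            using location_backward[OF x(2) h] x \<omega> s th h by (auto simp: E_def)
        qed
        then have "prob (loc L (a + h) ?B) - prob (loc L a ?B) \<le> prob (loc L (a + h) ?B \<inter> E)"
          using E by (intro prob_diff_le) auto
        then have "(prob (loc L (a + h) ?B) - prob (loc L a ?B)) / h \<le> A r - A s"
          unfolding A using h by (simp add: divide_right_mono)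
        moreover have "- slope law h r - - slope law h s = (prob (loc L (a + h) ?B) - prob (loc L a ?B)) / h"
          using slope_law_diff[OF h sr(3)] by (simp add: diff_divide_distrib)
        moreover have "0 \<le> A r - A s" unfolding A using h by simp
        ultimately show "max (- slope law h r - - slope law h s) 0 \<le> A r - A s" by simp
      qed
      also have "\<dots> \<le> prob (E \<inter> loc L (a + h) {t + h<..a + T}) / h"
      proof -
        have "prob (loc L (a + h) {t + h<..last xs + h} \<inter> E) \<le> prob (E \<inter> loc L (a + h) {t + h<..a + T})"
        proof (rule finite_measure_mono)
          have "loc L (a + h) {t + h<..last xs + h} \<subseteq> loc L (a + h) {t + h<..a + T}"
            using last by (intro loc_mono) auto
          then show "loc L (a + h) {t + h<..last xs + h} \<inter> E \<subseteq> E \<inter> loc L (a + h) {t + h<..a + T}" by blast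
        qed (use E in simp)
        then have "A (last xs) \<le> prob (E \<inter> loc L (a + h) {t + h<..a + T}) / h"
          unfolding A_def using h by (intro divide_right_mono) auto
        moreover have "0 \<le> A (hd xs)" using h by (simp add: A_def)
        ultimately show ?thesis by linarith
      qed
      also have "\<dots> \<le> slope law h t"
        unfolding slope_law[OF h] E_def using h th last by (intro divide_right_mono flux_left) auto
      finally show ?thesis .
    qed (simp add: nonneg)
  }
qed

lemma location_TV_density:
  "\<exists>f. has_density_on M (\<lambda>\<omega>. L (sample_path X \<omega>) a) a (a + T) f \<and> TV_constraints a (a + T) f"
  using law.TV_density_exists emeasure_law by (fastforce simp: has_density_on_def loc_def)

end

section \<open>First and last points of equivariant sets\<close>

lemma measurable_real_infI:
  assumes range: "\<And>\<omega>. \<omega> \<in> space M \<Longrightarrow> Y \<omega> \<in> insert \<infinity> (range ereal)"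
    and Y: "Y \<in> borel_measurable M"
  shows "Y \<in> M \<rightarrow>\<^sub>M real_inf"
proof (rule measurable_sigma_sets[OF sets_real_inf])
  show "Y \<in> space M \<rightarrow> insert \<infinity> (range ereal)" using range by blast
  fix A assume A: "A \<in> insert {\<infinity>} {ereal ` B |B. B \<in> sets borel}"
  have inf: "Y -` {\<infinity>} \<inter> space M \<in> sets M" using Y by (rule measurable_sets) simp
  consider "A = {\<infinity>}" | B where "A = ereal ` B" "B \<in> sets borel" using A by blast
  then show "Y -` A \<inter> space M \<in> sets M"
  proof cases
    case 2
    have "(\<lambda>\<omega>. real_of_ereal (Y \<omega>)) -` B \<inter> space M \<in> sets M"
      using Y 2 by (intro measurable_sets[OF borel_measurable_real_of_ereal]) auto
    moreover have "Y \<omega> \<in> ereal ` B \<longleftrightarrow> real_of_ereal (Y \<omega>) \<in> B \<and> Y \<omega> \<noteq> \<infinity>" if "\<omega> \<in> space M" for \<omega>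
      using range[OF that] by (cases "Y \<omega>") auto
    then have "Y -` A \<inter> space M =
        ((\<lambda>\<omega>. real_of_ereal (Y \<omega>)) -` B \<inter> space M) - (Y -` {\<infinity>} \<inter> space M)"
      unfolding 2(1) by blast
    ultimately show ?thesis using inf by auto
  qed (use inf in simp)
qed auto

lemma ereal_measurable_atMost:
  fixes Y :: "'a \<Rightarrow> ereal"
  assumes "\<And>s::real. {\<omega> \<in> space M. Y \<omega> \<le> ereal s} \<in> sets M"
    and "\<And>\<omega>. \<omega> \<in> space M \<Longrightarrow> Y \<omega> \<noteq> -\<infinity>"
  shows "Y \<in> borel_measurable M"
  unfolding borel_measurable_iff_Iic_ereal
proof
  fix a :: ereal
  show "Y -` {..a} \<inter> space M \<in> sets M"
  proof (cases a)
    case (real r)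
    then show ?thesis using assms(1)[of r] by (simp add: vimage_def Int_def conj_commute)
  next
    case MInf
    then have "Y -` {..a} \<inter> space M = {}" using assms(2) by auto
    then show ?thesis by simp
  next
    case PInf
    then have "Y -` {..a} \<inter> space M = space M" by auto
    then show ?thesis by simp
  qed
qed

lemma ereal_measurable_atLeast:
  fixes Y :: "'a \<Rightarrow> ereal"
  assumes "\<And>s::real. {\<omega> \<in> space M. ereal s \<le> Y \<omega>} \<in> sets M"
    and "{\<omega> \<in> space M. Y \<omega> = \<infinity>} \<in> sets M"
  shows "Y \<in> borel_measurable M"
  unfolding borel_measurable_iff_Ici_ereal
proof
  fix a :: ereal
  show "Y -` {a..} \<inter> space M \<in> sets M"
  proof (cases a)
    case (real r)
    then show ?thesis using assms(1)[of r] by (simp add: vimage_def Int_def conj_commute)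
  next
    case PInf
    then show ?thesis using assms(2) by (simp add: vimage_def Int_def conj_commute)
  next
    case MInf
    then have "Y -` {a..} \<inter> space M = space M" by auto
    then show ?thesis by simp
  qed
qed

text \<open>Measurability is required only for hitting compact intervals; these events determine the
  distribution functions of first and last points.\<close>

locale equivariant_set =
  fixes N :: "(real \<Rightarrow> real) \<Rightarrow> real set"
  assumes closed: "\<And>f. f \<in> C_real \<Longrightarrow> closed (N f)"
    and shift_iff: "\<And>f c x. f \<in> C_real \<Longrightarrow> x \<in> N (shift c f) \<longleftrightarrow> x + c \<in> N f"
    and meets: "\<And>u v. {f \<in> C_real. N f \<inter> {u..v} \<noteq> {}} \<in> sets C_cyl"
begin

definition first_point :: "real \<Rightarrow> (real \<Rightarrow> real) \<Rightarrow> real \<Rightarrow> ereal" where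
  "first_point T f a = (if N f \<inter> {a..a + T} = {} then \<infinity> else ereal (Inf (N f \<inter> {a..a + T})))"

definition last_point :: "real \<Rightarrow> (real \<Rightarrow> real) \<Rightarrow> real \<Rightarrow> ereal" where
  "last_point T f a = (if N f \<inter> {a..a + T} = {} then \<infinity> else ereal (Sup (N f \<inter> {a..a + T})))"

lemma first_point_eq_iff:
  assumes "f \<in> C_real"
  shows "first_point T f a = ereal x \<longleftrightarrow>
    x \<in> N f \<inter> {a..a + T} \<and> (\<forall>y\<in>N f \<inter> {a..a + T}. x \<le> y)"
proof (cases "N f \<inter> {a..a + T} = {}")
  case False
  let ?A = "N f \<inter> {a..a + T}"
  have bdd: "bdd_below ?A" by (rule bdd_below.I[of _ a]) auto
  have mem: "Inf ?A \<in> ?A"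
    using False bdd closed[OF assms] by (intro closed_contains_Inf) (auto intro: closed_Int)
  have le: "Inf ?A \<le> y" if "y \<in> ?A" for y using that bdd by (rule cInf_lower)
  have "Inf ?A = x \<longleftrightarrow> x \<in> ?A \<and> (\<forall>y\<in>?A. x \<le> y)"
    using mem le by (metis order.antisym)
  then show ?thesis using False by (simp add: first_point_def)
qed (simp add: first_point_def)

lemma last_point_eq_iff:
  assumes "f \<in> C_real"
  shows "last_point T f a = ereal x \<longleftrightarrow>
    x \<in> N f \<inter> {a..a + T} \<and> (\<forall>y\<in>N f \<inter> {a..a + T}. y \<le> x)"
proof (cases "N f \<inter> {a..a + T} = {}")
  case False
  let ?A = "N f \<inter> {a..a + T}"
  have bdd: "bdd_above ?A" by (rule bdd_above.I[of _ "a + T"]) auto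
  have mem: "Sup ?A \<in> ?A"
    using False bdd closed[OF assms] by (intro closed_contains_Sup) (auto intro: closed_Int)
  have le: "y \<le> Sup ?A" if "y \<in> ?A" for y using that bdd by (rule cSup_upper)
  have "Sup ?A = x \<longleftrightarrow> x \<in> ?A \<and> (\<forall>y\<in>?A. y \<le> x)"
    using mem le by (metis order.antisym)
  then show ?thesis using False by (simp add: last_point_def)
qed (simp add: last_point_def)

lemma first_point_cases:
  obtains "first_point T f a = \<infinity>" "N f \<inter> {a..a + T} = {}"
  | x where "first_point T f a = ereal x" "N f \<inter> {a..a + T} \<noteq> {}"
  by (auto simp: first_point_def)

lemma last_point_cases:
  obtains "last_point T f a = \<infinity>" "N f \<inter> {a..a + T} = {}"
  | x where "last_point T f a = ereal x" "N f \<inter> {a..a + T} \<noteq> {}"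
  by (auto simp: last_point_def)

text \<open>For consistency, suppose the minimal points of two windows each lie in the other window.
  Each then bounds the other from below, so they coincide.\<close>

lemma first_point_local: "first_point T \<in> local_intrinsic_location T"
  unfolding local_intrinsic_location_def
proof (intro CollectI conjI allI ballI impI)
  fix a
  show "(\<lambda>f. first_point T f a) \<in> C_cyl \<rightarrow>\<^sub>M real_inf"
  proof (intro measurable_real_infI ereal_measurable_atMost)
    fix s :: real
    have "{f \<in> space C_cyl. first_point T f a \<le> ereal s} = {f \<in> C_real. N f \<inter> {a..min s (a + T)} \<noteq> {}}"
      unfolding space_C_cyl
    proof (intro Collect_cong conj_cong refl)
      fix f assume f: "f \<in> C_real"
      show "first_point T f a \<le> ereal s \<longleftrightarrow> N f \<inter> {a..min s (a + T)} \<noteq> {}"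
      proof (rule first_point_cases[of T f a])
        assume "first_point T f a = \<infinity>" "N f \<inter> {a..a + T} = {}"
        then show ?thesis by auto
      next
        fix x assume x: "first_point T f a = ereal x"
        then have "x \<in> N f \<inter> {a..a + T}" "\<And>y. y \<in> N f \<inter> {a..a + T} \<Longrightarrow> x \<le> y"
          using first_point_eq_iff[OF f] by blast+
        then have "x \<le> s \<longleftrightarrow> N f \<inter> {a..min s (a + T)} \<noteq> {}" by fastforce
        then show ?thesis using x by simp
      qed
    qed
    then show "{f \<in> space C_cyl. first_point T f a \<le> ereal s} \<in> sets C_cyl" using meets by simp
  qed (auto simp: first_point_def)
next
  fix f a assume f: "f \<in> C_real"
  show "first_point T f a \<in> {ereal a..ereal (a + T)} \<union> {\<infinity>}"
  proof (rule first_point_cases[of T f a])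
    fix x assume x: "first_point T f a = ereal x"
    then have "x \<in> {a..a + T}" using first_point_eq_iff[OF f] by blast
    then show ?thesis using x by simp
  qed simp
  fix c
  have mem: "y \<in> N (shift c f) \<inter> {a - c..a - c + T} \<longleftrightarrow> y + c \<in> N f \<inter> {a..a + T}" for y
    using shift_iff[OF f] by auto
  show "first_point T f a = first_point T (shift c f) (a - c) + ereal c"
  proof (rule first_point_cases[of T f a])
    assume *: "first_point T f a = \<infinity>" "N f \<inter> {a..a + T} = {}"
    then have "N (shift c f) \<inter> {a - c..a - c + T} = {}"
      using mem by blast
    then show ?thesis using * by (simp add: first_point_def)
  next
    fix x assume "first_point T f a = ereal x"
    then have x: "x \<in> N f \<inter> {a..a + T} \<and> (\<forall>y\<in>N f \<inter> {a..a + T}. x \<le> y)"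
      using first_point_eq_iff[OF f] by blast
    have "x - c + c \<in> N f \<inter> {a..a + T}" using x by simp
    moreover have "x - c \<le> y" if "y + c \<in> N f \<inter> {a..a + T}" for y
    proof -
      have "x \<le> y + c" using x that by blast
      then show ?thesis by simp
    qed
    ultimately have "first_point T (shift c f) (a - c) = ereal (x - c)"
      unfolding first_point_eq_iff[OF C_real_shift[OF f]] Ball_def mem by blast
    then show ?thesis using \<open>first_point T f a = ereal x\<close> by simp
  qed
next
  fix f a b assume f: "f \<in> C_real" and "first_point T f a \<in> {ereal b..ereal (b + T)}"
  then obtain x where x: "first_point T f a = ereal x" "b \<le> x" "x \<le> b + T"
    by (cases "first_point T f a") auto
  note xa = first_point_eq_iff[OF f, THEN iffD1, OF x(1)]
  show "first_point T f b = first_point T f a \<or>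
      first_point T f b \<in> {ereal b..ereal (b + T)} - {ereal a..ereal (a + T)}"
  proof (rule first_point_cases[of T f b])
    assume "N f \<inter> {b..b + T} = {}"
    then show ?thesis using xa x by auto
  next
    fix y assume y: "first_point T f b = ereal y"
    note yb = first_point_eq_iff[OF f, THEN iffD1, OF y]
    show ?thesis
    proof (cases "y \<in> {a..a + T}")
      case True
      then have "x = y" using xa yb x by (intro antisym) auto
      then show ?thesis using x y by simp
    qed (use yb y in auto)
  qed
qed

lemma last_point_local: "last_point T \<in> local_intrinsic_location T"
  unfolding local_intrinsic_location_def
proof (intro CollectI conjI allI ballI impI)
  fix a
  have inf: "{f \<in> space C_cyl. last_point T f a = \<infinity>} \<in> sets C_cyl"
  proof -
    have "{f \<in> space C_cyl. last_point T f a = \<infinity>} = space C_cyl - {f \<in> C_real. N f \<inter> {a..a + T} \<noteq> {}}"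
      unfolding space_C_cyl by (auto simp: last_point_def)
    then show ?thesis using meets by simp
  qed
  show "(\<lambda>f. last_point T f a) \<in> C_cyl \<rightarrow>\<^sub>M real_inf"
  proof (intro measurable_real_infI ereal_measurable_atLeast)
    fix s :: real
    have "{f \<in> space C_cyl. ereal s \<le> last_point T f a} =
      {f \<in> C_real. N f \<inter> {max s a..a + T} \<noteq> {}} \<union> {f \<in> space C_cyl. last_point T f a = \<infinity>}"
    proof -
      have "ereal s \<le> last_point T f a \<longleftrightarrow> N f \<inter> {max s a..a + T} \<noteq> {} \<or> last_point T f a = \<infinity>"
        if f: "f \<in> C_real" for f
      proof (rule last_point_cases[of T f a])
        assume "last_point T f a = \<infinity>" "N f \<inter> {a..a + T} = {}"
        then show ?thesis by auto
      next
        fix x assume x: "last_point T f a = ereal x"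
        then have "x \<in> N f \<inter> {a..a + T}" "\<And>y. y \<in> N f \<inter> {a..a + T} \<Longrightarrow> y \<le> x"
          using last_point_eq_iff[OF f] by blast+
        then have "s \<le> x \<longleftrightarrow> N f \<inter> {max s a..a + T} \<noteq> {}" by fastforce
        then show ?thesis using x by simp
      qed
      then show ?thesis unfolding space_C_cyl by blast
    qed
    then show "{f \<in> space C_cyl. ereal s \<le> last_point T f a} \<in> sets C_cyl" using meets inf by simp
  qed (use inf in \<open>auto simp: last_point_def\<close>)
next
  fix f a assume f: "f \<in> C_real"
  show "last_point T f a \<in> {ereal a..ereal (a + T)} \<union> {\<infinity>}"
  proof (rule last_point_cases[of T f a])
    fix x assume x: "last_point T f a = ereal x"
    then have "x \<in> {a..a + T}" using last_point_eq_iff[OF f] by blast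
    then show ?thesis using x by simp
  qed simp
  fix c
  have mem: "y \<in> N (shift c f) \<inter> {a - c..a - c + T} \<longleftrightarrow> y + c \<in> N f \<inter> {a..a + T}" for y
    using shift_iff[OF f] by auto
  show "last_point T f a = last_point T (shift c f) (a - c) + ereal c"
  proof (rule last_point_cases[of T f a])
    assume *: "last_point T f a = \<infinity>" "N f \<inter> {a..a + T} = {}"
    then have "N (shift c f) \<inter> {a - c..a - c + T} = {}"
      using mem by blast
    then show ?thesis using * by (simp add: last_point_def)
  next
    fix x assume "last_point T f a = ereal x"
    then have x: "x \<in> N f \<inter> {a..a + T} \<and> (\<forall>y\<in>N f \<inter> {a..a + T}. y \<le> x)"
      using last_point_eq_iff[OF f] by blast
    have "x - c + c \<in> N f \<inter> {a..a + T}" using x by simp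
    moreover have "y \<le> x - c" if "y + c \<in> N f \<inter> {a..a + T}" for y
    proof -
      have "y + c \<le> x" using x that by blast
      then show ?thesis by simp
    qed
    ultimately have "last_point T (shift c f) (a - c) = ereal (x - c)"
      unfolding last_point_eq_iff[OF C_real_shift[OF f]] Ball_def mem by blast
    then show ?thesis using \<open>last_point T f a = ereal x\<close> by simp
  qed
next
  fix f a b assume f: "f \<in> C_real" and "last_point T f a \<in> {ereal b..ereal (b + T)}"
  then obtain x where x: "last_point T f a = ereal x" "b \<le> x" "x \<le> b + T"
    by (cases "last_point T f a") auto
  note xa = last_point_eq_iff[OF f, THEN iffD1, OF x(1)]
  show "last_point T f b = last_point T f a \<or>
      last_point T f b \<in> {ereal b..ereal (b + T)} - {ereal a..ereal (a + T)}"
  proof (rule last_point_cases[of T f b])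
    assume "N f \<inter> {b..b + T} = {}"
    then show ?thesis using xa x by auto
  next
    fix y assume y: "last_point T f b = ereal y"
    note yb = last_point_eq_iff[OF f, THEN iffD1, OF y]
    show ?thesis
    proof (cases "y \<in> {a..a + T}")
      case True
      then have "x = y" using xa yb x by (intro antisym) auto
      then show ?thesis using x y by simp
    qed (use yb y in auto)
  qed
qed

end

section \<open>Hitting sets and the ends of their gaps\<close>

locale path_functional =
  fixes h :: "(real \<Rightarrow> real) \<Rightarrow> real \<Rightarrow> real"
  assumes continuous: "\<And>f. f \<in> C_real \<Longrightarrow> continuous_on UNIV (h f)"
    and shift: "\<And>f c t. f \<in> C_real \<Longrightarrow> h (shift c f) t = h f (t + c)"
    and measurable [measurable]: "\<And>t. (\<lambda>f. h f t) \<in> borel_measurable C_cyl"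
begin

lemma closed_zero: "f \<in> C_real \<Longrightarrow> closed {t. h f t \<le> 0}"
  using continuous[of f] by (intro closed_Collect_le continuous_intros) auto

text \<open>A continuous function on a compact interval reaches a nonpositive value iff it has
  values below \<open>1 / (n + 1)\<close> for all \<open>n\<close>, and by continuity these may be
  sought along a countable set.\<close>

lemma hit_measurable: "{f \<in> C_real. \<exists>t\<in>{u..v}. h f t \<le> 0} \<in> sets C_cyl"
proof (cases "u \<le> v")
  case uv: True
  \<comment> \<open>Clamping all rationals to \<open>[u, v]\<close>, instead of using the rationals
    inside it, covers the degenerate interval of one irrational point.\<close>
  define c where "c q = min (max u q) v" for q
  have c: "c q \<in> {u..v}" for q using uv by (auto simp: c_def)
  have "{f \<in> C_real. \<exists>t\<in>{u..v}. h f t \<le> 0} =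
      (\<Inter>n. \<Union>q\<in>\<rat>. {f \<in> space C_cyl. h f (c q) < 1 / real (Suc n)})"
  proof (intro equalityI subsetI)
    fix f assume "f \<in> {f \<in> C_real. \<exists>t\<in>{u..v}. h f t \<le> 0}"
    then obtain t where f: "f \<in> C_real" and t: "t \<in> {u..v}" "h f t \<le> 0" by blast
    have "\<exists>q\<in>\<rat>. h f (c q) < 1 / real (Suc n)" for n
    proof -
      have "continuous_on UNIV (\<lambda>q. h f (c q))"
        unfolding c_def
        by (rule continuous_on_compose2[OF continuous[OF f]]) (intro continuous_intros, simp)
      then have "isCont (\<lambda>q. h f (c q)) t" by (simp add: continuous_on_eq_continuous_at)
      then have "((\<lambda>q. h f (c q)) \<longlongrightarrow> h f t) (at t)" using t by (simp add: isCont_def c_def)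
      then have "\<forall>\<^sub>F q in at t. h f (c q) < 1 / real (Suc n)"
        using le_less_trans[OF t(2), of "1 / real (Suc n)"] by (intro order_tendstoD) simp_all
      then obtain d where d: "0 < d" "\<And>q. q \<noteq> t \<Longrightarrow> dist q t < d \<Longrightarrow> h f (c q) < 1 / real (Suc n)"
        by (auto simp: eventually_at)
      obtain q where q: "q \<in> \<rat>" "t < q" "q < t + d" using Rats_dense_in_real[of t "t + d"] d(1) by auto
      then have "h f (c q) < 1 / real (Suc n)" by (intro d) (auto simp: dist_real_def)
      then show ?thesis using q by blast
    qed
    then show "f \<in> (\<Inter>n. \<Union>q\<in>\<rat>. {f \<in> space C_cyl. h f (c q) < 1 / real (Suc n)})"
      using f unfolding space_C_cyl by blast
  next
    fix f assume f: "f \<in> (\<Inter>n. \<Union>q\<in>\<rat>. {f \<in> space C_cyl. h f (c q) < 1 / real (Suc n)})"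
    then have fC: "f \<in> C_real" by (auto simp: space_C_cyl)
    have "continuous_on {u..v} (h f)" using continuous[OF fC] by (rule continuous_on_subset) simp
    then obtain t where t: "t \<in> {u..v}" "\<And>s. s \<in> {u..v} \<Longrightarrow> h f t \<le> h f s"
      using continuous_attains_inf[of "{u..v}" "h f"] uv by force
    have "h f t \<le> 1 / real (Suc n)" for n
    proof -
      obtain q where "h f (c q) < 1 / real (Suc n)" using f by blast
      then show ?thesis using t(2)[OF c, of q] by linarith
    qed
    then have "h f t \<le> 0" by (intro LIMSEQ_le_const[OF LIMSEQ_Suc[OF lim_1_over_n]]) auto
    then show "f \<in> {f \<in> C_real. \<exists>t\<in>{u..v}. h f t \<le> 0}" using fC t by blast
  qed
  also have "\<dots> \<in> sets C_cyl"
  proof -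
    have lev: "{f \<in> space C_cyl. h f (c q) < e} \<in> sets C_cyl" for q e by measurable
    have "(\<Union>q\<in>\<rat>. {f \<in> space C_cyl. h f (c q) < 1 / real (Suc n)}) \<in> sets C_cyl" for n
      by (intro sets.countable_UN' countable_rat image_subsetI lev)
    then show ?thesis by (intro sets.countable_INT) auto
  qed
  finally show ?thesis .
next
  case False
  then have "{f \<in> C_real. \<exists>t\<in>{u..v}. h f t \<le> 0} = {}" by auto
  then show ?thesis by (simp only: sets.empty_sets)
qed

text \<open>These points are isolated even when the hitting set is perfect. Including
  \<open>t - D\<close> in the free interval makes the separation strict and lets continuity extend
  the free interval a little further to the left.\<close>

definition gap_end :: "real \<Rightarrow> (real \<Rightarrow> real) \<Rightarrow> real set" where
  "gap_end D f = {t. h f t \<le> 0 \<and> (\<forall>s\<in>{t - D..<t}. 0 < h f s)}"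

lemma gap_end_separated:
  assumes "x \<in> gap_end D f" "y \<in> gap_end D f" "x < y"
  shows "D < y - x"
proof (rule ccontr)
  assume "\<not> D < y - x"
  then have "x \<in> {y - D..<y}" using assms by simp
  then show False using assms by (force simp: gap_end_def)
qed

lemma first_hit:
  assumes f: "f \<in> C_real" and t: "h f t \<le> 0" "s \<le> t"
  obtains r where "s \<le> r" "r \<le> t" "h f r \<le> 0" "\<And>q. s \<le> q \<Longrightarrow> q < r \<Longrightarrow> 0 < h f q"
proof -
  let ?A = "{t. h f t \<le> 0} \<inter> {s..t}"
  have bdd: "bdd_below ?A" by (rule bdd_below.I[of _ s]) auto
  have mem: "Inf ?A \<in> ?A"
    using t bdd closed_zero[OF f] by (intro closed_contains_Inf) (auto intro: closed_Int)
  have "0 < h f q" if "s \<le> q" "q < Inf ?A" for q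
  proof (rule ccontr)
    assume "\<not> 0 < h f q"
    then have "Inf ?A \<le> q" using that mem by (intro cInf_lower bdd) auto
    then show False using that by simp
  qed
  then show thesis using mem by (intro that[of "Inf ?A"]) auto
qed

text \<open>For a gap end \<open>t\<close>, a rational \<open>q\<close> slightly below
  \<open>t - D\<close> still has no hit in \<open>[q, t)\<close>. Conversely, the first hit after
  such a \<open>q\<close> is a gap end once it comes no earlier than \<open>u\<close> and
  \<open>q + D\<close>. The terms \<open>1 / (n + 1)\<close> express by compact intervals that a
  half-open interval contains no hit.\<close>

lemma gap_end_meets_iff:
  assumes f: "f \<in> C_real" and D: "0 < D"
  shows "gap_end D f \<inter> {u..v} \<noteq> {} \<longleftrightarrow>
    (\<exists>q\<in>\<rat>. (\<exists>t\<in>{q..v}. h f t \<le> 0) \<and> (\<forall>n. \<not> (\<exists>t\<in>{q..max u (q + D) - 1 / real (Suc n)}. h f t \<le> 0)))"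
    (is "?L \<longleftrightarrow> ?R")
proof
  assume ?L
  then obtain t where t: "t \<in> {u..v}" and "t \<in> gap_end D f" by blast
  then have t': "h f t \<le> 0" and t'': "\<And>s. t - D \<le> s \<Longrightarrow> s < t \<Longrightarrow> 0 < h f s"
    by (auto simp: gap_end_def)
  have "0 < h f (t - D)" using t'' D by simp
  moreover have "isCont (h f) (t - D)"
    using continuous[OF f] by (simp add: continuous_on_eq_continuous_at)
  ultimately have "\<forall>\<^sub>F q in at (t - D). 0 < h f q"
    by (intro order_tendstoD) (auto simp: isCont_def)
  then obtain d where d: "0 < d" "\<And>q. q \<noteq> t - D \<Longrightarrow> dist q (t - D) < d \<Longrightarrow> 0 < h f q"
    by (auto simp: eventually_at)
  obtain q where q: "q \<in> \<rat>" "t - D - d < q" "q < t - D"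
    using Rats_dense_in_real[of "t - D - d" "t - D"] d(1) by auto
  have "0 < h f s" if "q \<le> s" "s < t" for s
    using t''[of s] d(2)[of s] q that by (cases "t - D \<le> s") (auto simp: dist_real_def)
  moreover have "s < t" if "s \<le> max u (q + D) - 1 / real (Suc n)" for s n
  proof -
    have "0 < 1 / real (Suc n)" by simp
    moreover have "max u (q + D) \<le> t" using t q by simp
    ultimately show ?thesis using that by linarith
  qed
  moreover have "t \<in> {q..v}" using t q D by simp
  ultimately show ?R using t' by (intro bexI[OF _ q(1)] conjI) (auto simp: not_le)
next
  assume ?R
  then obtain q t where qt: "q \<le> t" "t \<le> v" "h f t \<le> 0"
    and no: "\<And>n t. q \<le> t \<Longrightarrow> t \<le> max u (q + D) - 1 / real (Suc n) \<Longrightarrow> 0 < h f t"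
    by (auto simp: not_le)
  obtain r where r: "q \<le> r" "r \<le> t" "h f r \<le> 0" "\<And>p. q \<le> p \<Longrightarrow> p < r \<Longrightarrow> 0 < h f p"
    using first_hit[OF f qt(3,1)] by blast
  have "max u (q + D) \<le> r"
  proof (rule ccontr)
    assume "\<not> ?thesis"
    then have "0 < max u (q + D) - r" by linarith
    then obtain n where "1 / real (Suc n) < max u (q + D) - r" by (rule nat_approx_posE)
    then show False using no[of r n] r by simp
  qed
  then have "r \<in> gap_end D f \<inter> {u..v}" using r qt by (auto simp: gap_end_def)
  then show ?L by blast
qed

lemma equivariant_zero: "equivariant_set (\<lambda>f. {t. h f t \<le> 0})"
proof
  fix u v
  have "{f \<in> C_real. {t. h f t \<le> 0} \<inter> {u..v} \<noteq> {}} = {f \<in> C_real. \<exists>t\<in>{u..v}. h f t \<le> 0}" by blast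
  then show "{f \<in> C_real. {t. h f t \<le> 0} \<inter> {u..v} \<noteq> {}} \<in> sets C_cyl" using hit_measurable by simp
qed (use closed_zero shift in auto)

lemma equivariant_gap_end:
  assumes D: "0 < D"
  shows "equivariant_set (gap_end D)"
proof
  show "closed (gap_end D f)" for f
  proof (rule discrete_imp_closed[OF D], intro ballI impI)
    fix x y assume "x \<in> gap_end D f" "y \<in> gap_end D f" "dist y x < D"
    then show "y = x"
      using gap_end_separated[of x D f y] gap_end_separated[of y D f x]
      by (cases x y rule: linorder_cases) (auto simp: dist_real_def)
  qed
  show "x \<in> gap_end D (shift c f) \<longleftrightarrow> x + c \<in> gap_end D f" if f: "f \<in> C_real" for f c x
  proof -
    have "(\<forall>s\<in>{x - D..<x}. 0 < h f (s + c)) \<longleftrightarrow> (\<forall>s\<in>{x + c - D..<x + c}. 0 < h f s)"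
    proof safe
      fix s assume *: "\<forall>s\<in>{x - D..<x}. 0 < h f (s + c)" "s \<in> {x + c - D..<x + c}"
      then show "0 < h f s" using *(1)[THEN bspec, of "s - c"] by auto
    qed auto
    then show ?thesis by (simp add: gap_end_def shift[OF f])
  qed
  fix u v
  let ?H = "\<lambda>u v. {f \<in> C_real. \<exists>t\<in>{u..v}. h f t \<le> 0}"
  have "{f \<in> C_real. gap_end D f \<inter> {u..v} \<noteq> {}} = {f \<in> C_real. \<exists>q\<in>\<rat>. (\<exists>t\<in>{q..v}. h f t \<le> 0) \<and>
      (\<forall>n. \<not> (\<exists>t\<in>{q..max u (q + D) - 1 / real (Suc n)}. h f t \<le> 0))}"
    using gap_end_meets_iff[OF _ D] by (intro Collect_cong conj_cong refl) simp
  also have "\<dots> = (\<Union>q\<in>\<rat>. ?H q v - (\<Union>n. ?H q (max u (q + D) - 1 / real (Suc n))))"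
    by blast
  also have "\<dots> \<in> sets C_cyl"
    by (intro sets.countable_UN' countable_rat sets.Diff hit_measurable)
       (use hit_measurable in \<open>blast intro: sets.countable_UN\<close>)
  finally show "{f \<in> C_real. gap_end D f \<inter> {u..v} \<noteq> {}} \<in> sets C_cyl" .
qed

end

section \<open>Recovering stationarity\<close>

text \<open>Joint distribution functions determine a finite measure: the lower orthants are stable
  under intersection and generate the product sigma-field.\<close>

lemma measure_eqI_PiM_atMost:
  fixes P Q :: "('i \<Rightarrow> real) measure"
  assumes I: "finite I" and sets: "sets P = sets (PiM I (\<lambda>_. borel))" "sets Q = sets (PiM I (\<lambda>_. borel))"
    and fin: "finite_measure P"
    and eq: "\<And>b. emeasure P (\<Pi>\<^sub>E i\<in>I. {..b i}) = emeasure Q (\<Pi>\<^sub>E i\<in>I. {..b i})"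
  shows "P = Q"
proof -
  let ?E = "{{f \<in> \<Pi>\<^sub>E i\<in>I. UNIV. \<forall>i\<in>j. f i \<in> A i} | A j. j \<in> {I} \<and> A \<in> (\<Pi> i\<in>j. range (\<lambda>a::real. {..a}))}"
  let ?B = "\<lambda>b :: 'i \<Rightarrow> real. \<Pi>\<^sub>E i\<in>I. {..b i}"
  have E: "?E = range ?B"
  proof (intro equalityI subsetI)
    fix X :: "('i \<Rightarrow> real) set" assume "X \<in> ?E"
    then obtain A where X: "X = {f \<in> \<Pi>\<^sub>E i\<in>I. UNIV. \<forall>i\<in>I. f i \<in> A i}" and A: "A \<in> (\<Pi> i\<in>I. range (\<lambda>a::real. {..a}))"
      by blast
    have "\<forall>i\<in>I. \<exists>a. A i = {..a}" using A by (auto simp: Pi_iff)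
    then obtain b where "\<forall>i\<in>I. A i = {..b i}" by metis
    then have "X = {f \<in> \<Pi>\<^sub>E i\<in>I. UNIV. \<forall>i\<in>I. f i \<in> {..b i}}"
      unfolding X by (intro Collect_cong conj_cong ball_cong) simp_all
    then have "X = ?B b" by (auto simp: PiE_iff extensional_def)
    then show "X \<in> range ?B" by blast
  next
    fix X :: "('i \<Rightarrow> real) set" assume "X \<in> range ?B"
    then obtain b where "X = ?B b" by blast
    then show "X \<in> ?E" by (intro CollectI exI[of _ "\<lambda>i. {..b i}"] exI[of _ I]) (auto simp: PiE_iff extensional_def)
  qed
  have "sets (PiM I (\<lambda>_. borel :: real measure)) = sets (PiM I (\<lambda>_. sigma UNIV (range (\<lambda>a::real. {..a}))))"
    by (simp add: borel_eq_atMost)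
  also have "\<dots> = sets (sigma (\<Pi>\<^sub>E i\<in>I. UNIV) ?E)"
  proof (rule sets_PiM_sigma)
    show "\<exists>S\<subseteq>range (\<lambda>a::real. {..a}). countable S \<and> UNIV = \<Union>S" for i
      by (intro exI[of _ "range (\<lambda>n::nat. {..real n})"]) (auto intro: real_arch_simple)
  qed (use I in auto)
  also have "\<dots> = sigma_sets (\<Pi>\<^sub>E i\<in>I. UNIV) (range ?B)"
    unfolding E by (intro sets_measure_of) (auto simp: PiE_iff)
  finally have gen: "sets (PiM I (\<lambda>_. borel :: real measure)) = sigma_sets (\<Pi>\<^sub>E i\<in>I. UNIV) (range ?B)" .
  show ?thesis
  proof (rule measure_eqI_generator_eq[where A="\<lambda>n. ?B (\<lambda>_. real n)"])
    show "Int_stable (range ?B)"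
    proof (rule Int_stableI)
      fix X Y :: "('i \<Rightarrow> real) set" assume "X \<in> range ?B" "Y \<in> range ?B"
      then obtain b c where "X = ?B b" "Y = ?B c" by blast
      then have "X \<inter> Y = ?B (\<lambda>i. min (b i) (c i))" by (auto simp: PiE_iff)
      then show "X \<inter> Y \<in> range ?B" by (rule range_eqI[where x="\<lambda>i. min (b i) (c i)"])
    qed
    show "range ?B \<subseteq> Pow (\<Pi>\<^sub>E i\<in>I. UNIV)" by (auto simp: PiE_iff)
    show "sets P = sigma_sets (\<Pi>\<^sub>E i\<in>I. UNIV) (range ?B)" "sets Q = sigma_sets (\<Pi>\<^sub>E i\<in>I. UNIV) (range ?B)"
      using sets gen by simp_all
    show "(\<Union>n. ?B (\<lambda>_. real n)) = (\<Pi>\<^sub>E i\<in>I. UNIV)"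
    proof (intro equalityI subsetI)
      fix f :: "'i \<Rightarrow> real" assume f: "f \<in> (\<Pi>\<^sub>E i\<in>I. UNIV)"
      obtain n :: nat where n: "(\<Sum>i\<in>I. \<bar>f i\<bar>) \<le> real n" using real_arch_simple by blast
      have "f i \<le> real n" if "i \<in> I" for i
        using member_le_sum[of i I "\<lambda>i. \<bar>f i\<bar>"] that I n by fastforce
      then show "f \<in> (\<Union>n. ?B (\<lambda>_. real n))" using f by (auto simp: PiE_iff)
    qed (auto simp: PiE_iff)
    show "emeasure P (?B (\<lambda>_. real n)) \<noteq> \<infinity>" for n
      using finite_measure.emeasure_finite[OF fin] by simp
  qed (use eq in auto)
qed

text \<open>The sum of the excesses is nonpositive at \<open>t\<close> iff
  \<open>f (j + t) \<le> b j\<close> for all \<open>j\<close> in \<open>J\<close>. The probability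
  of this event, as a function of \<open>b\<close>, is a joint distribution function, so one-time
  probabilities of path functionals contain all finite-dimensional laws.\<close>

lemma path_functional_boxes:
  assumes J: "finite J"
  shows "path_functional (\<lambda>f t. \<Sum>j\<in>J. max 0 (f (j + t) - b j))"
proof
  fix f assume "f \<in> C_real"
  then have "continuous_on UNIV f" by simp
  then have f: "continuous_on UNIV f" by simp
  have "continuous_on UNIV (\<lambda>t. f (j + t))" for j
    by (rule continuous_on_compose2[OF f]) (auto intro!: continuous_intros)
  then show "continuous_on UNIV (\<lambda>t. \<Sum>j\<in>J. max 0 (f (j + t) - b j))"
    by (intro continuous_on_sum continuous_on_max continuous_on_diff continuous_on_const)
next
  fix t
  show "(\<lambda>f. \<Sum>j\<in>J. max 0 (f (j + t) - b j)) \<in> borel_measurable C_cyl" by measurable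
qed (simp add: shift_def add_ac)

context continuous_process
begin

lemma functional_measurable:
  assumes "path_functional h"
  shows "(\<lambda>\<omega>. h (sample_path X \<omega>) t) \<in> borel_measurable M"
  by (rule measurable_compose[OF path_measurable path_functional.measurable[OF assms]])

lemma stationaryI:
  assumes "\<And>h s t. path_functional h \<Longrightarrow>
    prob {\<omega> \<in> space M. h (sample_path X \<omega>) s \<le> 0} = prob {\<omega> \<in> space M. h (sample_path X \<omega>) t \<le> 0}"
  shows "stationary_process M X"
  unfolding stationary_process_def
proof (intro allI impI)
  fix J :: "real set" and c :: real assume J: "finite J"
  let ?Y = "\<lambda>c \<omega>. \<lambda>t\<in>J. X (t + c) \<omega>"
  have meas: "?Y c \<in> M \<rightarrow>\<^sub>M PiM J (\<lambda>_. borel)" for c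
    by (intro measurable_restrict rv)
  have box: "emeasure (distr M (PiM J (\<lambda>_. borel)) (?Y c)) (\<Pi>\<^sub>E i\<in>J. {..b i}) =
      prob {\<omega> \<in> space M. (\<Sum>j\<in>J. max 0 (sample_path X \<omega> (j + c) - b j)) \<le> 0}" for c b
  proof -
    have "(\<Sum>j\<in>J. max 0 (sample_path X \<omega> (j + c) - b j)) \<le> 0 \<longleftrightarrow> (\<forall>j\<in>J. X (j + c) \<omega> \<le> b j)" for \<omega>
    proof -
      have "(\<Sum>j\<in>J. max 0 (sample_path X \<omega> (j + c) - b j)) \<le> 0 \<longleftrightarrow>
          (\<Sum>j\<in>J. max 0 (sample_path X \<omega> (j + c) - b j)) = 0"
        by (simp add: order.antisym_conv[symmetric] sum_nonneg antisym_conv)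
      also have "\<dots> \<longleftrightarrow> (\<forall>j\<in>J. X (j + c) \<omega> \<le> b j)"
        using J by (subst sum_nonneg_eq_0_iff) (auto simp: sample_path_def max_def)
      finally show ?thesis .
    qed
    then have "?Y c -` (\<Pi>\<^sub>E i\<in>J. {..b i}) \<inter> space M =
        {\<omega> \<in> space M. (\<Sum>j\<in>J. max 0 (sample_path X \<omega> (j + c) - b j)) \<le> 0}"
      by (auto simp: PiE_iff)
    then show ?thesis
      using J by (subst emeasure_distr[OF meas]) (auto intro!: sets_PiM_I_finite simp: emeasure_eq_measure)
  qed
  have "distr M (PiM J (\<lambda>_. borel)) (?Y c) = distr M (PiM J (\<lambda>_. borel)) (?Y 0)"
  proof (rule measure_eqI_PiM_atMost[OF J])
    show "finite_measure (distr M (PiM J (\<lambda>_. borel)) (?Y c))" by (intro finite_measure_distr meas)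
    fix b
    show "emeasure (distr M (PiM J (\<lambda>_. borel)) (?Y c)) (\<Pi>\<^sub>E i\<in>J. {..b i}) =
        emeasure (distr M (PiM J (\<lambda>_. borel)) (?Y 0)) (\<Pi>\<^sub>E i\<in>J. {..b i})"
      unfolding box using assms[OF path_functional_boxes[OF J, of b], of c 0] by simp
  qed simp_all
  then show "distr M (PiM J (\<lambda>_. borel)) (\<lambda>\<omega>. \<lambda>t\<in>J. X (t + c) \<omega>) =
      distr M (PiM J (\<lambda>_. borel)) (\<lambda>\<omega>. \<lambda>t\<in>J. X t \<omega>)" by simp
qed

text \<open>The first hit in \<open>[a, a + 1]\<close> equals \<open>a\<close> exactly if
  \<open>h\<close> is nonpositive at \<open>a\<close>, so the atom at 0 of the centred law is the
  probability wanted. The length 1 is arbitrary.\<close>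

lemma stationary_of_location_laws:
  assumes "\<forall>T>0. \<forall>L\<in>local_intrinsic_location T. \<forall>a b.
    distr M real_inf (\<lambda>\<omega>. L (sample_path X \<omega>) a - ereal a) =
    distr M real_inf (\<lambda>\<omega>. L (sample_path X \<omega>) b - ereal b)"
  shows "stationary_process M X"
proof (rule stationaryI)
  fix h s t assume "path_functional h"
  then interpret path_functional h .
  interpret Z: equivariant_set "\<lambda>f. {t. h f t \<le> 0}" by (rule equivariant_zero)
  let ?L = "Z.first_point 1"
  have "prob {\<omega> \<in> space M. h (sample_path X \<omega>) a \<le> 0} =
      measure (distr M real_inf (\<lambda>\<omega>. ?L (sample_path X \<omega>) a - ereal a)) (ereal ` {0})" for a
  proof -
    have "?L (sample_path X \<omega>) a - ereal a = 0 \<longleftrightarrow> h (sample_path X \<omega>) a \<le> 0" if "\<omega> \<in> space M" for \<omega>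
    proof -
      have "?L (sample_path X \<omega>) a - ereal a = 0 \<longleftrightarrow> ?L (sample_path X \<omega>) a = ereal a"
        by (cases "?L (sample_path X \<omega>) a") auto
      also have "\<dots> \<longleftrightarrow> h (sample_path X \<omega>) a \<le> 0"
        using Z.first_point_eq_iff[OF path_C_real[OF that]] by auto
      finally show ?thesis .
    qed
    then have "(\<lambda>\<omega>. ?L (sample_path X \<omega>) a - ereal a) -` (ereal ` {0}) \<inter> space M =
        {\<omega> \<in> space M. h (sample_path X \<omega>) a \<le> 0}"
      unfolding image_insert image_empty zero_ereal_def[symmetric] by blast
    moreover have B: "ereal ` {0} \<in> sets real_inf" by (rule image_in_real_inf) simp
    ultimately show ?thesis
      unfolding measure_distr[OF location_minus_measurable[OF Z.first_point_local] B] by (simp only:)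
  qed
  moreover have "distr M real_inf (\<lambda>\<omega>. ?L (sample_path X \<omega>) s - ereal s) =
      distr M real_inf (\<lambda>\<omega>. ?L (sample_path X \<omega>) t - ereal t)"
    by (rule assms[rule_format, OF zero_less_one Z.first_point_local])
  ultimately show "prob {\<omega> \<in> space M. h (sample_path X \<omega>) s \<le> 0} = prob {\<omega> \<in> space M. h (sample_path X \<omega>) t \<le> 0}"
    by simp
qed

end

section \<open>Separated equivariant sets have constant intensity\<close>

lemma TV_constraints_between:
  assumes f: "TV_constraints a b f" "\<And>t. t \<in> {a<..<b} \<Longrightarrow> 0 \<le> f t"
    and s: "a < s" "s < r" "r < z" "z < b"
  shows "f r \<le> f s + f z"
proof -
  have "TV_neg f (b - (b - s)) b \<le> low f (b - (b - s))"
  proof -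
    have "\<forall>\<epsilon>\<in>{0<..<b - a}. TV_pos f a (a + \<epsilon>) \<le> low f (a + \<epsilon>) \<and> TV_neg f (b - \<epsilon>) b \<le> low f (b - \<epsilon>)"
      using f(1) unfolding TV_constraints_def by blast
    moreover have "b - s \<in> {0<..<b - a}" using s by simp
    ultimately show ?thesis by blast
  qed
  then have "TV_neg f s b \<le> low f s" by simp
  \<comment> \<open>A single fall, from \<open>r\<close> to \<open>z\<close>, is at most all falls
    to the right of \<open>s\<close>.\<close>
  from this[unfolded TV_neg_le_iff, rule_format, of "[r, z]"] s
  have "ennreal (incr (\<lambda>x. - f x) [r, z]) \<le> low f s" by auto
  also have "\<dots> \<le> ennreal (f s)" unfolding low_def by (intro ennreal_leI) simp
  finally have "ennreal (incr (\<lambda>x. - f x) [r, z]) \<le> ennreal (f s)" .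
  moreover have "0 \<le> f s" using f(2)[of s] s by simp
  ultimately have "incr (\<lambda>x. - f x) [r, z] \<le> f s" by (simp only: ennreal_le_iff)
  then show ?thesis by simp
qed

lemma has_density_onD:
  assumes "has_density_on M Y a b f" "B \<in> sets borel" "B \<subseteq> {a<..<b}"
  shows "emeasure M {\<omega> \<in> space M. Y \<omega> \<in> ereal ` B} = (\<integral>\<^sup>+t\<in>B. ennreal (f t) \<partial>lborel)"
  using assms unfolding has_density_on_def by blast

context prob_space
begin

text \<open>The mean of the density over an interval of length \<open>K\<close> is at most
  \<open>1 / K\<close>. The factor 2 turns a lower bound at all points into a contradiction between
  numbers, \<open>2 \<le> 1\<close>.\<close>

lemma density_small_point:
  assumes f: "has_density_on M Y a b f" and w: "a \<le> w" "0 < K" "w + K \<le> b"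
  shows "\<exists>z\<in>{w<..<w + K}. f z \<le> 2 / K"
proof (rule ccontr)
  assume "\<not> ?thesis"
  then have big: "2 / K \<le> f z" if "z \<in> {w<..<w + K}" for z using that by force
  have "ennreal 2 = ennreal (2 / K) * ennreal K" using w by (simp add: ennreal_mult[symmetric])
  also have "\<dots> = (\<integral>\<^sup>+z. ennreal (2 / K) * indicator {w<..<w + K} z \<partial>lborel)"
    using w by (simp add: nn_integral_cmult_indicator)
  also have "\<dots> \<le> (\<integral>\<^sup>+z\<in>{w<..<w + K}. ennreal (f z) \<partial>lborel)"
    by (intro nn_integral_mono) (auto simp: indicator_def intro!: ennreal_leI big)
  also have "\<dots> = emeasure M {\<omega> \<in> space M. Y \<omega> \<in> ereal ` {w<..<w + K}}"
    using w by (intro has_density_onD[OF f, symmetric]) auto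
  also have "\<dots> \<le> 1" by (rule emeasure_le_1)
  finally show False by simp
qed

lemma density_interval_le:
  assumes f: "has_density_on M Y a b f"
    and uv: "a < u" "u + e < b" "a < v" "v + e < b" and e: "0 \<le> e" "0 \<le> c"
    and le: "\<And>r. u < r \<Longrightarrow> r \<le> u + e \<Longrightarrow> f (r + (v - u)) \<le> f r + c"
  shows "prob {\<omega> \<in> space M. Y \<omega> \<in> ereal ` {v<..v + e}} \<le>
    prob {\<omega> \<in> space M. Y \<omega> \<in> ereal ` {u<..u + e}} + c * e"
proof -
  let ?g = "\<lambda>t. ennreal (f t) * indicator {a<..<b} t"
  have meas: "f \<in> borel_measurable (restrict_space borel {a<..<b})"
    using f by (simp add: has_density_on_def)
  then have [measurable]: "?g \<in> borel_measurable borel"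
    by (subst borel_measurable_restrict_space_iff_ennreal[symmetric])
      (auto intro: measurable_compose[OF _ measurable_ennreal])
  have nonneg: "0 \<le> f t" if "a < t" "t < b" for t using f that by (simp add: has_density_on_def)
  have dens: "emeasure M {\<omega> \<in> space M. Y \<omega> \<in> ereal ` {p<..p + e}} =
      (\<integral>\<^sup>+t. ?g t * indicator {p<..p + e} t \<partial>lborel)" if p: "a < p" "p + e < b" for p
  proof -
    have "emeasure M {\<omega> \<in> space M. Y \<omega> \<in> ereal ` {p<..p + e}} = (\<integral>\<^sup>+t\<in>{p<..p + e}. ennreal (f t) \<partial>lborel)"
      using p by (intro has_density_onD[OF f]) auto
    also have "\<dots> = (\<integral>\<^sup>+t. ?g t * indicator {p<..p + e} t \<partial>lborel)"
      using p by (intro nn_integral_cong) (auto simp: indicator_def)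
    finally show ?thesis .
  qed
  have "emeasure M {\<omega> \<in> space M. Y \<omega> \<in> ereal ` {v<..v + e}} =
      (\<integral>\<^sup>+r. ?g (r + (v - u)) * indicator {u<..u + e} r \<partial>lborel)"
  proof -
    have m: "(\<lambda>t. ?g t * indicator {v<..v + e} t) \<in> borel_measurable borel" by measurable
    show ?thesis
      unfolding dens[OF uv(3,4)]
      by (subst nn_integral_real_affine[OF m, of 1 "v - u"])
         (auto intro!: nn_integral_cong simp: indicator_def algebra_simps)
  qed
  also have "\<dots> \<le> (\<integral>\<^sup>+r. ?g r * indicator {u<..u + e} r + ennreal c * indicator {u<..u + e} r \<partial>lborel)"
  proof (intro nn_integral_mono)
    fix r
    show "?g (r + (v - u)) * indicator {u<..u + e} r \<le>
        ?g r * indicator {u<..u + e} r + ennreal c * indicator {u<..u + e} r"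
    proof (cases "r \<in> {u<..u + e}")
      case True
      then have "ennreal (f (r + (v - u))) \<le> ennreal (f r + c)" using le by (intro ennreal_leI) auto
      also have "\<dots> = ennreal (f r) + ennreal c" using True uv e nonneg by (intro ennreal_plus) auto
      finally show ?thesis using True uv by (auto simp: indicator_def)
    qed simp
  qed
  also have "\<dots> = emeasure M {\<omega> \<in> space M. Y \<omega> \<in> ereal ` {u<..u + e}} + ennreal (c * e)"
    using e by (subst nn_integral_add) (auto simp: dens[OF uv(1,2)] nn_integral_cmult_indicator ennreal_mult)
  finally have "ennreal (prob {\<omega> \<in> space M. Y \<omega> \<in> ereal ` {v<..v + e}}) \<le>
      ennreal (prob {\<omega> \<in> space M. Y \<omega> \<in> ereal ` {u<..u + e}} + c * e)"
    using e by (simp add: emeasure_eq_measure)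
  then show ?thesis using e by (subst (asm) ennreal_le_iff) auto
qed

end

locale TV_process = continuous_process M X for M X +
  assumes TV: "\<And>T L a. 0 < T \<Longrightarrow> L \<in> local_intrinsic_location T \<Longrightarrow>
    \<exists>f. has_density_on M (\<lambda>\<omega>. L (sample_path X \<omega>) a) a (a + T) f \<and> TV_constraints a (a + T) f"

locale separated_set_process = TV_process M X + equivariant_set N for M X N +
  fixes D :: real
  assumes D: "0 < D"
    and separated: "\<And>f x y. f \<in> C_real \<Longrightarrow> x \<in> N f \<Longrightarrow> y \<in> N f \<Longrightarrow> x < y \<Longrightarrow> D < y - x"
begin

definition meet :: "real \<Rightarrow> real \<Rightarrow> 'a set" where
  "meet u v = {\<omega> \<in> space M. N (sample_path X \<omega>) \<inter> {u<..v} \<noteq> {}}"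

text \<open>An earlier point of \<open>N\<close> in the window would be within \<open>D\<close> of
  the given one. The event therefore does not depend on \<open>T\<close>, which remains free to tend
  to infinity.\<close>

lemma meet_first:
  assumes "a \<le> u" "v \<le> a + D" "v \<le> a + T"
  shows "loc (first_point T) a {u<..v} = meet u v"
proof (intro set_eqI iffI)
  fix \<omega> assume "\<omega> \<in> loc (first_point T) a {u<..v}"
  then obtain x where "\<omega> \<in> space M" "x \<in> {u<..v}" "first_point T (sample_path X \<omega>) a = ereal x"
    by (auto simp: loc_def)
  then show "\<omega> \<in> meet u v" using first_point_eq_iff[OF path_C_real] by (auto simp: meet_def)
next
  fix \<omega> assume "\<omega> \<in> meet u v"
  then obtain x where \<omega>: "\<omega> \<in> space M" and x: "x \<in> N (sample_path X \<omega>)" "x \<in> {u<..v}"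
    by (auto simp: meet_def simp del: greaterThanAtMost_iff)
  have "x \<le> y" if "y \<in> N (sample_path X \<omega>) \<inter> {a..a + T}" for y
    using separated[OF path_C_real[OF \<omega>], of y x] x that assms by force
  then have "first_point T (sample_path X \<omega>) a = ereal x"
    unfolding first_point_eq_iff[OF path_C_real[OF \<omega>]] using x assms by auto
  then show "\<omega> \<in> loc (first_point T) a {u<..v}" using \<omega> x by (auto simp: loc_def)
qed

lemma meet_last:
  assumes "a \<le> u" "v \<le> a + T" "a + T \<le> u + D"
  shows "loc (last_point T) a {u<..v} = meet u v"
proof (intro set_eqI iffI)
  fix \<omega> assume "\<omega> \<in> loc (last_point T) a {u<..v}"
  then obtain x where "\<omega> \<in> space M" "x \<in> {u<..v}" "last_point T (sample_path X \<omega>) a = ereal x"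
    by (auto simp: loc_def)
  then show "\<omega> \<in> meet u v" using last_point_eq_iff[OF path_C_real] by (auto simp: meet_def)
next
  fix \<omega> assume "\<omega> \<in> meet u v"
  then obtain x where \<omega>: "\<omega> \<in> space M" and x: "x \<in> N (sample_path X \<omega>)" "x \<in> {u<..v}"
    by (auto simp: meet_def simp del: greaterThanAtMost_iff)
  have "y \<le> x" if "y \<in> N (sample_path X \<omega>) \<inter> {a..a + T}" for y
    using separated[OF path_C_real[OF \<omega>], of x y] x that assms by force
  then have "last_point T (sample_path X \<omega>) a = ereal x"
    unfolding last_point_eq_iff[OF path_C_real[OF \<omega>]] using x assms by auto
  then show "\<omega> \<in> loc (last_point T) a {u<..v}" using \<omega> x by (auto simp: loc_def)
qed

lemma meet_event: "v \<le> u + D \<Longrightarrow> meet u v \<in> events"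
  using loc_event[OF first_point_local, of "{u<..v}" D u] meet_first[of u u v D] D by simp

text \<open>The first point is used in a window that reaches far to the right. There the density
  takes a value at most \<open>2 / K\<close> at some \<open>z\<close>, so moving right from
  \<open>r\<close> to \<open>r + (v - u)\<close> raises the density by at most
  \<open>2 / K\<close>.\<close>

lemma meet_le_right:
  assumes uv: "u < v" "v + e < u + D" and e: "0 < e"
  shows "prob (meet v (v + e)) \<le> prob (meet u (u + e))"
proof (rule field_le_epsilon)
  fix \<epsilon> :: real assume \<epsilon>: "0 < \<epsilon>"
  \<comment> \<open>With this \<open>K\<close> the error \<open>2 / K\<close>, integrated over a
    length \<open>e\<close>, is exactly \<open>\<epsilon>\<close>. The left end \<open>a\<close> is
    placed at distance \<open>D\<close> before \<open>v + e\<close>, so both intervals are covered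
    by \<open>meet_first\<close>.\<close>
  define K where "K = 2 * e / \<epsilon>"
  have K: "0 < K" "2 / K * e = \<epsilon>" using e \<epsilon> by (auto simp: K_def)
  define a where "a = v + e - D"
  define T where "T = D + K"
  have T: "0 < T" "a < u" "a + T = v + e + K" using K D uv by (auto simp: T_def a_def)
  obtain f where f: "has_density_on M (\<lambda>\<omega>. first_point T (sample_path X \<omega>) a) a (a + T) f"
    "TV_constraints a (a + T) f" using TV[OF T(1) first_point_local] by blast
  obtain z where z: "z \<in> {v + e<..<v + e + K}" "f z \<le> 2 / K"
    using density_small_point[OF f(1), of "v + e" K] T uv e K by auto
  have "prob {\<omega> \<in> space M. first_point T (sample_path X \<omega>) a \<in> ereal ` {v<..v + e}} \<le>
      prob {\<omega> \<in> space M. first_point T (sample_path X \<omega>) a \<in> ereal ` {u<..u + e}} + 2 / K * e"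
  proof (rule density_interval_le[OF f(1)])
    fix r assume r: "u < r" "r \<le> u + e"
    have "f (r + (v - u)) \<le> f r + f z"
      using f(1) r z T uv by (intro TV_constraints_between[OF f(2)]) (auto simp: has_density_on_def)
    then show "f (r + (v - u)) \<le> f r + 2 / K" using z by simp
  qed (use T uv e K in auto)
  moreover have "{\<omega> \<in> space M. first_point T (sample_path X \<omega>) a \<in> ereal ` {p<..p + e}} = meet p (p + e)"
    if "a \<le> p" "p \<le> v" for p
    using meet_first[of a p "p + e" T] that T K D uv by (simp add: loc_def a_def T_def)
  ultimately show "prob (meet v (v + e)) \<le> prob (meet u (u + e)) + \<epsilon>"
    using T uv K(2) by simp
qed

text \<open>The mirror image with last points: the window reaches far to the left, and the small
  value of the density lies at a point \<open>s\<close> before \<open>u\<close>.\<close>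

lemma meet_le_left:
  assumes uv: "u < v" "v + e < u + D" and e: "0 < e"
  shows "prob (meet u (u + e)) \<le> prob (meet v (v + e))"
proof (rule field_le_epsilon)
  fix \<epsilon> :: real assume \<epsilon>: "0 < \<epsilon>"
  define K where "K = 2 * e / \<epsilon>"
  have K: "0 < K" "2 / K * e = \<epsilon>" using e \<epsilon> by (auto simp: K_def)
  define a where "a = u - K"
  define T where "T = D + K"
  have T: "0 < T" "a < u" "a + T = u + D" "a + K = u" using K D uv by (auto simp: T_def a_def)
  obtain f where f: "has_density_on M (\<lambda>\<omega>. last_point T (sample_path X \<omega>) a) a (a + T) f"
    "TV_constraints a (a + T) f" using TV[OF T(1) last_point_local] by blast
  obtain s where s: "s \<in> {a<..<a + K}" "f s \<le> 2 / K"
    using density_small_point[OF f(1), of a K] T uv e K D by auto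
  have "prob {\<omega> \<in> space M. last_point T (sample_path X \<omega>) a \<in> ereal ` {u<..u + e}} \<le>
      prob {\<omega> \<in> space M. last_point T (sample_path X \<omega>) a \<in> ereal ` {v<..v + e}} + 2 / K * e"
  proof (rule density_interval_le[OF f(1)])
    fix r assume r: "v < r" "r \<le> v + e"
    have "f (r + (u - v)) \<le> f s + f r"
      using f(1) r s T uv by (intro TV_constraints_between[OF f(2)]) (auto simp: has_density_on_def)
    then show "f (r + (u - v)) \<le> f r + 2 / K" using s by simp
  qed (use T uv e K in auto)
  moreover have "{\<omega> \<in> space M. last_point T (sample_path X \<omega>) a \<in> ereal ` {p<..p + e}} = meet p (p + e)"
    if "u \<le> p" "p \<le> v" for p
    using meet_last[of a p "p + e" T] that T K D uv by (simp add: loc_def)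
  ultimately show "prob (meet u (u + e)) \<le> prob (meet v (v + e)) + \<epsilon>"
    using uv K(2) by simp
qed

text \<open>The two comparisons require both intervals to fit into a length below \<open>D\<close>.
  Distant intervals are joined by equal steps shorter than \<open>D - e\<close>.\<close>

lemma prob_meet_const:
  assumes e: "0 < e" "e < D"
  shows "prob (meet u (u + e)) = prob (meet v (v + e))"
proof -
  let ?\<phi> = "\<lambda>u. prob (meet u (u + e))"
  have near: "?\<phi> p = ?\<phi> q" if "\<bar>p - q\<bar> < D - e" for p q
  proof (cases p q rule: linorder_cases)
    case less
    then show ?thesis using that e by (intro antisym meet_le_left meet_le_right) auto
  next
    case greater
    then show ?thesis using that e by (intro antisym meet_le_left meet_le_right) auto
  qed simp
  obtain n :: nat where "\<bar>v - u\<bar> / (D - e) < real n" using reals_Archimedean2 by blast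
  then have n: "\<bar>v - u\<bar> < real n * (D - e)" using e by (simp add: pos_divide_less_eq)
  then have n0: "0 < real n" using e by (cases n) auto
  define d where "d = (v - u) / real n"
  have d: "\<bar>d\<bar> < D - e" using n n0 by (simp add: d_def abs_div pos_divide_less_eq mult.commute)
  have "?\<phi> (u + real k * d) = ?\<phi> u" for k
  proof (induction k)
    case (Suc k)
    have "?\<phi> (u + real (Suc k) * d) = ?\<phi> (u + real k * d)"
      using d by (intro near) (simp add: algebra_simps)
    then show ?case using Suc.IH by simp
  qed simp
  from this[of n] show ?thesis using n0 by (simp add: d_def)
qed

text \<open>The \<open>n\<close> adjacent intervals span at most \<open>D\<close>, so at most one of
  them contains a point. The events are disjoint, and they are equally likely by constancy.\<close>

lemma prob_meet_le:
  assumes e: "0 < e" "real n * e \<le> D" and n: "0 < n"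
  shows "prob (meet u (u + e)) \<le> 1 / real n"
proof (cases "n = 1")
  case False
  \<comment> \<open>From \<open>n = 2\<close> on, \<open>e < D\<close> holds, as constancy requires;
    for \<open>n = 1\<close> the bound is trivial.\<close>
  then have "2 \<le> real n" using n by linarith
  then have "2 * e \<le> real n * e" using e by (intro mult_right_mono) auto
  then have eD: "e < D" using e by linarith
  define A where "A i = meet (u + real i * e) (u + real i * e + e)" for i
  have ev: "A i \<in> events" for i unfolding A_def using eD by (intro meet_event) simp
  have "disjoint_family_on A {..<n}"
  proof -
    have "A i \<inter> A j = {}" if ij: "i < j" "j < n" for i j
    proof (rule ccontr)
      assume "A i \<inter> A j \<noteq> {}"
      then obtain \<omega> x y where \<omega>: "\<omega> \<in> space M" "x \<in> N (sample_path X \<omega>)" "y \<in> N (sample_path X \<omega>)"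
        "u + real i * e < x" "x \<le> u + real i * e + e" "u + real j * e < y" "y \<le> u + real j * e + e"
        by (fastforce simp: A_def meet_def)
      have "(real i + 1) * e \<le> real j * e" "(real j + 1) * e \<le> real n * e"
        using ij e by (intro mult_right_mono; simp)+
      then have "real i * e + e \<le> real j * e" "real j * e + e \<le> real n * e"
        unfolding distrib_right by simp_all
      moreover have "0 \<le> real i * e" using e by simp
      ultimately have "x < y" "y - x < D" using \<omega> e by linarith+
      then show False using separated[OF path_C_real[OF \<omega>(1)] \<omega>(2,3)] by simp
    qed
    then show ?thesis by (auto simp: disjoint_family_on_def) (metis Int_commute linorder_neqE_nat disjoint_iff)
  qed
  then have "(\<Sum>i<n. prob (A i)) = prob (\<Union>i<n. A i)"
    using ev by (intro finite_measure_finite_Union[symmetric]) auto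
  also have "\<dots> \<le> 1" by simp
  finally have "(\<Sum>i<n. prob (A i)) \<le> 1" .
  moreover have "prob (A i) = prob (meet u (u + e))" for i
    unfolding A_def using e(1) eD by (rule prob_meet_const)
  ultimately show ?thesis using n by (simp add: field_simps)
qed simp

end

section \<open>Waiting times for a hit\<close>

locale TV_process_functional = TV_process M X + path_functional h for M X h
begin

definition no_hit :: "real \<Rightarrow> real \<Rightarrow> 'a set" where
  "no_hit s y = {\<omega> \<in> space M. \<forall>t\<in>{s..s + y}. 0 < h (sample_path X \<omega>) t}"

lemma no_hit_event: "no_hit s y \<in> events"
proof -
  have "no_hit s y = space M - (sample_path X -` {f \<in> C_real. \<exists>t\<in>{s..s + y}. h f t \<le> 0} \<inter> space M)"
  proof -
    have "(\<forall>t\<in>{s..s + y}. 0 < h (sample_path X \<omega>) t) \<longleftrightarrow> \<not> (\<exists>t\<in>{s..s + y}. h (sample_path X \<omega>) t \<le> 0)" for \<omega>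
      by (simp add: not_le)
    then show ?thesis using path_C_real unfolding no_hit_def by blast
  qed
  then show ?thesis using measurable_sets[OF path_measurable hit_measurable] by simp
qed

lemma no_hit_antimono: "y \<le> z \<Longrightarrow> no_hit s z \<subseteq> no_hit s y"
  by (auto simp: no_hit_def)

text \<open>For \<open>0 < e < D\<close> this is the expected number of gap ends in any interval of
  length \<open>e\<close>, since at most one fits; the interval at 0 serves as a
  representative.\<close>

definition rate :: "real \<Rightarrow> real \<Rightarrow> real" where
  "rate D e = prob {\<omega> \<in> space M. gap_end D (sample_path X \<omega>) \<inter> {0<..e} \<noteq> {}}"

lemma separated_gap_end:
  assumes "0 < D" shows "separated_set_process M X (gap_end D) D"
proof -
  interpret equivariant_set "gap_end D" using assms by (rule equivariant_gap_end)
  show ?thesis by unfold_locales (use assms gap_end_separated in auto)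
qed

lemma prob_gap_end:
  assumes "0 < e" "e < D"
  shows "prob {\<omega> \<in> space M. gap_end D (sample_path X \<omega>) \<inter> {u<..u + e} \<noteq> {}} = rate D e"
proof -
  interpret G: separated_set_process M X "gap_end D" D using assms by (intro separated_gap_end) simp
  show ?thesis using G.prob_meet_const[OF assms, of u 0] by (simp add: G.meet_def rate_def)
qed

lemma rate_le:
  assumes "0 < e" "real n * e \<le> D" "0 < n" "0 < D"
  shows "rate D e \<le> 1 / real n"
proof -
  interpret G: separated_set_process M X "gap_end D" D using assms by (intro separated_gap_end)
  show ?thesis using G.prob_meet_le[OF assms(1-3), of 0] by (simp add: G.meet_def rate_def)
qed

text \<open>A waiting time in \<open>(y, y + e]\<close> ends at a hit preceded by a gap of length at
  least \<open>y\<close>. Conversely, a gap of length \<open>y + e\<close> that ends in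
  \<open>(s + y, s + y + e]\<close> reaches back to \<open>s\<close>. Both bounds are free of the
  starting time \<open>s\<close>.\<close>

lemma rate_bounds:
  assumes e: "0 < e" "e < y"
  shows "rate (y + e) e \<le> prob (no_hit s y) - prob (no_hit s (y + e))"
    and "prob (no_hit s y) - prob (no_hit s (y + e)) \<le> rate y e"
proof -
  let ?E = "no_hit s y - no_hit s (y + e)"
  let ?G = "\<lambda>D. {\<omega> \<in> space M. gap_end D (sample_path X \<omega>) \<inter> {s + y<..s + y + e} \<noteq> {}}"
  have E: "prob (no_hit s y) - prob (no_hit s (y + e)) = prob ?E"
    using e by (intro finite_measure_Diff[symmetric] no_hit_event no_hit_antimono) auto
  have "?G (y + e) \<subseteq> ?E"
  proof
    fix \<omega> assume "\<omega> \<in> ?G (y + e)"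
    then obtain t where t: "\<omega> \<in> space M" "t \<in> {s + y<..s + y + e}" "h (sample_path X \<omega>) t \<le> 0"
      "\<And>q. t - (y + e) \<le> q \<Longrightarrow> q < t \<Longrightarrow> 0 < h (sample_path X \<omega>) q"
      unfolding gap_end_def by fastforce
    then show "\<omega> \<in> ?E" using e by (force simp: no_hit_def not_less intro!: bexI[of _ t])
  qed
  then have "prob (?G (y + e)) \<le> prob ?E" by (intro finite_measure_mono sets.Diff no_hit_event)
  then show "rate (y + e) e \<le> prob (no_hit s y) - prob (no_hit s (y + e))"
    unfolding E using prob_gap_end[of e "y + e" "s + y"] e by simp
  have "?E \<subseteq> ?G y"
  proof
    fix \<omega> assume \<omega>: "\<omega> \<in> ?E"
    let ?h = "h (sample_path X \<omega>)"
    obtain t where t: "\<omega> \<in> space M" "t \<in> {s..s + (y + e)}" "?h t \<le> 0"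
      and no: "\<And>q. q \<in> {s..s + y} \<Longrightarrow> 0 < ?h q"
      using \<omega> by (auto simp: no_hit_def not_less)
    obtain r where r: "s \<le> r" "r \<le> t" "?h r \<le> 0" "\<And>q. s \<le> q \<Longrightarrow> q < r \<Longrightarrow> 0 < ?h q"
      using first_hit[OF path_C_real[OF t(1)] t(3), of s] t(2) by auto
    have "s + y < r" using no[of r] r by force
    then have "r \<in> gap_end y (sample_path X \<omega>) \<inter> {s + y<..s + y + e}"
      using r t(2) by (auto simp: gap_end_def)
    then show "\<omega> \<in> ?G y" using t(1) by blast
  qed
  moreover have "?G y \<in> events"
  proof -
    interpret G: separated_set_process M X "gap_end y" y using e by (intro separated_gap_end) simp
    show ?thesis using G.meet_event[of "s + y + e" "s + y"] e by (simp add: G.meet_def)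
  qed
  ultimately have "prob ?E \<le> prob (?G y)" by (rule finite_measure_mono)
  then show "prob (no_hit s y) - prob (no_hit s (y + e)) \<le> rate y e"
    unfolding E using prob_gap_end[of e y "s + y"] e by simp
qed

text \<open>On each small piece the difference between the two starting times is squeezed between
  rates for gap lengths that differ by one step, so the sum over the pieces telescopes to a single
  rate, which is small.\<close>

lemma no_hit_increment_le:
  assumes y: "0 < y" "y < z" and m: "2 \<le> m"
  shows "(prob (no_hit s y) - prob (no_hit s z)) - (prob (no_hit r y) - prob (no_hit r z)) \<le> 1 / real m"
proof -
  \<comment> \<open>The mesh is made so fine that \<open>m\<close> steps fit into \<open>y\<close>,
    which bounds the remaining rate by \<open>1 / m\<close>; with \<open>m\<close> at least 2 it
    also gives \<open>e < y\<close>.\<close>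
  obtain n :: nat where n: "real m * (z - y) / y < real n" using reals_Archimedean2 by blast
  define e where "e = (z - y) / real n"
  have "0 \<le> real m * (z - y) / y" using y by simp
  then have n0: "0 < real n" using n by linarith
  have e: "0 < e" "real m * e \<le> y" "y + real n * e = z"
  proof -
    show "0 < e" "y + real n * e = z" using y n0 by (auto simp: e_def)
    have "real m * (z - y) < real n * y" using n y by (simp add: pos_divide_less_eq)
    then show "real m * e \<le> y" using n0 by (simp add: e_def pos_divide_le_eq mult.commute)
  qed
  have "2 * e \<le> real m * e" using m e by (intro mult_right_mono) auto
  then have ey: "e < y" using e by linarith
  define Y where "Y i = y + real i * e" for i
  have Y: "Y (Suc i) = Y i + e" "e < Y i" for i
    using ey e(1) by (auto simp: Y_def algebra_simps intro!: add_pos_nonneg less_le_trans[OF ey])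
  have tel: "prob (no_hit p y) - prob (no_hit p z) = (\<Sum>i<n. prob (no_hit p (Y i)) - prob (no_hit p (Y i + e)))" for p
    using sum_lessThan_telescope'[of "\<lambda>i. prob (no_hit p (Y i))" n] e(3) by (simp add: Y(1)) (simp add: Y_def)
  have "(prob (no_hit s y) - prob (no_hit s z)) - (prob (no_hit r y) - prob (no_hit r z)) =
      (\<Sum>i<n. (prob (no_hit s (Y i)) - prob (no_hit s (Y i + e)))
        - (prob (no_hit r (Y i)) - prob (no_hit r (Y i + e))))"
    unfolding tel sum_subtractf by simp
  also have "\<dots> \<le> (\<Sum>i<n. rate (Y i) e - rate (Y (Suc i)) e)"
  proof (rule sum_mono)
    fix i
    show "(prob (no_hit s (Y i)) - prob (no_hit s (Y i + e)))
        - (prob (no_hit r (Y i)) - prob (no_hit r (Y i + e))) \<le> rate (Y i) e - rate (Y (Suc i)) e"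
      using rate_bounds(2)[OF e(1) Y(2), of s i] rate_bounds(1)[OF e(1) Y(2), of i r] by (simp add: Y(1))
  qed
  also have "\<dots> = rate (Y 0) e - rate (Y n) e" by (rule sum_lessThan_telescope')
  also have "\<dots> \<le> rate y e" by (simp add: Y_def rate_def)
  also have "\<dots> \<le> 1 / real m" using e y m by (intro rate_le) auto
  finally show ?thesis .
qed

lemma no_hit_increment_const:
  assumes y: "0 < y" "y < z"
  shows "prob (no_hit s y) - prob (no_hit s z) = prob (no_hit r y) - prob (no_hit r z)"
proof -
  have le: "prob (no_hit s y) - prob (no_hit s z) \<le> prob (no_hit r y) - prob (no_hit r z)" for s r
  proof (rule field_le_epsilon)
    fix \<epsilon> :: real assume "0 < \<epsilon>"
    then obtain m where m: "1 / real (Suc m) < \<epsilon>" by (rule nat_approx_posE)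
    have "1 / real (Suc m + 1) \<le> 1 / real (Suc m)" by (intro frac_le) auto
    then show "prob (no_hit s y) - prob (no_hit s z) \<le> prob (no_hit r y) - prob (no_hit r z) + \<epsilon>"
      using no_hit_increment_le[OF y, of "Suc m + 1" s r] m by simp
  qed
  show ?thesis using le[of s r] le[of r s] by simp
qed

lemma prob_positive_mono:
  assumes sr: "s \<le> r"
  shows "prob {\<omega> \<in> space M. 0 < h (sample_path X \<omega>) s} \<le> prob {\<omega> \<in> space M. 0 < h (sample_path X \<omega>) r}"
proof -
  let ?\<psi> = "\<lambda>s. prob {\<omega> \<in> space M. 0 < h (sample_path X \<omega>) s}"
  let ?\<kappa> = "\<lambda>s. prob {\<omega> \<in> space M. \<forall>t\<ge>s. 0 < h (sample_path X \<omega>) t}"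
  have Un: "(\<Union>n. no_hit s (1 / real (Suc n))) = {\<omega> \<in> space M. 0 < h (sample_path X \<omega>) s}" for s
  proof (intro equalityI subsetI)
    fix \<omega> assume "\<omega> \<in> {\<omega> \<in> space M. 0 < h (sample_path X \<omega>) s}"
    then have \<omega>: "\<omega> \<in> space M" "0 < h (sample_path X \<omega>) s" by auto
    have "isCont (h (sample_path X \<omega>)) s"
      using continuous[OF path_C_real[OF \<omega>(1)]] by (simp add: continuous_on_eq_continuous_at)
    then have "\<forall>\<^sub>F t in at s. 0 < h (sample_path X \<omega>) t"
      using \<omega>(2) by (intro order_tendstoD) (auto simp: isCont_def)
    then obtain d where d: "0 < d" "\<And>t. t \<noteq> s \<Longrightarrow> dist t s < d \<Longrightarrow> 0 < h (sample_path X \<omega>) t"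
      by (auto simp: eventually_at)
    obtain n where n: "1 / real (Suc n) < d" using d(1) by (rule nat_approx_posE)
    have "0 < h (sample_path X \<omega>) t" if "t \<in> {s..s + 1 / real (Suc n)}" for t
    proof (cases "t = s")
      case False
      moreover have "dist t s < d" using that n unfolding dist_real_def atLeastAtMost_iff by linarith
      ultimately show ?thesis by (rule d(2))
    qed (use \<omega> in simp)
    then have "\<omega> \<in> no_hit s (1 / real (Suc n))" using \<omega>(1) unfolding no_hit_def by blast
    then show "\<omega> \<in> (\<Union>n. no_hit s (1 / real (Suc n)))" by blast
  qed (auto simp: no_hit_def)
  have In: "(\<Inter>n. no_hit s (real (Suc (Suc n)))) = {\<omega> \<in> space M. \<forall>t\<ge>s. 0 < h (sample_path X \<omega>) t}" for s
  proof (intro equalityI subsetI)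
    fix \<omega> assume \<omega>: "\<omega> \<in> (\<Inter>n. no_hit s (real (Suc (Suc n))))"
    have "0 < h (sample_path X \<omega>) t" if "s \<le> t" for t
    proof -
      obtain n where "t - s \<le> real n" using real_arch_simple by blast
      then have "t \<in> {s..s + real (Suc (Suc n))}" using that by simp
      then show ?thesis using \<omega> by (fastforce simp: no_hit_def)
    qed
    then show "\<omega> \<in> {\<omega> \<in> space M. \<forall>t\<ge>s. 0 < h (sample_path X \<omega>) t}" using \<omega> by (auto simp: no_hit_def)
  qed (auto simp: no_hit_def)
  have lim1: "(\<lambda>n. prob (no_hit s (1 / real (Suc n)))) \<longlonglongrightarrow> ?\<psi> s" for s
    unfolding Un[symmetric]
    by (intro finite_Lim_measure_incseq) (auto intro!: no_hit_event incseq_SucI no_hit_antimono frac_le)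
  have lim2: "(\<lambda>n. prob (no_hit s (real (Suc (Suc n))))) \<longlonglongrightarrow> ?\<kappa> s" for s
    unfolding In[symmetric]
    by (intro finite_Lim_measure_decseq) (auto intro!: no_hit_event decseq_SucI no_hit_antimono)
  \<comment> \<open>The sequences \<open>1 / (n + 1)\<close> and \<open>n + 2\<close> tend to 0 and
    infinity and are strictly ordered already at \<open>n = 0\<close>, as constancy of the
    increments requires.\<close>
  have lim: "(\<lambda>n. prob (no_hit p (1 / real (Suc n))) - prob (no_hit p (real (Suc (Suc n))))) \<longlonglongrightarrow> ?\<psi> p - ?\<kappa> p" for p
    by (intro tendsto_diff lim1 lim2)
  have eq: "prob (no_hit s (1 / real (Suc n))) - prob (no_hit s (real (Suc (Suc n)))) =
      prob (no_hit r (1 / real (Suc n))) - prob (no_hit r (real (Suc (Suc n))))" for n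
  proof (rule no_hit_increment_const)
    have "1 / real (Suc n) \<le> 1" "1 < real (Suc (Suc n))" by simp_all
    then show "1 / real (Suc n) < real (Suc (Suc n))" by (rule le_less_trans)
  qed simp
  have "?\<psi> s - ?\<kappa> s = ?\<psi> r - ?\<kappa> r"
    by (rule LIMSEQ_unique[OF lim[of s, unfolded eq] lim[of r]])
  moreover have "?\<kappa> s \<le> ?\<kappa> r"
  proof (rule finite_measure_mono)
    show "{\<omega> \<in> space M. \<forall>t\<ge>r. 0 < h (sample_path X \<omega>) t} \<in> events"
      unfolding In[symmetric] using no_hit_event by (intro sets.countable_INT) auto
  qed (use sr in auto)
  ultimately show ?thesis by simp
qed

end

context TV_process
begin

lemma prob_functional_positive_mono:
  assumes "path_functional k" "s \<le> r"
  shows "prob {\<omega> \<in> space M. 0 < k (sample_path X \<omega>) s} \<le> prob {\<omega> \<in> space M. 0 < k (sample_path X \<omega>) r}"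
proof -
  interpret path_functional k by fact
  interpret TV_process_functional M X k ..
  show ?thesis using assms(2) by (rule prob_positive_mono)
qed

lemma stationary_of_TV: "stationary_process M X"
proof (rule stationaryI)
  fix h s t assume h: "path_functional h"
  interpret H: path_functional h by fact
  let ?h = "\<lambda>\<omega>. h (sample_path X \<omega>)"
  have [measurable]: "(\<lambda>\<omega>. ?h \<omega> s) \<in> borel_measurable M" for s
    by (rule functional_measurable[OF h])
  note pos = prob_functional_positive_mono
  have compl: "prob {\<omega> \<in> space M. ?h \<omega> s \<le> 0} = 1 - prob {\<omega> \<in> space M. 0 < ?h \<omega> s}" for s
    by (subst prob_neg[symmetric]) (auto simp: not_less)
  have nonpos: "prob {\<omega> \<in> space M. ?h \<omega> s \<le> 0} \<le> prob {\<omega> \<in> space M. ?h \<omega> r \<le> 0}" if "s \<le> r" for s r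
  proof -
    have lim: "(\<lambda>n. prob {\<omega> \<in> space M. 0 < 1 / real (Suc n) - ?h \<omega> s}) \<longlonglongrightarrow> prob {\<omega> \<in> space M. ?h \<omega> s \<le> 0}" for s
    proof -
      have "(\<Inter>n. {\<omega> \<in> space M. 0 < 1 / real (Suc n) - ?h \<omega> s}) = {\<omega> \<in> space M. ?h \<omega> s \<le> 0}"
      proof (intro equalityI subsetI)
        fix \<omega> assume \<omega>: "\<omega> \<in> (\<Inter>n. {\<omega> \<in> space M. 0 < 1 / real (Suc n) - ?h \<omega> s})"
        then have "0 < 1 / real (Suc n) - ?h \<omega> s" for n by blast
        then have "?h \<omega> s \<le> 1 / real (Suc n)" for n by (metis diff_gt_0_iff_gt less_imp_le)
        then have "?h \<omega> s \<le> 0" by (intro LIMSEQ_le_const[OF LIMSEQ_Suc[OF lim_1_over_n]]) auto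
        then show "\<omega> \<in> {\<omega> \<in> space M. ?h \<omega> s \<le> 0}" using \<omega> by auto
      next
        fix \<omega> assume \<omega>: "\<omega> \<in> {\<omega> \<in> space M. ?h \<omega> s \<le> 0}"
        have "0 < 1 / real (Suc n) - ?h \<omega> s" for n
        proof -
          have "0 < 1 / real (Suc n)" by simp
          moreover have "?h \<omega> s \<le> 0" using \<omega> by simp
          ultimately show ?thesis by linarith
        qed
        then show "\<omega> \<in> (\<Inter>n. {\<omega> \<in> space M. 0 < 1 / real (Suc n) - ?h \<omega> s})" using \<omega> by auto
      qed
      moreover have "decseq (\<lambda>n. {\<omega> \<in> space M. 0 < 1 / real (Suc n) - ?h \<omega> s})"
      proof (rule decseq_SucI)
        fix n
        have "1 / real (Suc (Suc n)) \<le> 1 / real (Suc n)" by (intro frac_le) auto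
        then show "{\<omega> \<in> space M. 0 < 1 / real (Suc (Suc n)) - ?h \<omega> s} \<subseteq> {\<omega> \<in> space M. 0 < 1 / real (Suc n) - ?h \<omega> s}"
          by auto
      qed
      moreover have "range (\<lambda>n. {\<omega> \<in> space M. 0 < 1 / real (Suc n) - ?h \<omega> s}) \<subseteq> events"
        by (intro image_subsetI) measurable
      ultimately show ?thesis
        using finite_Lim_measure_decseq[of "\<lambda>n. {\<omega> \<in> space M. 0 < 1 / real (Suc n) - ?h \<omega> s}"] by simp
    qed
    \<comment> \<open>The complementary event is not of the form treated so far, but it is a
      decreasing limit of positivity events of these functionals. Its probability is thus
      nondecreasing as well, which leaves only constancy.\<close>
    have "path_functional (\<lambda>f t. 1 / real (Suc n) - h f t)" for n
      by unfold_locales (auto intro!: continuous_intros H.continuous simp: H.shift)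
    then have "prob {\<omega> \<in> space M. 0 < 1 / real (Suc n) - ?h \<omega> s} \<le> prob {\<omega> \<in> space M. 0 < 1 / real (Suc n) - ?h \<omega> r}" for n
      using pos that by blast
    then show ?thesis by (intro LIMSEQ_le[OF lim lim]) auto
  qed
  have eq: "prob {\<omega> \<in> space M. ?h \<omega> s \<le> 0} = prob {\<omega> \<in> space M. ?h \<omega> r \<le> 0}" if "s \<le> r" for s r
    using nonpos[OF that] pos[OF h that] compl[of s] compl[of r] by linarith
  show "prob {\<omega> \<in> space M. ?h \<omega> s \<le> 0} = prob {\<omega> \<in> space M. ?h \<omega> t \<le> 0}"
  proof (cases "s \<le> t")
    case True
    then show ?thesis by (rule eq)
  next
    case False
    then show ?thesis by (intro eq[symmetric]) simp
  qed
qed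

end

theorem corollary4p5:
  fixes M :: "'w measure" and X :: "real \<Rightarrow> 'w \<Rightarrow> real"
  assumes "prob_space M"
    and "\<And>t. X t \<in> borel_measurable M"
    and "\<And>\<omega>. \<omega> \<in> space M \<Longrightarrow> continuous_on UNIV (sample_path X \<omega>)"
  shows "(stationary_process M X \<longleftrightarrow>
          (\<forall>T>0. \<forall>L\<in>local_intrinsic_location T. \<forall>a b.
             distr M real_inf (\<lambda>\<omega>. L (sample_path X \<omega>) a - ereal a) =
             distr M real_inf (\<lambda>\<omega>. L (sample_path X \<omega>) b - ereal b)))
       \<and> (stationary_process M X \<longleftrightarrow>
          (\<forall>T>0. \<forall>L\<in>local_intrinsic_location T. \<forall>a.
             \<exists>f. has_density_on M (\<lambda>\<omega>. L (sample_path X \<omega>) a) a (a + T) f \<and>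
                 TV_constraints a (a + T) f))"
proof -
  interpret prob_space M by fact
  interpret continuous_process M X by unfold_locales (use assms in auto)
  show ?thesis
  proof (intro conjI iffI allI impI ballI)
    fix T a b :: real and L
    assume "stationary_process M X" "L \<in> local_intrinsic_location T"
    then show "distr M real_inf (\<lambda>\<omega>. L (sample_path X \<omega>) a - ereal a) =
        distr M real_inf (\<lambda>\<omega>. L (sample_path X \<omega>) b - ereal b)"
      by (simp only: stationary_location_law)
  next
    fix T a :: real and L
    assume "stationary_process M X" "0 < T" "L \<in> local_intrinsic_location T"
    then interpret stationary_location M X L T a by unfold_locales
    show "\<exists>f. has_density_on M (\<lambda>\<omega>. L (sample_path X \<omega>) a) a (a + T) f \<and> TV_constraints a (a + T) f"
      by (rule location_TV_density)
  next
    assume TV: "\<forall>T>0. \<forall>L\<in>local_intrinsic_location T. \<forall>a. \<exists>f.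
      has_density_on M (\<lambda>\<omega>. L (sample_path X \<omega>) a) a (a + T) f \<and> TV_constraints a (a + T) f"
    interpret TV_process M X by unfold_locales (rule TV[rule_format])
    show "stationary_process M X" by (rule stationary_of_TV)
  qed (rule stationary_of_location_laws)
qed

end
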